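(* Let $\theta$ be a scalar correlation parameter. In the Universal Kriging model $\boldsymbol y\mid\boldsymbol\beta,\sigma^2,\theta\sim\mathcal N(\boldsymbol H\boldsymbol\beta,\sigma^2\boldsymbol\Sigma_\theta)$, the reference prior on $\theta$ is $$\pi(\theta)\propto\sqrt{\mathrm{Tr}\left[\left\{\boldsymbol W^\top\frac{\partial\boldsymbol\Sigma_\theta}{\partial\theta}\boldsymbol W\left(\boldsymbol W^\top\boldsymbol\Sigma_\theta\boldsymbol W\right)^{-1}\right\}^2\right]-\frac1{n-p}\left[\mathrm{Tr}\left\{\boldsymbol W^\top\frac{\partial\boldsymbol\Sigma_\theta}{\partial\theta}\boldsymbol W\left(\boldsymbol W^\top\boldsymbol\Sigma_\theta\boldsymbol W\right)^{-1}\right\}\right]^2},$$ where $\propto$ means equality up to a positive factor not depending on $\theta$.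
   Context: $n>p\ge0$ are integers; $\boldsymbol H$ is a fixed real $n\times p$ matrix of rank $p$; $\boldsymbol\beta\in\mathbb R^p$, $\sigma^2>0$; $\theta$ ranges over an open interval and $\theta\mapsto\boldsymbol\Sigma_\theta$ is a differentiable family of nonsingular $n\times n$ correlation matrices. $\boldsymbol W$ is an $n\times(n-p)$ matrix of full rank whose columns span the orthogonal complement of the column space of $\boldsymbol H$ (so $\boldsymbol W^\top\boldsymbol H=0$). Let $L(\boldsymbol y\mid\boldsymbol\beta,\sigma^2,\theta)$ be the density of $\mathcal N(\boldsymbol H\boldsymbol\beta,\sigma^2\boldsymbol\Sigma_\theta)$. Conditionally on $\theta$, the reference prior on $(\boldsymbol\beta,\sigma^2)$ is $\pi(\boldsymbol\beta,\sigma^2\mid\theta)\propto1/\sigma^2$, and the integrated likelihood is $L^1(\boldsymbol y\mid\theta)=\iint L(\boldsymbol y\mid\boldsymbol\beta,\sigma^2,\theta)\,\sigma^{-2}\,d\boldsymbol\beta\,d\sigma^2$. The reference prior on the scalar $\theta$ (with $(\boldsymbol\beta,\sigma^2)$ integrated out) is the Jeffreys prior of the integrated model: $\pi(\theta)\propto\sqrt{\mathrm{Var}[\partial_\theta\log L^1(\boldsymbol y\mid\theta)]}$, the variance being taken for $\boldsymbol y\sim\mathcal N(\boldsymbol H\boldsymbol\beta,\sigma^2\boldsymbol\Sigma_\theta)$ (it does not depend on $\boldsymbol\beta,\sigma^2$). *)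

theory Defs
  imports "HOL-Probability.Probability" "Jordan_Normal_Form.DL_Rank"
    "Jordan_Normal_Form.Gauss_Jordan_Elimination"
begin

(* Both HOL-Analysis and Jordan_Normal_Form provide vectors, matrices and determinants;
   here the unqualified names refer to the latter, whose dimensions are natural numbers. *)
hide_const (open) Finite_Cartesian_Product.vec Finite_Cartesian_Product.mat
  Determinants.det Cartesian_Space.rank
no_notation inner (infix "\<bullet>" 70)

definition mtrace :: "real mat \<Rightarrow> real" where
  "mtrace A = (\<Sum>i<dim_row A. A $$ (i, i))"

(* Only meaningful for nonsingular A: mat_inverse returns None for every other matrix. *)
definition minv :: "real mat \<Rightarrow> real mat" where
  "minv A = the (mat_inverse A)"

definition correlation_mat :: "nat \<Rightarrow> real mat \<Rightarrow> bool" where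
  "correlation_mat n A \<longleftrightarrow> A \<in> carrier_mat n n \<and> transpose_mat A = A \<and>
     (\<forall>i<n. A $$ (i, i) = 1) \<and> (\<forall>v\<in>carrier_vec n. 0 \<le> v \<bullet> (A *\<^sub>v v))"

definition mat_differentiable :: "nat \<Rightarrow> (real \<Rightarrow> real mat) \<Rightarrow> real \<Rightarrow> bool" where
  "mat_differentiable n A \<theta> \<longleftrightarrow> (\<forall>i<n. \<forall>j<n. (\<lambda>t. A t $$ (i, j)) differentiable (at \<theta>))"

definition mat_deriv :: "(real \<Rightarrow> real mat) \<Rightarrow> real \<Rightarrow> real mat" where
  "mat_deriv A \<theta> = mat (dim_row (A \<theta>)) (dim_col (A \<theta>)) (\<lambda>ij. deriv (\<lambda>t. A t $$ ij) \<theta>)"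

definition orth_complement :: "nat \<Rightarrow> real vec set \<Rightarrow> real vec set" where
  "orth_complement n U = {v \<in> carrier_vec n. \<forall>u\<in>U. u \<bullet> v = 0}"

(* Lebesgue measure on R^n; a point is a function on {..<n}, and vec n turns it into a vector.
   For n = 0 this is the unit mass at the single point of R^0. *)
definition lebesgue_Rn :: "nat \<Rightarrow> (nat \<Rightarrow> real) measure" where
  "lebesgue_Rn n = (\<Pi>\<^sub>M i\<in>{..<n}. lborel)"

definition mvn_density :: "nat \<Rightarrow> real vec \<Rightarrow> real mat \<Rightarrow> real vec \<Rightarrow> real" where
  "mvn_density n \<mu> C y =
     exp (- ((y - \<mu>) \<bullet> (minv C *\<^sub>v (y - \<mu>))) / 2) / sqrt ((2 * pi) ^ n * det C)"

definition mvn :: "nat \<Rightarrow> real vec \<Rightarrow> real mat \<Rightarrow> (nat \<Rightarrow> real) measure" where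
  "mvn n \<mu> C = density (lebesgue_Rn n) (\<lambda>y. ennreal (mvn_density n \<mu> C (vec n y)))"

(* In the Universal Kriging definitions the parameter s stands for the variance sigma^2. *)
definition uk_likelihood ::
  "nat \<Rightarrow> real mat \<Rightarrow> (real \<Rightarrow> real mat) \<Rightarrow> real vec \<Rightarrow> real \<Rightarrow> real \<Rightarrow> (nat \<Rightarrow> real) \<Rightarrow> real" where
  "uk_likelihood n H \<Sigma> \<beta> s \<theta> y = mvn_density n (H *\<^sub>v \<beta>) (s \<cdot>\<^sub>m \<Sigma> \<theta>) (vec n y)"

definition uk_distr ::
  "nat \<Rightarrow> real mat \<Rightarrow> (real \<Rightarrow> real mat) \<Rightarrow> real vec \<times> real \<Rightarrow> real \<Rightarrow> (nat \<Rightarrow> real) measure" where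
  "uk_distr n H \<Sigma> = (\<lambda>(\<beta>, s) \<theta>. mvn n (H *\<^sub>v \<beta>) (s \<cdot>\<^sub>m \<Sigma> \<theta>))"

definition uk_integrated_likelihood ::
  "nat \<Rightarrow> nat \<Rightarrow> real mat \<Rightarrow> (real \<Rightarrow> real mat) \<Rightarrow> real \<Rightarrow> (nat \<Rightarrow> real) \<Rightarrow> real" where
  "uk_integrated_likelihood n p H \<Sigma> \<theta> y =
     (\<integral>(b, s). indicator {0<..} s * (uk_likelihood n H \<Sigma> (vec p b) s \<theta> y * (1 / s))
        \<partial>(lebesgue_Rn p \<Otimes>\<^sub>M lborel))"

definition score :: "(real \<Rightarrow> 'y \<Rightarrow> real) \<Rightarrow> real \<Rightarrow> 'y \<Rightarrow> real" where
  "score L \<theta> y = deriv (\<lambda>t. ln (L t y)) \<theta>"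

definition variance_of :: "'y measure \<Rightarrow> ('y \<Rightarrow> real) \<Rightarrow> real" where
  "variance_of M X = (LINT y|M. (X y - (LINT z|M. X z))\<^sup>2)"

(* The likelihood L of a scalar parameter in I has its nuisance parameters already integrated
   out, while the sampling distributions P still carry them (ranging over N); the Fisher
   information must not depend on them. Since the Bochner integral, ln and deriv are total
   functions, the definition also demands that the quantities involved really exist. In
   particular positivity of a likelihood given by an integral says that this integral
   converges, as a divergent one has the value 0. *)
definition is_jeffreys_prior ::
  "real set \<Rightarrow> 'a set \<Rightarrow> ('a \<Rightarrow> real \<Rightarrow> 'y measure) \<Rightarrow> (real \<Rightarrow> 'y \<Rightarrow> real) \<Rightarrow> (real \<Rightarrow> real) \<Rightarrow> bool" where
  "is_jeffreys_prior I N P L \<pi> \<longleftrightarrow>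
     (\<exists>k>0. \<forall>\<theta>\<in>I. \<forall>\<nu>\<in>N.
        prob_space (P \<nu> \<theta>) \<and>
        (AE y in P \<nu> \<theta>. (\<forall>t\<in>I. 0 < L t y) \<and> (\<lambda>t. ln (L t y)) differentiable (at \<theta>)) \<and>
        integrable (P \<nu> \<theta>) (score L \<theta>) \<and>
        integrable (P \<nu> \<theta>) (\<lambda>y. (score L \<theta> y)\<^sup>2) \<and>
        \<pi> \<theta> = k * sqrt (variance_of (P \<nu> \<theta>) (score L \<theta>)))"

definition uk_reference_prior ::
  "nat \<Rightarrow> nat \<Rightarrow> real mat \<Rightarrow> (real \<Rightarrow> real mat) \<Rightarrow> real set \<Rightarrow> (real \<Rightarrow> real) \<Rightarrow> bool" where
  "uk_reference_prior n p H \<Sigma> I \<pi> \<longleftrightarrow>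
     is_jeffreys_prior I (carrier_vec p \<times> {0<..}) (uk_distr n H \<Sigma>)
       (uk_integrated_likelihood n p H \<Sigma>) \<pi>"

end

theory Submission
  imports Defs "HOL-Real_Asymp.Real_Asymp"
begin

text \<open>
  Write \<open>m = n - p\<close>, \<open>G = W\<^sup>T \<Sigma> W\<close> and \<open>z = W\<^sup>T y\<close>, and let a prime denote the derivative in
  \<open>\<theta>\<close>. The proof computes the integrated likelihood explicitly, so that its score becomes a ratio
  of two quadratic forms in \<open>z\<close>, and then computes the variance of that ratio.

  The integrated likelihood. The columns of \<open>H\<close> and of \<open>\<Sigma> W\<close> together form a basis of the
  sample space, and the two groups are orthogonal for the inner product given by the inverse of
  \<open>\<Sigma>\<close>. Hence the exponent of the likelihood is, up to the factor \<open>- 1 / (2 * s)\<close>, the sum of a quadratic form in \<open>\<beta>\<close>, centred at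
  the generalised least squares estimate, and of \<open>q = z\<^sup>T G\<^sup>-\<^sup>1 z\<close>
  (\<open>residual_decomposition\<close>). The determinant of the form in \<open>\<beta>\<close>, times that of \<open>\<Sigma>\<close>, is a
  constant multiple of \<open>det G\<close> (\<open>det_mean_precision\<close>). Integrating over \<open>\<beta>\<close> therefore leaves,
  up to a constant, \<open>(det G) powr (- 1/2)\<close> times the integral of
  \<open>s powr (- 1 - m/2) * exp (- q / (2 * s))\<close> over \<open>s > 0\<close>, which is a constant multiple of
  \<open>q powr (- m/2)\<close> by the substitution \<open>s = q * u\<close>. So the logarithm of the integrated likelihood
  is \<open>const - ln (det G) / 2 - m/2 * ln q\<close>, and its score is \<open>a \<theta> + m/2 * R\<close>, where \<open>R\<close> is the
  quotient of \<open>z\<^sup>T G\<^sup>-\<^sup>1 G' G\<^sup>-\<^sup>1 z\<close> by \<open>q\<close> and \<open>a \<theta>\<close> is not random. Only the variance of \<open>R\<close>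
  matters, and the derivative of \<open>ln (det G)\<close> need not be evaluated: it suffices that it exists.

  The variance. As \<open>R\<close> does not change when \<open>G\<close> and \<open>G'\<close> are multiplied by the same number, it may be
  computed for \<open>s = 1\<close> (\<open>contrast_ratio_smult\<close>). The denominator of \<open>R\<^sup>2\<close> is removed by \<open>1 / q\<^sup>2 = \<integral> t * exp (- t * q) dt\<close> over
  \<open>t > 0\<close>. Multiplying the Gaussian density of \<open>y\<close> by \<open>exp (- t * q)\<close> gives another Gaussian
  density up to a factor; its precision matrix, its determinant and the covariance of \<open>z\<close> under
  it are explicit (\<open>det_tilted_precision\<close>, \<open>contrast_cov_tilted\<close>). With \<open>M = G' G\<^sup>-\<^sup>1\<close>, the second moment
  of a Gaussian quadratic form then gives the expectation of \<open>(q * R)\<^sup>2 * exp (- t * q)\<close> as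
  \<open>((tr M)\<^sup>2 + 2 * tr (M\<^sup>2)) * (1 + 2 * t) powr (- 2 - m/2)\<close>, and integrating \<open>t\<close> times this shows
  that the second moment of \<open>R\<close> is \<open>((tr M)\<^sup>2 + 2 * tr (M\<^sup>2)) / (m * (m + 2))\<close>. Replacing \<open>G'\<close> by
  \<open>G' + G\<close> replaces \<open>R\<close> by \<open>R + 1\<close>, so the same formula also yields the mean \<open>tr M / m\<close>. Hence
  the score has variance \<open>m / (2 * (m + 2)) * (tr (M\<^sup>2) - (tr M)\<^sup>2 / m)\<close>.

  All Gaussian integrals are reduced to the standard one by a Cholesky factorisation and a
  triangular substitution, and the latter to Tonelli's theorem and one-dimensional affine
  substitutions.
\<close>

no_notation Finite_Cartesian_Product.vec_nth (infixl "$" 90)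

section \<open>Inverses, quadratic forms and traces\<close>

lemma minv_inverse:
  assumes A: "A \<in> carrier_mat n n" and "det A \<noteq> 0"
  shows minv_carrier: "minv A \<in> carrier_mat n n"
    and minv_right: "A * minv A = 1\<^sub>m n"
    and minv_left: "minv A * A = 1\<^sub>m n"
proof -
  have U: "A \<in> Units (ring_mat TYPE(real) n undefined)"
    using det_non_zero_imp_unit[OF A assms(2)] .
  then obtain B where B: "mat_inverse A = Some B"
    using mat_inverse(1)[OF A] by (metis option.exhaust)
  from mat_inverse(2)[OF A B] show "minv A \<in> carrier_mat n n" "A * minv A = 1\<^sub>m n" "minv A * A = 1\<^sub>m n"
    by (auto simp: minv_def B)
qed

lemma minv_unique:
  assumes A: "A \<in> carrier_mat n n" and B: "B \<in> carrier_mat n n" and AB: "A * B = 1\<^sub>m n"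
  shows "det A \<noteq> 0" and "minv A = B"
proof -
  have "det A * det B = 1" using det_mult[OF A B] AB by simp
  then show d: "det A \<noteq> 0" by auto
  have "minv A = minv A * (A * B)" using AB minv_carrier[OF A d] by simp
  also have "\<dots> = B" using minv_left[OF A d] A B minv_carrier[OF A d]
    by (simp flip: assoc_mult_mat)
  finally show "minv A = B" .
qed

lemma invertible_mat_det:
  assumes "A \<in> carrier_mat n n" "invertible_mat (A :: real mat)"
  shows "det A \<noteq> 0"
proof -
  from assms obtain B where B: "inverts_mat A B" "inverts_mat B A" unfolding invertible_mat_def by auto
  then have *: "A * B = 1\<^sub>m n" "B * A = 1\<^sub>m (dim_row B)" using assms(1) by (auto simp: inverts_mat_def)
  have "dim_row (B * A) = dim_row B" "dim_col (B * A) = n" "dim_col (A * B) = dim_col B" using assms(1) by auto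
  then have "B \<in> carrier_mat n n" using * by auto
  then show ?thesis using minv_unique(1)[OF assms(1) _ *(1)] by auto
qed

lemma mult_mat_zero_vec: "A \<in> carrier_mat n k \<Longrightarrow> A *\<^sub>v 0\<^sub>v k = (0\<^sub>v n :: real vec)"
  by (intro eq_vecI) auto

lemma zero_mat_mult_vec: "v \<in> carrier_vec k \<Longrightarrow> 0\<^sub>m n k *\<^sub>v v = (0\<^sub>v n :: real vec)"
  by (intro eq_vecI) auto

lemma smult_mat_mult_vec: "A \<in> carrier_mat n k \<Longrightarrow> v \<in> carrier_vec k \<Longrightarrow> (c \<cdot>\<^sub>m A) *\<^sub>v v = c \<cdot>\<^sub>v (A *\<^sub>v (v :: real vec))"
  by (intro eq_vecI) auto

lemma transpose_smult: "transpose_mat (c \<cdot>\<^sub>m A) = c \<cdot>\<^sub>m transpose_mat A"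
  by (intro eq_matI) auto

lemma minv_smult:
  assumes "A \<in> carrier_mat n n" "det A \<noteq> 0" "s \<noteq> 0"
  shows "minv (s \<cdot>\<^sub>m A) = (1 / s) \<cdot>\<^sub>m minv A"
proof (rule minv_unique(2))
  note mc = minv_carrier[OF assms(1,2)]
  show "(s \<cdot>\<^sub>m A) * ((1 / s) \<cdot>\<^sub>m minv A) = 1\<^sub>m n"
    using mult_smult_assoc_mat[OF assms(1) smult_carrier_mat[OF mc]] mult_smult_distrib[OF assms(1) mc]
      minv_right[OF assms(1,2)] assms(3) by (simp, intro eq_matI) auto
qed (use assms minv_carrier in auto)

lemma quadratic_form_sum:
  assumes "A \<in> carrier_mat n k" "u \<in> carrier_vec n" "v \<in> carrier_vec k"
  shows "u \<bullet> (A *\<^sub>v v) = (\<Sum>i<n. \<Sum>j<k. u $ i * A $$ (i, j) * (v $ j :: real))"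
  using assms by (auto simp: scalar_prod_def atLeast0LessThan sum_distrib_left mult.assoc intro!: sum.cong)

lemma scalar_prod_mult_mat_vec:
  assumes "T \<in> carrier_mat n k" "u \<in> carrier_vec n" "v \<in> carrier_vec k"
  shows "u \<bullet> (T *\<^sub>v (v :: real vec)) = (transpose_mat T *\<^sub>v u) \<bullet> v"
  using transpose_vec_mult_scalar[of T n k v u] assms by simp

lemma quadratic_form_congruence:
  assumes "A \<in> carrier_mat n n" "T \<in> carrier_mat n k" "v \<in> carrier_vec k"
  shows "v \<bullet> ((transpose_mat T * A * T) *\<^sub>v v) = (T *\<^sub>v v) \<bullet> (A *\<^sub>v (T *\<^sub>v (v :: real vec)))"
proof -
  have "v \<bullet> ((transpose_mat T * A * T) *\<^sub>v v) = v \<bullet> (transpose_mat T *\<^sub>v (A *\<^sub>v (T *\<^sub>v v)))"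
    using assms by (simp add: assoc_mult_mat_vec[of _ k n _ k] assoc_mult_mat_vec[of _ k n _ n])
  also have "\<dots> = (T *\<^sub>v v) \<bullet> (A *\<^sub>v (T *\<^sub>v v))"
    using assms by (subst scalar_prod_mult_mat_vec[of _ k n]) auto
  finally show ?thesis .
qed

lemma mtrace_comm:
  assumes "A \<in> carrier_mat n k" "B \<in> carrier_mat k n"
  shows "mtrace (A * B) = mtrace (B * A)"
proof -
  have "mtrace (A * B) = (\<Sum>i<n. \<Sum>j<k. A $$ (i,j) * B $$ (j,i))"
    using assms by (simp add: mtrace_def scalar_prod_def atLeast0LessThan)
  also have "\<dots> = (\<Sum>j<k. \<Sum>i<n. B $$ (j,i) * A $$ (i,j))"
    by (subst sum.swap) (simp add: mult.commute)
  also have "\<dots> = mtrace (B * A)"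
    using assms by (simp add: mtrace_def scalar_prod_def atLeast0LessThan)
  finally show ?thesis .
qed

lemma mtrace_smult: "mtrace (c \<cdot>\<^sub>m A) = c * mtrace A" if "A \<in> carrier_mat n n"
  using that by (simp add: mtrace_def sum_distrib_left)

lemma mtrace_add: "mtrace (A + B) = mtrace A + mtrace B" if "A \<in> carrier_mat n n" "B \<in> carrier_mat n n"
  using that by (simp add: mtrace_def sum.distrib)

text \<open>
  Moves the factor \<open>W\<close> of a congruence around the trace, so that traces of \<open>n\<close> by \<open>n\<close> matrices become
  traces of matrices of the size of \<open>N\<close>.
\<close>
lemma mtrace_congruence:
  assumes W: "W \<in> carrier_mat n m" and N: "N \<in> carrier_mat m m" and V: "V \<in> carrier_mat n n"
  shows "mtrace (W * N * transpose_mat W * V) = mtrace (N * (transpose_mat W * V * W))"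
    and "mtrace (W * N * transpose_mat W * V * (W * N * transpose_mat W * V)) =
      mtrace (N * (transpose_mat W * V * W) * (N * (transpose_mat W * V * W)))"
proof -
  define X where "X = N * transpose_mat W * V"
  have X: "X \<in> carrier_mat m n" using W N V by (simp add: X_def mult_carrier_mat[of _ m m _ n] mult_carrier_mat[of _ m n _ n])
  have WX: "W * N * transpose_mat W * V = W * X"
  proof -
    have "W * N * transpose_mat W = W * (N * transpose_mat W)" using W N by (intro assoc_mult_mat[of _ n m _ m _ n]) auto
    then show ?thesis unfolding X_def using W N V
      by (metis assoc_mult_mat mult_carrier_mat transpose_carrier_mat)
  qed
  have XW: "X * W = N * (transpose_mat W * V * W)"
  proof -
    have WV: "transpose_mat W * V \<in> carrier_mat m n" using W V by (simp add: mult_carrier_mat[of _ m n _ n])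
    have "X = N * (transpose_mat W * V)" unfolding X_def using W N V by (intro assoc_mult_mat[of _ m m _ n _ n]) auto
    then show ?thesis using assoc_mult_mat[OF N WV W] by simp
  qed
  show "mtrace (W * N * transpose_mat W * V) = mtrace (N * (transpose_mat W * V * W))"
    unfolding WX XW[symmetric] by (rule mtrace_comm[OF W X])
  have XWX: "X * W * X \<in> carrier_mat m n" using X W by (simp add: mult_carrier_mat[of _ m n _ m] mult_carrier_mat[of _ m m _ n])
  have "W * X * (W * X) = W * (X * W * X)"
    using X W by (metis assoc_mult_mat mult_carrier_mat)
  moreover have "X * W * X * W = X * W * (X * W)"
    using X W by (metis assoc_mult_mat mult_carrier_mat)
  ultimately show "mtrace (W * N * transpose_mat W * V * (W * N * transpose_mat W * V)) =
      mtrace (N * (transpose_mat W * V * W) * (N * (transpose_mat W * V * W)))"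
    unfolding WX XW[symmetric] using mtrace_comm[OF W XWX] by simp
qed

section \<open>Positive definite matrices\<close>

definition pos_def_mat :: "nat \<Rightarrow> real mat \<Rightarrow> bool" where
  "pos_def_mat n A \<longleftrightarrow> A \<in> carrier_mat n n \<and> transpose_mat A = A \<and>
     (\<forall>v\<in>carrier_vec n. v \<noteq> 0\<^sub>v n \<longrightarrow> 0 < v \<bullet> (A *\<^sub>v v))"

lemma pos_def_carrier: "pos_def_mat n A \<Longrightarrow> A \<in> carrier_mat n n"
  and pos_def_sym: "pos_def_mat n A \<Longrightarrow> transpose_mat A = A"
  and pos_def_pos: "pos_def_mat n A \<Longrightarrow> v \<in> carrier_vec n \<Longrightarrow> v \<noteq> 0\<^sub>v n \<Longrightarrow> 0 < v \<bullet> (A *\<^sub>v v)"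
  by (auto simp: pos_def_mat_def)

lemma pos_def_nonneg: "pos_def_mat n A \<Longrightarrow> v \<in> carrier_vec n \<Longrightarrow> 0 \<le> v \<bullet> (A *\<^sub>v v)"
  by (cases "v = 0\<^sub>v n") (auto dest: pos_def_pos simp: pos_def_carrier mult_mat_zero_vec[of _ n n] less_imp_le)

lemma pos_def_det_nonzero: "pos_def_mat n A \<Longrightarrow> det A \<noteq> 0"
  using det_0_iff_vec_prod_zero_field[of A n] pos_def_pos[of n A] pos_def_carrier[of n A] by fastforce

lemma pos_def_one: "pos_def_mat n (1\<^sub>m n)"
proof -
  have "0 < v \<bullet> v" if "v \<in> carrier_vec n" "v \<noteq> 0\<^sub>v n" for v :: "real vec"
  proof -
    have "\<exists>i<n. v $ i \<noteq> 0" using that by (auto intro!: eq_vecI)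
    then obtain i where i: "i < n" "v $ i \<noteq> 0" by blast
    have "0 < (\<Sum>i<n. v $ i * v $ i)"
      using i by (intro sum_pos2[of _ i]) (auto simp: zero_less_mult_iff linorder_neq_iff)
    then show ?thesis using that by (simp add: scalar_prod_def atLeast0LessThan)
  qed
  then show ?thesis by (auto simp: pos_def_mat_def)
qed

lemma pos_def_smult: "0 < c \<Longrightarrow> pos_def_mat n A \<Longrightarrow> pos_def_mat n (c \<cdot>\<^sub>m A)"
  unfolding pos_def_mat_def
  by (auto simp: quadratic_form_sum[of _ n n] transpose_smult mult.assoc mult.left_commute[of _ c] simp flip: sum_distrib_left)

lemma pos_def_congruence:
  assumes A: "pos_def_mat n A" and T: "T \<in> carrier_mat n k"
    and inj: "\<And>x. x \<in> carrier_vec k \<Longrightarrow> T *\<^sub>v x = 0\<^sub>v n \<Longrightarrow> x = 0\<^sub>v k"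
  shows "pos_def_mat k (transpose_mat T * A * T)"
proof -
  note Ac = pos_def_carrier[OF A]
  have "transpose_mat (transpose_mat T * A * T) = transpose_mat T * (transpose_mat A * T)"
    using T Ac by (simp add: transpose_mult[of _ k n _ k] transpose_mult[of _ k n _ n] transpose_mult[of _ n n _ k])
  also have "\<dots> = transpose_mat T * A * T" using T Ac pos_def_sym[OF A]
    by (simp add: assoc_mult_mat[of _ k n _ n _ k])
  finally show ?thesis
    unfolding pos_def_mat_def
    using T Ac inj by (auto simp del: assoc_mult_mat simp: quadratic_form_congruence[OF Ac T] intro!: pos_def_pos[OF A])
qed

lemma pos_def_minv:
  assumes A: "pos_def_mat n A" shows "pos_def_mat n (minv A)"
proof -
  note c = pos_def_carrier[OF A] and d = pos_def_det_nonzero[OF A]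
  note mc = minv_carrier[OF c d]
  have "transpose_mat (minv A) * A = transpose_mat (A * minv A)"
    using transpose_mult[OF c mc] pos_def_sym[OF A] by simp
  then have e: "transpose_mat (minv A) * A = 1\<^sub>m n" using minv_right[OF c d] by simp
  have "x = 0\<^sub>v n" if "x \<in> carrier_vec n" "minv A *\<^sub>v x = 0\<^sub>v n" for x
  proof -
    have "x = (A * minv A) *\<^sub>v x" using that minv_right[OF c d] by simp
    also have "\<dots> = A *\<^sub>v (minv A *\<^sub>v x)" using c mc that(1) by (rule assoc_mult_mat_vec)
    finally show ?thesis using that c by (simp add: mult_mat_zero_vec)
  qed
  from pos_def_congruence[OF A mc this] e mc show ?thesis by simp
qed

text \<open>
  If the form vanished at some \<open>v\<close>, moving from \<open>v\<close> in the direction \<open>- A v\<close>, which is nonzero,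
  would change it by a negative first-order term and make it negative.
\<close>
lemma pos_semidef_invertible_imp_pos_def:
  assumes A: "A \<in> carrier_mat n n" and sym: "transpose_mat A = A"
    and psd: "\<And>v. v \<in> carrier_vec n \<Longrightarrow> 0 \<le> v \<bullet> (A *\<^sub>v v)" and d: "det A \<noteq> 0"
  shows "pos_def_mat n A"
proof -
  have False if v: "v \<in> carrier_vec n" "v \<noteq> 0\<^sub>v n" and le: "v \<bullet> (A *\<^sub>v v) \<le> 0" for v
  proof -
    define w where "w = A *\<^sub>v v"
    have w: "w \<in> carrier_vec n" using A v by (simp add: w_def)
    have w0: "w \<noteq> 0\<^sub>v n" unfolding w_def using det_0_iff_vec_prod_zero_field[OF A] d v by auto
    define q where "q = w \<bullet> w"
    define c where "c = w \<bullet> (A *\<^sub>v w)"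
    have q: "0 < q" using pos_def_pos[OF pos_def_one w w0] w by (simp add: q_def)
    have c: "0 \<le> c" using psd[OF w] by (simp add: c_def)
    have expand: "(v + e \<cdot>\<^sub>v w) \<bullet> (A *\<^sub>v (v + e \<cdot>\<^sub>v w)) = v \<bullet> (A *\<^sub>v v) + 2 * e * q + e\<^sup>2 * c" for e
    proof -
      have "v \<bullet> (A *\<^sub>v w) = q"
        using scalar_prod_mult_mat_vec[OF A v(1) w] sym by (simp add: q_def w_def)
      moreover have "A *\<^sub>v (v + e \<cdot>\<^sub>v w) = w + e \<cdot>\<^sub>v (A *\<^sub>v w)"
        using A v w by (simp add: mult_add_distrib_mat_vec[of _ n n] mult_mat_vec[of _ n n] w_def)
      moreover have "w \<bullet> w = q" "v \<bullet> (A *\<^sub>v v) = v \<bullet> w" by (simp_all add: q_def w_def)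
      ultimately show ?thesis using A v w
        by (simp add: scalar_prod_add_distrib[of _ n] add_scalar_prod_distrib[of _ n] c_def[symmetric]
            algebra_simps power2_eq_square)
    qed
    \<comment> \<open>a step so small that the linear term dominates the quadratic one\<close>
    define e where "e = - q / (c + 1)"
    have "0 \<le> (v + e \<cdot>\<^sub>v w) \<bullet> (A *\<^sub>v (v + e \<cdot>\<^sub>v w))" using v w by (intro psd) auto
    then have "0 \<le> 2 * e * q + e\<^sup>2 * c" using le expand by simp
    also have "\<dots> = - (q\<^sup>2 / (c+1)) * (2 - c / (c + 1))"
    proof -
      have "2 * (- q / r) * q + (- q / r)\<^sup>2 * c = - (q\<^sup>2 / r) * (2 - c / r)" for r
        by (simp add: power2_eq_square right_diff_distrib)
      then show ?thesis unfolding e_def .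
    qed
    also have "\<dots> < 0" using c q by (intro mult_neg_pos) (auto simp: field_simps)
    finally show False by simp
  qed
  then show ?thesis unfolding pos_def_mat_def using A sym by force
qed

text \<open>
  By induction on the size: if the leading block is \<open>L' L'\<^sup>T\<close> and \<open>a\<close> is the rest of the last column, the
  new row of the factor must be \<open>v = L'\<^sup>-\<^sup>1 a\<close> followed by the square root of the Schur complement.
\<close>
lemma cholesky:
  assumes "pos_def_mat n A"
  obtains L where "L \<in> carrier_mat n n" "\<And>i j. i < j \<Longrightarrow> j < n \<Longrightarrow> L $$ (i, j) = 0"
    "\<And>i. i < n \<Longrightarrow> 0 < L $$ (i, i)" "A = L * transpose_mat L"
proof -
  have "\<exists>L\<in>carrier_mat n n. (\<forall>i j. i < j \<longrightarrow> j < n \<longrightarrow> L $$ (i, j) = 0) \<and> (\<forall>i<n. 0 < L $$ (i, i)) \<and>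
    A = L * transpose_mat L" using assms
  proof (induction n arbitrary: A)
    case 0
    then show ?case by (intro bexI[of _ "mat 0 0 (\<lambda>_. 0)"]) (auto simp: pos_def_mat_def)
  next
    case (Suc n)
    note Ac = pos_def_carrier[OF Suc.prems]
    define A' where "A' = mat n n (\<lambda>ij. A $$ ij)"
    define a where "a = vec n (\<lambda>i. A $$ (i, n))"
    define \<alpha> where "\<alpha> = A $$ (n, n)"
    have symA: "A $$ (i, j) = A $$ (j, i)" if "i < Suc n" "j < Suc n" for i j
      using that Ac pos_def_sym[OF Suc.prems] by (metis carrier_matD index_transpose_mat(1))
    \<comment> \<open>positivity of the form at \<open>(x, t)\<close>, in terms of the blocks\<close>
    have ext: "0 < x \<bullet> (A' *\<^sub>v x) + 2 * t * (a \<bullet> x) + t\<^sup>2 * \<alpha>"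
      if x: "x \<in> carrier_vec n" "x \<noteq> 0\<^sub>v n \<or> t \<noteq> 0" for x t
    proof -
      define x' where "x' = vec (Suc n) (\<lambda>i. if i < n then x $ i else t)"
      have x': "x' \<in> carrier_vec (Suc n)" by (simp add: x'_def)
      have "x' \<noteq> 0\<^sub>v (Suc n)"
      proof
        assume "x' = 0\<^sub>v (Suc n)"
        then have z: "\<And>i. i < Suc n \<Longrightarrow> x' $ i = 0" by simp
        have "t = 0" using z[of n] by (simp add: x'_def)
        moreover have "x = 0\<^sub>v n"
        proof (rule eq_vecI)
          fix i assume "i < dim_vec (0\<^sub>v n :: real vec)"
          then show "x $ i = 0\<^sub>v n $ i" using z[of i] by (simp add: x'_def)
        qed (use x in simp)
        ultimately show False using x by simp
      qed
      then have "0 < x' \<bullet> (A *\<^sub>v x')" using pos_def_pos[OF Suc.prems x'] by simp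
      also have "\<dots> = (\<Sum>i<n. \<Sum>j<n. x $ i * A $$ (i, j) * x $ j) + (\<Sum>i<n. x $ i * A $$ (i,n) * t) +
           (\<Sum>j<n. t * A $$ (n,j) * x $ j) + t * \<alpha> * t"
        using Ac x' by (simp add: quadratic_form_sum[of _ "Suc n" "Suc n"] sum.distrib x'_def \<alpha>_def)
      also have "(\<Sum>j<n. t * A $$ (n,j) * x $ j) = (\<Sum>i<n. x $ i * A $$ (i,n) * t)"
        by (intro sum.cong refl) (simp add: symA[of n])
      also have "(\<Sum>i<n. x $ i * A $$ (i,n) * t) = t * (a \<bullet> x)"
        using x by (auto simp: scalar_prod_def a_def sum_distrib_left atLeast0LessThan intro!: sum.cong)
      also have "(\<Sum>i<n. \<Sum>j<n. x $ i * A $$ (i, j) * x $ j) = x \<bullet> (A' *\<^sub>v x)"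
        using x by (subst quadratic_form_sum[of _ n n]) (auto simp: A'_def intro!: sum.cong)
      finally show ?thesis by (simp add: power2_eq_square algebra_simps)
    qed
    have "pos_def_mat n A'" unfolding pos_def_mat_def
      using ext[of _ 0] by (auto simp: A'_def symA intro!: eq_matI)
    from Suc.IH[OF this] obtain L' where L': "L' \<in> carrier_mat n n"
      and low: "\<And>i j. i < j \<Longrightarrow> j < n \<Longrightarrow> L' $$ (i, j) = 0" and diag: "\<And>i. i < n \<Longrightarrow> 0 < L' $$ (i, i)"
      and AL: "A' = L' * transpose_mat L'" by auto
    have dL: "det L' \<noteq> 0"
      using diag L' by (subst det_lower_triangular[OF low L']) (auto simp: prod_list_diag_prod less_imp_neq[symmetric])
    define X where "X = minv L'"
    have X: "X \<in> carrier_mat n n" "L' * X = 1\<^sub>m n" "X * L' = 1\<^sub>m n"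
      using minv_inverse[OF L' dL] by (auto simp: X_def)
    have a: "a \<in> carrier_vec n" by (simp add: a_def)
    define v where "v = X *\<^sub>v a"
    have v: "v \<in> carrier_vec n" using X a by (simp add: v_def)
    \<comment> \<open>\<open>w\<close> solves \<open>A' w = a\<close>, so the form at \<open>(w, - 1)\<close> is the Schur complement\<close>
    define w where "w = transpose_mat X *\<^sub>v v"
    have w: "w \<in> carrier_vec n" using X v by (simp add: w_def)
    have L'v: "L' *\<^sub>v v = a" using assoc_mult_mat_vec[OF L' X(1) a] X a by (simp add: v_def)
    have "transpose_mat L' *\<^sub>v w = (transpose_mat L' * transpose_mat X) *\<^sub>v v"
      using X L' v by (simp add: w_def)
    also have "transpose_mat L' * transpose_mat X = transpose_mat (X * L')"
      using transpose_mult[OF X(1) L'] by simp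
    finally have Lw: "transpose_mat L' *\<^sub>v w = v" using X v by simp
    have A'w: "A' *\<^sub>v w = a" using L' w L'v Lw by (simp add: AL)
    have aw: "a \<bullet> w = v \<bullet> v"
      using scalar_prod_mult_mat_vec[of "transpose_mat X" n n a v] X a v by (simp add: w_def v_def)
    have "0 < w \<bullet> a - 2 * (a \<bullet> w) + \<alpha>" using ext[of w "-1"] w A'w by simp
    then have pos: "0 < \<alpha> - v \<bullet> v" using aw comm_scalar_prod[OF w a] by simp
    define d where "d = sqrt (\<alpha> - v \<bullet> v)"
    have d: "0 < d" "d * d = \<alpha> - v \<bullet> v" using pos by (auto simp: d_def)
    define L where "L = mat (Suc n) (Suc n) (\<lambda>(i, j). if i < n then if j < n then L' $$ (i, j) else 0
        else if j < n then v $ j else d)"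
    have L: "L \<in> carrier_mat (Suc n) (Suc n)" by (simp add: L_def)
    have ent: "(L * transpose_mat L) $$ (i, j) = (\<Sum>k<n. L $$ (i,k) * L $$ (j,k)) + L $$ (i,n) * L $$ (j,n)"
      if "i < Suc n" "j < Suc n" for i j
      using that L by (simp add: scalar_prod_def atLeast0LessThan)
    have entA': "A $$ (i, j) = (\<Sum>k<n. L' $$ (i,k) * L' $$ (j,k))" if "i < n" "j < n" for i j
    proof -
      have "A $$ (i, j) = A' $$ (i, j)" using that by (simp add: A'_def)
      also have "\<dots> = (\<Sum>k<n. L' $$ (i,k) * L' $$ (j,k))" using that L'
        by (simp add: AL scalar_prod_def atLeast0LessThan)
      finally show ?thesis .
    qed
    have enta: "A $$ (i, n) = (\<Sum>k<n. L' $$ (i,k) * v $ k)" if "i < n" for i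
    proof -
      have "A $$ (i, n) = (L' *\<^sub>v v) $ i" using that L'v by (simp add: a_def)
      then show ?thesis using that L' v by (simp add: scalar_prod_def atLeast0LessThan)
    qed
    have vv: "v \<bullet> v = (\<Sum>k<n. v $ k * v $ k)" using v by (simp add: scalar_prod_def atLeast0LessThan)
    have "A $$ (i, j) = (L * transpose_mat L) $$ (i, j)" if ij: "i < Suc n" "j < Suc n" for i j
    proof -
      consider "i < n" "j < n" | "i < n" "j = n" | "i = n" "j < n" | "i = n" "j = n" using ij by linarith
      then show ?thesis
      proof cases
        case 1 then show ?thesis by (subst ent) (simp_all add: L_def entA')
      next
        case 2 then show ?thesis by (subst ent) (simp_all add: L_def enta)
      next
        case 3 then show ?thesis by (subst ent) (simp_all add: L_def symA[of n] enta mult.commute)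
      next
        case 4 then show ?thesis by (subst ent) (simp_all add: L_def d vv flip: \<alpha>_def)
      qed
    qed
    then have "A = L * transpose_mat L" using L Ac by (intro eq_matI) auto
    moreover have "\<forall>i j. i < j \<longrightarrow> j < Suc n \<longrightarrow> L $$ (i, j) = 0" by (auto simp: L_def low)
    moreover have "\<forall>i<Suc n. 0 < L $$ (i, i)" by (auto simp: L_def diag d)
    ultimately show ?case using L by blast
  qed
  then show ?thesis using that by blast
qed

lemma pos_def_det_pos:
  assumes "pos_def_mat n A" shows "0 < det A"
proof -
  obtain L where L: "L \<in> carrier_mat n n" "A = L * transpose_mat L"
    using cholesky[OF assms] by metis
  then have "det A = (det L)\<^sup>2" by (simp add: det_mult[of _ n] det_transpose[of _ n] power2_eq_square)
  then show ?thesis using pos_def_det_nonzero[OF assms] by (metis zero_le_power2 order_le_less)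
qed

section \<open>Matrices of full column rank\<close>

text \<open>
  Full rank first rules out repeated columns, so that the columns as a set are as many as their
  indices; then a kernel vector would be a linear dependence.
\<close>
lemma full_column_rank_inj:
  fixes A :: "real mat"
  assumes A: "A \<in> carrier_mat n k" and r: "vec_space.rank n A = k"
    and x: "x \<in> carrier_vec k" "A *\<^sub>v x = 0\<^sub>v n"
  shows "x = 0\<^sub>v k"
proof -
  interpret vec_space "TYPE(real)" n .
  have dist: "distinct (cols A)"
  proof (rule ccontr)
    assume nd: "\<not> distinct (cols A)"
    obtain S where S: "maximal S (\<lambda>T. T \<subseteq> set (cols A) \<and> lin_indpt T)"
      using maximal_exists[of "(\<lambda>T. T \<subseteq> set (cols A) \<and> lin_indpt T)" "card (set (cols A))" "{}"]
      by (meson List.finite_set card_mono empty_iff empty_subsetI finite_lin_indpt2 rev_finite_subset)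
    then have "card S \<le> card (set (cols A))" by (simp add: card_mono maximal_def)
    also have "\<dots> < k" using nd A card_length[of "cols A"] card_distinct[of "cols A"] by (simp add: nat_less_le) metis
    finally show False using rank_card_indpt[OF A S] r by simp
  qed
  show ?thesis
    using lin_depI[OF A x(1) _ x(2) dist] full_rank_lin_indpt[OF A r dist] by blast
qed

lemma col_in_col_space:
  assumes A: "A \<in> carrier_mat n k" and j: "j < k"
  shows "col A j \<in> vec_space.col_space n (A :: real mat)"
proof -
  interpret vec_space "TYPE(real)" n .
  have "A *\<^sub>v unit_vec k j = col A j" using A j by (intro eq_vecI) auto
  moreover have "unit_vec k j \<in> carrier_vec (dim_col A)" using A by simp
  ultimately show ?thesis using A j by (subst col_space_eq[OF A]) auto
qed

section \<open>Gaussian integrals\<close>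

interpretation lborel_product: product_sigma_finite "\<lambda>_::nat. lborel :: real measure"
  by standard

lemma measurable_lebesgue_Rn_component:
  "i < n \<Longrightarrow> (\<lambda>y. y i) \<in> borel_measurable (lebesgue_Rn n)"
  unfolding lebesgue_Rn_def by measurable

lemma sigma_finite_lebesgue_Rn: "sigma_finite_measure (lebesgue_Rn n)"
  unfolding lebesgue_Rn_def by (intro lborel_product.sigma_finite) simp

text \<open>
  Substitution under a lower triangular affine map. The last coordinate of the image is the only one
  that involves the last variable, and it is affine in it; so integrating that variable first
  reduces the claim to a one-dimensional substitution and to the case of one variable less.
\<close>
lemma nn_integral_lebesgue_Rn_triangular:
  fixes L :: "nat \<Rightarrow> nat \<Rightarrow> real"
  assumes "\<And>i. i < n \<Longrightarrow> 0 < L i i" and "f \<in> borel_measurable (lebesgue_Rn n)"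
  shows "(\<integral>\<^sup>+y. f y \<partial>lebesgue_Rn n) =
    ennreal (\<Prod>i<n. L i i) * (\<integral>\<^sup>+u. f (\<lambda>i\<in>{..<n}. \<mu> i + (\<Sum>j\<le>i. L i j * u j)) \<partial>lebesgue_Rn n)"
  using assms
proof (induction n arbitrary: f)
  case 0
  then show ?case by (simp add: lebesgue_Rn_def PiM_empty nn_integral_count_space_finite restrict_def)
next
  case (Suc n)
  let ?P = "Pi\<^sub>M {..<n} (\<lambda>_. lborel :: real measure)"
  define T where "T m u = (\<lambda>i\<in>{..<m}. \<mu> i + (\<Sum>j\<le>i. L i j * u j))" for m u
  define t where "t u = \<mu> n + (\<Sum>j<n. L n j * u j)" for u
  have [measurable]: "f \<in> borel_measurable (Pi\<^sub>M (insert n {..<n}) (\<lambda>_. lborel))"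
    using Suc.prems by (simp add: lebesgue_Rn_def lessThan_Suc)
  have T_meas [measurable]: "T m \<in> measurable (Pi\<^sub>M {..<m} (\<lambda>_. lborel)) (Pi\<^sub>M {..<m} (\<lambda>_. lborel))" for m
    unfolding T_def by (intro measurable_restrict) (auto intro!: borel_measurable_add borel_measurable_sum borel_measurable_times
      measurable_lebesgue_Rn_component[unfolded lebesgue_Rn_def])
  have T_Suc: "T (Suc n) (u(n := x)) = (T n u)(n := t u + L n n * x)" for u x
    by (auto simp: T_def t_def fun_eq_iff lessThan_Suc_atMost[symmetric] restrict_def intro!: sum.cong)
  have fT: "(\<lambda>u. f (T (Suc n) u)) \<in> borel_measurable (Pi\<^sub>M (insert n {..<n}) (\<lambda>_. lborel))"
    using T_meas[of "Suc n"] unfolding lessThan_Suc by measurable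
  have fT': "(\<lambda>(u, x). f (T (Suc n) (u(n := x)))) \<in> borel_measurable (?P \<Otimes>\<^sub>M lborel)"
    using measurable_compose[OF measurable_add_dim[of n "{..<n}" "\<lambda>_. lborel"] fT]
    by (simp add: case_prod_unfold)
  define g where "g w = (\<integral>\<^sup>+x. f (w(n := x)) \<partial>lborel)" for w
  have g_meas [measurable]: "g \<in> borel_measurable ?P" unfolding g_def by measurable
  have gT: "g (T n u) = ennreal (L n n) * (\<integral>\<^sup>+x. f (T (Suc n) (u(n := x))) \<partial>lborel)" if u: "u \<in> space ?P" for u
  proof -
    have [measurable]: "T n u \<in> space ?P" using measurable_space[OF T_meas u] .
    have "(\<lambda>x. (T n u)(n := x)) \<in> measurable lborel (Pi\<^sub>M (insert n {..<n}) (\<lambda>_. lborel))"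
      using measurable_comp[OF measurable_Pair1' measurable_add_dim, of "T n u" "{..<n}" "\<lambda>_. lborel :: real measure" n]
        \<open>T n u \<in> space ?P\<close> by (simp add: comp_def)
    then have "(\<lambda>x. f ((T n u)(n := x))) \<in> borel_measurable borel"
      using measurable_compose[of "\<lambda>x. (T n u)(n := x)" lborel _ f borel] by simp
    then show ?thesis
      unfolding g_def T_Suc using Suc.prems(1)[of n]
      by (subst nn_integral_real_affine[of _ "L n n" "t u"]) auto
  qed
  have "(\<integral>\<^sup>+y. f y \<partial>lebesgue_Rn (Suc n)) = (\<integral>\<^sup>+w. g w \<partial>?P)"
    unfolding lebesgue_Rn_def lessThan_Suc g_def by (subst lborel_product.product_nn_integral_insert) auto
  also have "\<dots> = ennreal (\<Prod>i<n. L i i) * (\<integral>\<^sup>+u. g (T n u) \<partial>?P)"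
    unfolding T_def by (rule Suc.IH[unfolded lebesgue_Rn_def]) (use Suc.prems(1) g_meas in auto)
  also have "(\<integral>\<^sup>+u. g (T n u) \<partial>?P) = (\<integral>\<^sup>+u. ennreal (L n n) * (\<integral>\<^sup>+x. f (T (Suc n) (u(n := x))) \<partial>lborel) \<partial>?P)"
    by (intro nn_integral_cong gT)
  also have "\<dots> = ennreal (L n n) * (\<integral>\<^sup>+u. \<integral>\<^sup>+x. f (T (Suc n) (u(n := x))) \<partial>lborel \<partial>?P)"
    by (intro nn_integral_cmult lborel.borel_measurable_nn_integral fT')
  also have "(\<integral>\<^sup>+u. \<integral>\<^sup>+x. f (T (Suc n) (u(n := x))) \<partial>lborel \<partial>?P) = (\<integral>\<^sup>+u. f (T (Suc n) u) \<partial>lebesgue_Rn (Suc n))"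
    unfolding lebesgue_Rn_def lessThan_Suc using fT
    by (subst lborel_product.product_nn_integral_insert) auto
  finally have "(\<integral>\<^sup>+y. f y \<partial>lebesgue_Rn (Suc n)) =
    ennreal (\<Prod>i<n. L i i) * (ennreal (L n n) * (\<integral>\<^sup>+u. f (T (Suc n) u) \<partial>lebesgue_Rn (Suc n)))" .
  moreover have "ennreal (\<Prod>i<Suc n. L i i) = ennreal (\<Prod>i<n. L i i) * ennreal (L n n)"
    using Suc.prems(1) by (simp add: ennreal_mult'' less_imp_le)
  ultimately show ?case by (simp only: T_def mult.assoc)
qed

lemma nn_integral_lebesgue_Rn_affine:
  assumes L: "L \<in> carrier_mat n n" and low: "\<And>i j. i < j \<Longrightarrow> j < n \<Longrightarrow> L $$ (i, j) = 0"
    and diag: "\<And>i. i < n \<Longrightarrow> 0 < L $$ (i, i)" and \<mu>: "\<mu> \<in> carrier_vec n"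
    and F: "(\<lambda>y. F (vec n y)) \<in> borel_measurable (lebesgue_Rn n)"
  shows "(\<integral>\<^sup>+y. F (vec n y) \<partial>lebesgue_Rn n) =
    ennreal (det L) * (\<integral>\<^sup>+u. F (\<mu> + L *\<^sub>v vec n u) \<partial>lebesgue_Rn n)"
proof -
  have eq: "vec n (\<lambda>i\<in>{..<n}. \<mu> $ i + (\<Sum>j\<le>i. L $$ (i, j) * u j)) = \<mu> + L *\<^sub>v vec n u" for u
  proof (rule eq_vecI)
    fix i assume "i < dim_vec (\<mu> + L *\<^sub>v vec n u)"
    then have i: "i < n" using L \<mu> by simp
    have "(\<Sum>j\<le>i. L $$ (i, j) * u j) = (\<Sum>j<n. L $$ (i, j) * u j)"
      using i low by (intro sum.mono_neutral_left) auto
    then show "vec n (\<lambda>i\<in>{..<n}. \<mu> $ i + (\<Sum>j\<le>i. L $$ (i, j) * u j)) $ i = (\<mu> + L *\<^sub>v vec n u) $ i"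
      using i L \<mu> by (simp add: scalar_prod_def atLeast0LessThan)
  qed (use L \<mu> in simp)
  have "det L = (\<Prod>i<n. L $$ (i, i))"
    using L by (simp add: det_lower_triangular[OF low L] prod_list_diag_prod atLeast0LessThan)
  then show ?thesis
    using nn_integral_lebesgue_Rn_triangular[of n "\<lambda>i j. L $$ (i, j)" "\<lambda>y. F (vec n y)" "\<lambda>i. \<mu> $ i", OF diag F]
    by (simp add: eq)
qed

lemma borel_measurable_quadratic_form:
  fixes A :: "real mat"
  assumes "A \<in> carrier_mat n k" "u \<in> carrier_vec n" "v \<in> carrier_vec k"
    and meas: "\<And>i. i < n \<Longrightarrow> (\<lambda>x. f x i) \<in> borel_measurable M" "\<And>i. i < k \<Longrightarrow> (\<lambda>x. g x i) \<in> borel_measurable M"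
  shows "(\<lambda>x. (vec n (f x) - u) \<bullet> (A *\<^sub>v (vec k (g x) - v))) \<in> borel_measurable M"
proof -
  have "(vec n (f x) - u) \<bullet> (A *\<^sub>v (vec k (g x) - v)) = (\<Sum>i<n. \<Sum>j<k. (f x i - u $ i) * A $$ (i, j) * (g x j - v $ j))" for x
    using assms(1-3) by (subst quadratic_form_sum[OF assms(1)]) (auto intro!: sum.cong)
  then show ?thesis using meas by simp
qed

definition std_normal_moment :: "nat \<Rightarrow> real" where
  "std_normal_moment k = (\<integral>x. std_normal_density x * x ^ k \<partial>lborel)"

lemma std_normal_moments:
  "std_normal_moment 0 = 1" "std_normal_moment (Suc 0) = 0" "std_normal_moment (Suc (Suc 0)) = 1"
  "std_normal_moment (Suc (Suc (Suc 0))) = 0" "std_normal_moment (Suc (Suc (Suc (Suc 0)))) = 3"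
  using integral_std_normal_moment_even[of 0] integral_std_normal_moment_odd[of 0]
    integral_std_normal_moment_even[of 1] integral_std_normal_moment_odd[of 1] integral_std_normal_moment_even[of 2]
  by (simp_all add: std_normal_moment_def fact_numeral eval_nat_numeral)

text \<open>
  Wick's formula for four factors. The integrand is a product over the coordinates, in which
  coordinate \<open>a\<close> occurs with the exponent \<open>e a\<close>, so the integral is a product of one-dimensional
  moments; odd exponents make it vanish.
\<close>
lemma std_normal_fourth_moments:
  fixes n :: nat
  assumes ijkl: "i < n" "j < n" "k < n" "l < n"
  shows "has_bochner_integral (lebesgue_Rn n) (\<lambda>u. (\<Prod>a<n. std_normal_density (u a)) * (u i * u j * u k * u l))
    (of_bool (i = j \<and> k = l) + of_bool (i = k \<and> j = l) + of_bool (i = l \<and> j = k))"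
proof -
  define e :: "nat \<Rightarrow> nat" where "e a = of_bool (a = i) + of_bool (a = j) + of_bool (a = k) + of_bool (a = l)" for a
  define F where "F u = (\<Prod>a<n. std_normal_density (u a) * u a ^ e a)" for u :: "nat \<Rightarrow> real"
  have single: "(\<Prod>a<n. u a ^ of_bool (a = b)) = u b" if "b < n" for u :: "nat \<Rightarrow> real" and b
  proof -
    have "(\<Prod>a<n. u a ^ of_bool (a = b)) = (\<Prod>a<n. if b = a then u a else 1)" by (intro prod.cong) auto
    then show ?thesis using that by simp
  qed
  have F: "F u = (\<Prod>a<n. std_normal_density (u a)) * (u i * u j * u k * u l)" for u
    using ijkl by (simp add: F_def e_def prod.distrib power_add single)
  have int: "integrable lborel (\<lambda>x. std_normal_density x * x ^ e a)" for a
    by (rule integrable_std_normal_moment)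
  have "integrable (lebesgue_Rn n) F"
    unfolding F_def lebesgue_Rn_def by (intro lborel_product.product_integrable_prod int) simp
  moreover have "(\<integral>u. F u \<partial>lebesgue_Rn n) = (\<Prod>a<n. std_normal_moment (e a))"
    unfolding F_def lebesgue_Rn_def std_normal_moment_def by (intro lborel_product.product_integral_prod int) simp
  moreover have "(\<Prod>a<n. std_normal_moment (e a)) = (\<Prod>a\<in>{i, j, k, l}. std_normal_moment (e a))"
    using ijkl by (intro prod.mono_neutral_right) (auto simp: e_def std_normal_moments)
  moreover have "\<dots> = of_bool (i = j \<and> k = l) + of_bool (i = k \<and> j = l) + of_bool (i = l \<and> j = k)"
    by (cases "i = j"; cases "i = k"; cases "i = l"; cases "j = k"; cases "j = l"; cases "k = l")
       (simp_all add: e_def std_normal_moments insert_commute eval_nat_numeral)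
  ultimately show ?thesis unfolding has_bochner_integral_iff F[symmetric] by simp
qed


lemma prod_std_normal_density:
  "(\<Prod>a<n. std_normal_density (u a)) = exp (- (vec n u \<bullet> vec n u) / 2) / sqrt ((2 * pi) ^ n)"
proof -
  have "(\<Prod>a<n. std_normal_density (u a)) = (\<Prod>a<n. exp (- (u a * u a) / 2) / sqrt (2 * pi))"
    by (simp add: std_normal_density_def power2_eq_square)
  also have "\<dots> = exp (\<Sum>a<n. - (u a * u a) / 2) / sqrt (2 * pi) ^ n"
    by (simp add: prod_dividef exp_sum)
  also have "(\<Sum>a<n. - (u a * u a) / 2) = - (vec n u \<bullet> vec n u) / 2"
    by (simp add: scalar_prod_def atLeast0LessThan sum_negf flip: sum_divide_distrib)
  finally show ?thesis by (simp only: real_sqrt_power)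
qed

lemma sum_of_bool_eq: "k < n \<Longrightarrow> (\<Sum>l<n. f l * of_bool (k = l)) = (f k :: real)" for k n :: nat
  using sum.delta'[of "{..<n}" k f] by (simp add: of_bool_def if_distrib[of "(*) _"] cong: if_cong)

text \<open>
  Of the three pairings in Wick's formula, one gives the squared trace of \<open>B\<close>, and each of the
  other two gives the trace of \<open>B\<^sup>2\<close> because \<open>B\<close> is symmetric. The density is left without its
  normalising constant, which therefore appears on the right.
\<close>
lemma nn_integral_std_normal_quadratic_form_square:
  assumes B: "B \<in> carrier_mat n n" and sym: "transpose_mat B = B"
  shows "(\<integral>\<^sup>+u. ennreal ((vec n u \<bullet> (B *\<^sub>v vec n u))\<^sup>2) * ennreal (exp (- (vec n u \<bullet> vec n u) / 2)) \<partial>lebesgue_Rn n) =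
    ennreal (sqrt ((2 * pi) ^ n) * ((mtrace B)\<^sup>2 + 2 * mtrace (B * B)))"
proof -
  define S where "S = (mtrace B)\<^sup>2 + 2 * mtrace (B * B)"
  define b where "b i j = B $$ (i, j)" for i j
  have b_sym: "b i j = b j i" if "i < n" "j < n" for i j
    using that B sym by (metis b_def carrier_matD index_transpose_mat(1))
  have trB: "mtrace B = (\<Sum>i<n. b i i)" using B by (simp add: mtrace_def b_def)
  have trBB: "mtrace (B * B) = (\<Sum>i<n. \<Sum>j<n. b i j * b i j)"
    using B b_sym by (auto simp: mtrace_def scalar_prod_def atLeast0LessThan b_def intro!: sum.cong)
  have quad: "(vec n u \<bullet> (B *\<^sub>v vec n u))\<^sup>2 = (\<Sum>i<n. \<Sum>j<n. \<Sum>k<n. \<Sum>l<n. b i j * b k l * (u i * u j * u k * u l))" for u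
  proof -
    have "vec n u \<bullet> (B *\<^sub>v vec n u) = (\<Sum>i<n. \<Sum>j<n. b i j * (u i * u j))"
      by (subst quadratic_form_sum[OF B]) (auto simp: b_def mult_ac intro!: sum.cong)
    then have "(vec n u \<bullet> (B *\<^sub>v vec n u))\<^sup>2 =
        (\<Sum>i<n. \<Sum>j<n. b i j * (u i * u j) * (\<Sum>k<n. \<Sum>l<n. b k l * (u k * u l)))"
      by (simp only: power2_eq_square sum_distrib_right)
    then show ?thesis by (simp add: sum_distrib_left mult_ac)
  qed
  let ?c = "\<lambda>i j k l. (of_bool (i = j \<and> k = l) + of_bool (i = k \<and> j = l) + of_bool (i = l \<and> j = k)) :: real"
  have "has_bochner_integral (lebesgue_Rn n)
      (\<lambda>u. \<Sum>i<n. \<Sum>j<n. \<Sum>k<n. \<Sum>l<n. b i j * b k l * ((\<Prod>a<n. std_normal_density (u a)) * (u i * u j * u k * u l)))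
      (\<Sum>i<n. \<Sum>j<n. \<Sum>k<n. \<Sum>l<n. b i j * b k l * ?c i j k l)"
    by (intro has_bochner_integral_sum has_bochner_integral_mult_right std_normal_fourth_moments) auto
  also have "(\<lambda>u. \<Sum>i<n. \<Sum>j<n. \<Sum>k<n. \<Sum>l<n. b i j * b k l * ((\<Prod>a<n. std_normal_density (u a)) * (u i * u j * u k * u l)))
     = (\<lambda>u. (\<Prod>a<n. std_normal_density (u a)) * (vec n u \<bullet> (B *\<^sub>v vec n u))\<^sup>2)"
    by (simp add: quad sum_distrib_left mult_ac)
  also have "(\<Sum>i<n. \<Sum>j<n. \<Sum>k<n. \<Sum>l<n. b i j * b k l * ?c i j k l) = S"
  proof -
    have 1: "(\<Sum>k<n. \<Sum>l<n. b i j * b k l * of_bool (i = j \<and> k = l)) = (\<Sum>k<n. b k k) * b i j * of_bool (i = j)" for i j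
    proof -
      have "(\<Sum>k<n. \<Sum>l<n. b i j * b k l * of_bool (i = j \<and> k = l)) =
        (\<Sum>k<n. \<Sum>l<n. (b i j * of_bool (i = j) * b k l) * of_bool (k = l))"
        by (simp add: of_bool_conj mult_ac)
      also have "\<dots> = (\<Sum>k<n. b i j * of_bool (i = j) * b k k)"
        by (intro sum.cong refl sum_of_bool_eq) simp
      finally show ?thesis by (simp add: sum_distrib_left mult_ac)
    qed
    have 2: "(\<Sum>k<n. \<Sum>l<n. b i j * b k l * of_bool (i = k \<and> j = l)) = b i j * b i j" if "i < n" "j < n" for i j
    proof -
      have "(\<Sum>k<n. \<Sum>l<n. b i j * b k l * of_bool (i = k \<and> j = l)) =
        (\<Sum>k<n. \<Sum>l<n. (b i j * of_bool (i = k) * b k l) * of_bool (j = l))"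
        by (simp add: of_bool_conj mult_ac)
      also have "\<dots> = (\<Sum>k<n. b i j * of_bool (i = k) * b k j)"
        by (intro sum.cong refl sum_of_bool_eq that)
      also have "\<dots> = (\<Sum>k<n. (b i j * b k j) * of_bool (i = k))"
        by (simp add: mult_ac)
      finally show ?thesis using that by (simp add: sum_of_bool_eq)
    qed
    have 3: "(\<Sum>k<n. \<Sum>l<n. b i j * b k l * of_bool (i = l \<and> j = k)) = b i j * b i j" if "i < n" "j < n" for i j
    proof -
      have "(\<Sum>k<n. \<Sum>l<n. b i j * b k l * of_bool (i = l \<and> j = k)) =
        (\<Sum>k<n. \<Sum>l<n. (b i j * of_bool (j = k) * b k l) * of_bool (i = l))"
        by (simp add: of_bool_conj mult_ac)
      also have "\<dots> = (\<Sum>k<n. b i j * of_bool (j = k) * b k i)"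
        by (intro sum.cong refl sum_of_bool_eq that)
      also have "\<dots> = (\<Sum>k<n. (b i j * b k i) * of_bool (j = k))"
        by (simp add: mult_ac)
      finally show ?thesis using that by (simp add: sum_of_bool_eq b_sym)
    qed
    have "(\<Sum>i<n. \<Sum>j<n. \<Sum>k<n. \<Sum>l<n. b i j * b k l * ?c i j k l) =
      (\<Sum>i<n. \<Sum>j<n. (\<Sum>k<n. b k k) * b i j * of_bool (i = j) + (b i j * b i j + b i j * b i j))"
      by (intro sum.cong refl) (simp only: distrib_left sum.distrib 1 2 3 lessThan_iff add.assoc)
    also have "\<dots> = (\<Sum>k<n. b k k) * (\<Sum>i<n. b i i) + 2 * (\<Sum>i<n. \<Sum>j<n. b i j * b i j)"
    proof -
      have "(\<Sum>i<n. \<Sum>j<n. (\<Sum>k<n. b k k) * b i j * of_bool (i = j)) = (\<Sum>i<n. (\<Sum>k<n. b k k) * b i i)"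
        by (intro sum.cong refl sum_of_bool_eq) simp
      also have "\<dots> = (\<Sum>k<n. b k k) * (\<Sum>i<n. b i i)" by (simp only: sum_distrib_left)
      finally show ?thesis by (simp only: sum.distrib mult_2)
    qed
    finally show ?thesis by (simp only: S_def trB trBB power2_eq_square)
  qed
  finally have hb: "has_bochner_integral (lebesgue_Rn n)
    (\<lambda>u. (\<Prod>a<n. std_normal_density (u a)) * (vec n u \<bullet> (B *\<^sub>v vec n u))\<^sup>2) S" .
  have "(\<integral>\<^sup>+u. ennreal ((\<Prod>a<n. std_normal_density (u a)) * (vec n u \<bullet> (B *\<^sub>v vec n u))\<^sup>2) \<partial>lebesgue_Rn n) = ennreal S"
    using hb by (subst nn_integral_eq_integral) (auto simp: has_bochner_integral_iff prod_nonneg)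
  then have "(\<integral>\<^sup>+u. ennreal (sqrt ((2 * pi) ^ n)) * ennreal ((\<Prod>a<n. std_normal_density (u a)) *
      (vec n u \<bullet> (B *\<^sub>v vec n u))\<^sup>2) \<partial>lebesgue_Rn n) = ennreal (sqrt ((2 * pi) ^ n)) * ennreal S"
    using hb by (subst nn_integral_cmult) (auto simp: has_bochner_integral_iff)
  then show ?thesis
    by (simp add: prod_std_normal_density S_def[symmetric] mult.commute flip: ennreal_mult' ennreal_mult'')
qed

lemma nn_integral_std_normal:
  "(\<integral>\<^sup>+u. ennreal (exp (- (vec n u \<bullet> vec n u) / 2)) \<partial>lebesgue_Rn n) = ennreal (sqrt ((2 * pi) ^ n))"
proof -
  have "(\<integral>\<^sup>+u. (\<Prod>a<n. ennreal (std_normal_density (u a))) \<partial>lebesgue_Rn n) =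
      (\<Prod>a<n. \<integral>\<^sup>+x. ennreal (std_normal_density x) \<partial>lborel)"
    unfolding lebesgue_Rn_def by (intro lborel_product.product_nn_integral_prod) auto
  also have "(\<integral>\<^sup>+x. ennreal (std_normal_density x) \<partial>lborel) = 1"
    by (subst nn_integral_eq_integral) (auto simp: integrable_normal_density integral_normal_density)
  finally have *: "(\<integral>\<^sup>+u. ennreal (\<Prod>a<n. std_normal_density (u a)) \<partial>lebesgue_Rn n) = 1"
    by (simp add: prod_ennreal)
  have "(\<integral>\<^sup>+u. ennreal (sqrt ((2 * pi) ^ n)) * ennreal (\<Prod>a<n. std_normal_density (u a)) \<partial>lebesgue_Rn n) =
      ennreal (sqrt ((2 * pi) ^ n))"
  proof (subst nn_integral_cmult)
    have "(\<lambda>u. \<Prod>a<n. std_normal_density (u a)) \<in> borel_measurable (lebesgue_Rn n)"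
      by (intro borel_measurable_prod measurable_compose[OF measurable_lebesgue_Rn_component borel_measurable_normal_density]) auto
    then show "(\<lambda>u. ennreal (\<Prod>a<n. std_normal_density (u a))) \<in> borel_measurable (lebesgue_Rn n)"
      by measurable
  qed (simp add: *)
  then show ?thesis by (simp add: prod_std_normal_density flip: ennreal_mult')
qed

text \<open>
  The substitution \<open>y = \<mu> + L u\<close>, where \<open>L\<close> is the Cholesky factor of the covariance matrix, turns
  the exponent with precision matrix \<open>K\<close> into the standard one.
\<close>
lemma gaussian_standardize:
  assumes K: "pos_def_mat n K" and \<mu>: "\<mu> \<in> carrier_vec n"
  obtains L where "L \<in> carrier_mat n n" "L * transpose_mat L = minv K"
    "\<forall>h. (\<lambda>y. h (vec n y - \<mu>)) \<in> borel_measurable (lebesgue_Rn n) \<longrightarrow>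
      (\<integral>\<^sup>+y. h (vec n y - \<mu>) * ennreal (exp (- ((vec n y - \<mu>) \<bullet> (K *\<^sub>v (vec n y - \<mu>))) / 2)) \<partial>lebesgue_Rn n) =
      ennreal (1 / sqrt (det K)) *
        (\<integral>\<^sup>+u. h (L *\<^sub>v vec n u) * ennreal (exp (- (vec n u \<bullet> vec n u) / 2)) \<partial>lebesgue_Rn n)"
proof -
  note Kc = pos_def_carrier[OF K] and Kd = pos_def_det_nonzero[OF K]
  obtain L where L: "L \<in> carrier_mat n n" and low: "\<And>i j. i < j \<Longrightarrow> j < n \<Longrightarrow> L $$ (i, j) = 0"
    and diag: "\<And>i. i < n \<Longrightarrow> 0 < L $$ (i, i)" and LL: "minv K = L * transpose_mat L"
    using cholesky[OF pos_def_minv[OF K]] by metis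
  have detL: "0 < det L"
    using diag L by (subst det_lower_triangular[OF low L]) (auto simp: prod_list_diag_prod intro!: prod_pos)
  have "det K * (det L)\<^sup>2 = det (K * minv K)"
    using L Kc by (simp add: LL det_mult[of _ n] det_transpose[of _ n] power2_eq_square)
  also have "\<dots> = 1" using minv_right[OF Kc Kd] by simp
  finally have "(det L)\<^sup>2 = 1 / det K" using Kd by (simp add: field_simps)
  then have dL: "det L = 1 / sqrt (det K)" using detL by (metis real_sqrt_divide real_sqrt_one real_sqrt_unique less_imp_le)
  have "L * (transpose_mat L * K) = 1\<^sub>m n"
    using minv_left[OF Kc Kd] L Kc by (simp add: LL)
  from minv_unique[OF L _ this] minv_left[OF L] L Kc
  have LKL: "transpose_mat L * K * L = 1\<^sub>m n" by simp
  have "(\<integral>\<^sup>+y. h (vec n y - \<mu>) * ennreal (exp (- ((vec n y - \<mu>) \<bullet> (K *\<^sub>v (vec n y - \<mu>))) / 2)) \<partial>lebesgue_Rn n) =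
      ennreal (1 / sqrt (det K)) *
        (\<integral>\<^sup>+u. h (L *\<^sub>v vec n u) * ennreal (exp (- (vec n u \<bullet> vec n u) / 2)) \<partial>lebesgue_Rn n)"
    if [measurable]: "(\<lambda>y. h (vec n y - \<mu>)) \<in> borel_measurable (lebesgue_Rn n)" for h :: "real vec \<Rightarrow> ennreal"
  proof -
    have [measurable]: "(\<lambda>y. (vec n y - \<mu>) \<bullet> (K *\<^sub>v (vec n y - \<mu>))) \<in> borel_measurable (lebesgue_Rn n)"
      using \<mu> Kc by (intro borel_measurable_quadratic_form) (auto intro: measurable_lebesgue_Rn_component)
    have minus: "\<mu> + L *\<^sub>v vec n u - \<mu> = L *\<^sub>v vec n u" for u using \<mu> L by auto
    have q: "(L *\<^sub>v vec n u) \<bullet> (K *\<^sub>v (L *\<^sub>v vec n u)) = vec n u \<bullet> vec n u" for u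
      using quadratic_form_congruence[OF Kc L, of "vec n u"] LKL by simp
    show ?thesis
      using \<mu> by (subst nn_integral_lebesgue_Rn_affine[OF L low diag \<mu>,
          where F="\<lambda>y. h (y - \<mu>) * ennreal (exp (- ((y - \<mu>) \<bullet> (K *\<^sub>v (y - \<mu>))) / 2))"])
        (simp_all add: minus q dL)
  qed
  then show ?thesis by (intro that[OF L LL[symmetric]]) blast
qed

lemma gaussian_mass:
  assumes K: "pos_def_mat n K" and \<mu>: "\<mu> \<in> carrier_vec n"
  shows "(\<integral>\<^sup>+y. ennreal (exp (- ((vec n y - \<mu>) \<bullet> (K *\<^sub>v (vec n y - \<mu>))) / 2)) \<partial>lebesgue_Rn n) =
    ennreal (sqrt ((2 * pi) ^ n / det K))"
proof -
  obtain L where "L \<in> carrier_mat n n" "L * transpose_mat L = minv K" and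
    *: "\<forall>h. (\<lambda>y. h (vec n y - \<mu>)) \<in> borel_measurable (lebesgue_Rn n) \<longrightarrow>
      (\<integral>\<^sup>+y. h (vec n y - \<mu>) * ennreal (exp (- ((vec n y - \<mu>) \<bullet> (K *\<^sub>v (vec n y - \<mu>))) / 2)) \<partial>lebesgue_Rn n) =
      ennreal (1 / sqrt (det K)) *
        (\<integral>\<^sup>+u. h (L *\<^sub>v vec n u) * ennreal (exp (- (vec n u \<bullet> vec n u) / 2)) \<partial>lebesgue_Rn n)"
    by (rule gaussian_standardize[OF K \<mu>])
  have "ennreal (1 / sqrt (det K)) * ennreal (sqrt ((2 * pi) ^ n)) = ennreal (sqrt ((2 * pi) ^ n / det K))"
    using pos_def_det_pos[OF K] by (simp add: real_sqrt_divide flip: ennreal_mult')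
  then show ?thesis using *[rule_format, of "\<lambda>_. 1"]
    unfolding nn_integral_std_normal mult_1 by simp
qed

lemma gaussian_quadratic_form_square:
  assumes K: "pos_def_mat n K" and \<mu>: "\<mu> \<in> carrier_vec n"
    and D: "D \<in> carrier_mat n n" "transpose_mat D = D"
  shows "(\<integral>\<^sup>+y. ennreal (((vec n y - \<mu>) \<bullet> (D *\<^sub>v (vec n y - \<mu>)))\<^sup>2) *
      ennreal (exp (- ((vec n y - \<mu>) \<bullet> (K *\<^sub>v (vec n y - \<mu>))) / 2)) \<partial>lebesgue_Rn n) =
    ennreal (sqrt ((2 * pi) ^ n / det K) * ((mtrace (D * minv K))\<^sup>2 + 2 * mtrace (D * minv K * (D * minv K))))"
proof -
  obtain L where L: "L \<in> carrier_mat n n" and LL: "L * transpose_mat L = minv K" and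
    *: "\<forall>h. (\<lambda>y. h (vec n y - \<mu>)) \<in> borel_measurable (lebesgue_Rn n) \<longrightarrow>
      (\<integral>\<^sup>+y. h (vec n y - \<mu>) * ennreal (exp (- ((vec n y - \<mu>) \<bullet> (K *\<^sub>v (vec n y - \<mu>))) / 2)) \<partial>lebesgue_Rn n) =
      ennreal (1 / sqrt (det K)) *
        (\<integral>\<^sup>+u. h (L *\<^sub>v vec n u) * ennreal (exp (- (vec n u \<bullet> vec n u) / 2)) \<partial>lebesgue_Rn n)"
    by (rule gaussian_standardize[OF K \<mu>])
  define B where "B = transpose_mat L * D * L"
  have Bc: "B \<in> carrier_mat n n" using L D by (simp add: B_def)
  have Bs: "transpose_mat B = B"
    using L D by (simp add: B_def transpose_mult[of _ n n _ n])
  have tr1: "mtrace B = mtrace (D * minv K)"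
    using L D mtrace_comm[of "transpose_mat L" n n "D * L"] by (simp add: B_def flip: LL)
  have tr2: "mtrace (B * B) = mtrace (D * minv K * (D * minv K))"
    using L D mtrace_comm[of "transpose_mat L" n n "D * (L * (transpose_mat L * (D * L)))"]
    by (simp add: B_def assoc_mult_mat[of _ n n _ n _ n] mult_carrier_mat[of _ n n _ n] flip: LL)
  have [measurable]: "(\<lambda>y. (vec n y - \<mu>) \<bullet> (D *\<^sub>v (vec n y - \<mu>))) \<in> borel_measurable (lebesgue_Rn n)"
    using \<mu> D by (intro borel_measurable_quadratic_form) (auto intro: measurable_lebesgue_Rn_component)
  have q: "(L *\<^sub>v vec n u) \<bullet> (D *\<^sub>v (L *\<^sub>v vec n u)) = vec n u \<bullet> (B *\<^sub>v vec n u)" for u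
    using quadratic_form_congruence[OF D(1) L, of "vec n u"] by (simp add: B_def)
  have "(\<integral>\<^sup>+y. ennreal (((vec n y - \<mu>) \<bullet> (D *\<^sub>v (vec n y - \<mu>)))\<^sup>2) *
      ennreal (exp (- ((vec n y - \<mu>) \<bullet> (K *\<^sub>v (vec n y - \<mu>))) / 2)) \<partial>lebesgue_Rn n) =
      ennreal (1 / sqrt (det K)) * ennreal (sqrt ((2 * pi) ^ n) * ((mtrace B)\<^sup>2 + 2 * mtrace (B * B)))"
    by (subst *[rule_format, of "\<lambda>v. ennreal ((v \<bullet> (D *\<^sub>v v))\<^sup>2)"])
      (simp_all only: q nn_integral_std_normal_quadratic_form_square[OF Bc Bs], measurable)
  also have "\<dots> = ennreal (1 / sqrt (det K) * (sqrt ((2 * pi) ^ n) * ((mtrace B)\<^sup>2 + 2 * mtrace (B * B))))"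
    using pos_def_det_pos[OF K] by (intro ennreal_mult'[symmetric]) simp
  also have "1 / sqrt (det K) * (sqrt ((2 * pi) ^ n) * ((mtrace B)\<^sup>2 + 2 * mtrace (B * B))) =
    sqrt ((2 * pi) ^ n / det K) * ((mtrace B)\<^sup>2 + 2 * mtrace (B * B))"
    by (simp add: real_sqrt_divide)
  finally show ?thesis by (simp only: tr1 tr2)
qed

section \<open>One-dimensional integrals\<close>

text \<open>
  Used to write the reciprocal of a squared quadratic form as a mixture of exponentials.
\<close>
lemma nn_integral_linear_exp:
  assumes q: "0 < q"
  shows "(\<integral>\<^sup>+t. ennreal (t * exp (- t * q)) * indicator {0..} t \<partial>lborel) = ennreal (1 / q\<^sup>2)"
proof -
  define F where "F t = - (t / q + 1 / q\<^sup>2) * exp (- t * q)" for t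
  have "(F has_real_derivative t * exp (- t * q)) (at t)" for t
    unfolding F_def using q
    by (auto intro!: derivative_eq_intros simp: field_simps power2_eq_square)
  moreover have "(F \<longlongrightarrow> 0) at_top" unfolding F_def using q by real_asymp
  ultimately have "(\<integral>\<^sup>+t. ennreal (t * exp (- t * q)) * indicator {0..} t \<partial>lborel) = 0 - F 0"
    by (intro nn_integral_FTC_atLeast) auto
  then show ?thesis by (simp add: F_def)
qed

text \<open>
  With \<open>x = 1 + 2 * t\<close> and \<open>a = m/2\<close> the integrand is \<open>(x - 1) / 2 * x powr (- 2 - a)\<close>, whose
  antiderivative is elementary.
\<close>
lemma nn_integral_tilt_tail:
  assumes m: "0 < m"
  shows "(\<integral>\<^sup>+t. ennreal (t / ((1 + 2 * t)\<^sup>2 * sqrt ((1 + 2 * t) ^ m))) * indicator {0..} t \<partial>lborel) =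
    ennreal (1 / (real m * (real m + 2)))"
proof -
  define a where "a = real m / 2"
  have a: "0 < a" using m by (simp add: a_def)
  define F where "F t = ((1 + 2 * t) powr (- 1 - a) / (1 + a) - (1 + 2 * t) powr (- a) / a) / 4" for t
  have "(F has_real_derivative t / ((1 + 2 * t)\<^sup>2 * sqrt ((1 + 2 * t) ^ m))) (at t)" if t: "0 \<le> t" for t
  proof -
    define x where "x = 1 + 2 * t"
    have x: "0 < x" using t by (simp add: x_def)
    have "sqrt (x ^ m) = x powr a"
      using x by (simp add: powr_half_sqrt[symmetric] powr_realpow[symmetric] powr_powr a_def)
    moreover have "x\<^sup>2 = x powr 2" using x by (simp add: powr_numeral)
    ultimately have "t / (x\<^sup>2 * sqrt (x ^ m)) = t * x powr (- 2 - a)"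
      using x by (simp add: powr_diff powr_minus field_simps)
    also have "\<dots> = (x - 1) * x powr (- 2 - a) / 2" by (simp add: x_def)
    also have "\<dots> = ((- 1 - a) * x powr (- 1 - a - 1) * 2 / (1 + a) - (- a) * x powr (- a - 1) * 2 / a) / 4"
    proof -
      have "1 + (- 2 - a) = - a - 1" by simp
      then have "x * x powr (- 2 - a) = x powr (- a - 1)" using x by (simp only: powr_mult_base less_imp_le)
      moreover have "x powr (- 1 - a - 1) = x powr (- 2 - a)" by (rule arg_cong) simp
      ultimately have "x powr (- 1 - a - 1) = x powr (- 2 - a)" "x powr (- a - 1) = x * x powr (- 2 - a)" by simp_all
      moreover have "(x - 1) * b / 2 = ((- 1 - a) * b * 2 / (1 + a) - (- a) * (x * b) * 2 / a) / 4" for b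
        using a by (simp add: field_simps)
      ultimately show ?thesis by presburger
    qed
    finally have eq: "t / (x\<^sup>2 * sqrt (x ^ m)) =
      ((- 1 - a) * x powr (- 1 - a - 1) * 2 / (1 + a) - (- a) * x powr (- a - 1) * 2 / a) / 4" .
    have P: "((\<lambda>t. (1 + 2 * t) powr c) has_real_derivative c * x powr (c - 1) * 2) (at t)" for c
      using x by (auto intro!: derivative_eq_intros simp: x_def powr_diff field_simps)
    show ?thesis
      unfolding F_def eq[unfolded x_def] by (intro DERIV_cdivide DERIV_diff P[unfolded x_def])
  qed
  moreover have "(F \<longlongrightarrow> 0) at_top"
  proof -
    have *: "LIM t at_top. 1 + 2 * t :> (at_top :: real filter)" by real_asymp
    have "(F \<longlongrightarrow> (0 / (1 + a) - 0 / a) / 4) at_top"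
      unfolding F_def using a by (intro tendsto_intros tendsto_neg_powr *) auto
    then show ?thesis by simp
  qed
  ultimately have "(\<integral>\<^sup>+t. ennreal (t / ((1 + 2 * t)\<^sup>2 * sqrt ((1 + 2 * t) ^ m))) * indicator {0..} t \<partial>lborel) = 0 - F 0"
    by (intro nn_integral_FTC_atLeast) auto
  also have "0 - F 0 = 1 / (real m * (real m + 2))"
  proof -
    have "0 - F 0 = (1 / a - 1 / (1 + a)) / 4" by (simp add: F_def diff_divide_distrib)
    also have "1 / a - 1 / (1 + a) = 1 / (a * (1 + a))" using a by (simp add: field_simps)
    also have "\<dots> / 4 = 1 / (4 * (a * (1 + a)))" by simp
    also have "4 * (a * (1 + a)) = real m * (real m + 2)" by (simp add: a_def field_simps)
    finally show ?thesis .
  qed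
  finally show ?thesis .
qed

text \<open>
  The integral over the variance \<open>s\<close> that remains once the mean parameters have been integrated
  out; it is extended-valued because it diverges for \<open>q = 0\<close>. Up to a constant it is the
  normalising constant of an inverse gamma distribution.
\<close>
definition radial :: "nat \<Rightarrow> real \<Rightarrow> ennreal" where
  "radial m q = (\<integral>\<^sup>+s. ennreal (indicator {0<..} s * (exp (- q / (2 * s)) / (s * sqrt (s ^ m)))) \<partial>lborel)"

lemma radial_scale:
  assumes q: "0 < q"
  shows "radial m q = ennreal (1 / sqrt (q ^ m)) * radial m 1"
proof -
  have "radial m q = ennreal \<bar>q\<bar> * (\<integral>\<^sup>+s. ennreal (indicator {0<..} (0 + q * s) *
      (exp (- q / (2 * (0 + q * s))) / ((0 + q * s) * sqrt ((0 + q * s) ^ m)))) \<partial>lborel)"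
    unfolding radial_def using q by (intro nn_integral_real_affine) auto
  also have "\<dots> = (\<integral>\<^sup>+s. ennreal \<bar>q\<bar> * ennreal (indicator {0<..} (0 + q * s) *
      (exp (- q / (2 * (0 + q * s))) / ((0 + q * s) * sqrt ((0 + q * s) ^ m)))) \<partial>lborel)"
    by (intro nn_integral_cmult[symmetric]) measurable
  also have "\<dots> = (\<integral>\<^sup>+s. ennreal (1 / sqrt (q ^ m)) *
      ennreal (indicator {0<..} s * (exp (- 1 / (2 * s)) / (s * sqrt (s ^ m)))) \<partial>lborel)"
  proof (intro nn_integral_cong)
    fix s :: real
    have "q * (indicator {0<..} (q * s) * (exp (- q / (2 * (q * s))) / ((q * s) * sqrt ((q * s) ^ m)))) =
        1 / sqrt (q ^ m) * (indicator {0<..} s * (exp (- 1 / (2 * s)) / (s * sqrt (s ^ m))))"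
    proof (cases "0 < s")
      case True
      then have "q * s \<in> {0<..}" using q by simp
      then show ?thesis using q True by (simp add: power_mult_distrib real_sqrt_mult)
    next
      case False
      then have "q * s \<notin> {0<..}" using q by (simp add: zero_less_mult_iff)
      then show ?thesis using False by simp
    qed
    then show "ennreal \<bar>q\<bar> * ennreal (indicator {0<..} (0 + q * s) *
      (exp (- q / (2 * (0 + q * s))) / ((0 + q * s) * sqrt ((0 + q * s) ^ m)))) =
      ennreal (1 / sqrt (q ^ m)) * ennreal (indicator {0<..} s * (exp (- 1 / (2 * s)) / (s * sqrt (s ^ m))))"
      using q by (simp flip: ennreal_mult')
  qed
  also have "\<dots> = ennreal (1 / sqrt (q ^ m)) * radial m 1"
    unfolding radial_def by (intro nn_integral_cmult) measurable
  finally show ?thesis .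
qed

text \<open>
  Near \<open>0\<close> the exponential factor beats every power of \<open>s\<close>; from \<open>1\<close> on, the integrand is
  dominated by \<open>s powr (- 3/2)\<close>.
\<close>
lemma radial_one_finite:
  assumes m: "0 < m" shows "radial m 1 < \<infinity>"
proof -
  \<comment> \<open>the constant for which \<open>exp (- 1 / (2 * s)) \<le> c * s ^ Suc m\<close>,
    from \<open>(x / N) ^ N \<le> exp x\<close> with \<open>x = 1 / (2 * s)\<close> and \<open>N = Suc m\<close>\<close>
  define c :: real where "c = (2 * real (Suc m)) ^ Suc m"
  have le: "ennreal (indicator {0<..} s * (exp (- 1 / (2 * s)) / (s * sqrt (s ^ m)))) \<le>
      ennreal c * indicator {0..1} s + ennreal (1 / (s * sqrt s)) * indicator {1..} s" for s
  proof -
    consider "s \<le> 0" | "0 < s" "s \<le> 1" | "1 < s" by linarith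
    then show ?thesis
    proof cases
      case 1 then show ?thesis by simp
    next
      case 2
      define x where "x = 1 / (2 * s)"
      have x: "0 < x" using 2 by (simp add: x_def)
      have "(x / real (Suc m)) ^ Suc m \<le> (1 + x / real (Suc m)) ^ Suc m"
        using x by (intro power_mono) auto
      also have "\<dots> \<le> exp x" using x by (intro exp_ge_one_plus_x_over_n_power_n) auto
      finally have "(c * s ^ Suc m) * (x / real (Suc m)) ^ Suc m \<le> (c * s ^ Suc m) * exp x"
        using 2 by (intro mult_left_mono) (auto simp: c_def)
      moreover have "(c * s ^ Suc m) * (x / real (Suc m)) ^ Suc m = (2 * real (Suc m) * s * (x / real (Suc m))) ^ Suc m"
        unfolding c_def by (simp only: power_mult_distrib)
      moreover have "2 * real (Suc m) * s * (x / real (Suc m)) = 1" using 2 by (simp add: x_def)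
      ultimately have "1 \<le> c * s ^ Suc m * exp (1 / (2 * s))" by (simp only: power_one x_def)
      then have e: "exp (- 1 / (2 * s)) \<le> c * s ^ Suc m"
        by (simp add: exp_minus field_simps)
      have "s ^ m * s ^ m \<le> s ^ m * 1" using 2 by (intro mult_left_mono) (auto simp: power_le_one)
      then have "s ^ m \<le> sqrt (s ^ m)" using 2 by (intro real_le_rsqrt) (simp add: power2_eq_square)
      then have "s ^ Suc m \<le> s * sqrt (s ^ m)" using 2 by simp
      then have "c * s ^ Suc m \<le> c * (s * sqrt (s ^ m))"
        by (intro mult_left_mono) (auto simp: c_def)
      then have "exp (- 1 / (2 * s)) \<le> c * (s * sqrt (s ^ m))" using e by linarith
      then have "exp (- 1 / (2 * s)) / (s * sqrt (s ^ m)) \<le> c"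
        using 2 by (simp add: pos_divide_le_eq)
      then have "ennreal (exp (- 1 / (2 * s)) / (s * sqrt (s ^ m))) \<le> ennreal c" by (rule ennreal_leI)
      then show ?thesis using 2 by (simp add: add_increasing2)
    next
      case 3
      have "s ^ 1 \<le> s ^ m" using 3 m by (intro power_increasing) auto
      then have "s * sqrt s \<le> s * sqrt (s ^ m)" using 3 by simp
      then have "exp (- 1 / (2 * s)) / (s * sqrt (s ^ m)) \<le> 1 / (s * sqrt s)"
        using 3 by (intro frac_le) auto
      then show ?thesis using 3 by (simp add: ennreal_leI)
    qed
  qed
  have "radial m 1 \<le> (\<integral>\<^sup>+s. ennreal c * indicator {0..1} s + ennreal (1 / (s * sqrt s)) * indicator {1..} s \<partial>lborel)"
    unfolding radial_def by (intro nn_integral_mono le)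
  also have "\<dots> = (\<integral>\<^sup>+s. ennreal c * indicator {0..1::real} s \<partial>lborel) +
      (\<integral>\<^sup>+s. ennreal (1 / (s * sqrt s)) * indicator {1..} s \<partial>lborel)"
    by (intro nn_integral_add) measurable
  also have "(\<integral>\<^sup>+s. ennreal c * indicator {0..1::real} s \<partial>lborel) = ennreal c"
    by (simp add: nn_integral_cmult_indicator)
  also have "(\<integral>\<^sup>+s. ennreal (1 / (s * sqrt s)) * indicator {1..} s \<partial>lborel) = ennreal (0 - (- 2 / sqrt 1))"
  proof (rule nn_integral_FTC_atLeast)
    show "((\<lambda>s. - 2 / sqrt s) has_real_derivative 1 / (s * sqrt s)) (at s)" if "1 \<le> s" for s
      using that by (auto intro!: derivative_eq_intros simp: field_simps)
    show "((\<lambda>s. - 2 / sqrt s :: real) \<longlongrightarrow> 0) at_top" by real_asymp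
  qed auto
  finally show ?thesis by (auto simp: top_unique less_top[symmetric] intro: le_less_trans)
qed

lemma radial_one_pos: "0 < radial m 1"
proof -
  define c :: real where "c = exp (- 1 / 2) / (2 * sqrt (2 ^ m))"
  have "ennreal c = (\<integral>\<^sup>+s. ennreal c * indicator {1..2::real} s \<partial>lborel)"
    by (simp add: nn_integral_cmult_indicator)
  also have "\<dots> \<le> radial m 1"
    unfolding radial_def
  proof (intro nn_integral_mono)
    fix s :: real
    show "ennreal c * indicator {1..2} s \<le> ennreal (indicator {0<..} s * (exp (- 1 / (2 * s)) / (s * sqrt (s ^ m))))"
    proof (cases "1 \<le> s \<and> s \<le> 2")
      case True
      have "s * sqrt (s ^ m) \<le> 2 * sqrt (2 ^ m)" using True by (intro mult_mono) (auto intro: power_mono)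
      moreover have "exp (- 1 / 2) \<le> exp (- 1 / (2 * s))" using True by (simp add: field_simps)
      ultimately have "c \<le> exp (- 1 / (2 * s)) / (s * sqrt (s ^ m))"
        unfolding c_def using True by (intro frac_le) auto
      then show ?thesis using True by (simp add: ennreal_leI)
    qed auto
  qed
  finally show ?thesis by (rule less_le_trans[rotated]) (simp add: c_def)
qed

definition radial_const :: "nat \<Rightarrow> real" where
  "radial_const m = enn2real (radial m 1)"

lemma radial_const_pos: "0 < m \<Longrightarrow> 0 < radial_const m"
  using radial_one_finite[of m] radial_one_pos[of m] by (simp add: radial_const_def enn2real_positive_iff)

lemma enn2real_radial: "0 < q \<Longrightarrow> enn2real (radial m q) = radial_const m / sqrt (q ^ m)"
  by (simp add: radial_scale[of q] enn2real_mult radial_const_def)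

section \<open>Derivatives of determinants and inverses\<close>

lemma differentiable_transform_open:
  fixes f g :: "real \<Rightarrow> real"
  assumes "f differentiable (at x)" "open S" "x \<in> S" "\<And>t. t \<in> S \<Longrightarrow> f t = g t"
  shows "g differentiable (at x)"
  using assms unfolding differentiable_def by (metis has_derivative_transform_within_open)

lemma differentiable_prod:
  fixes f :: "'i \<Rightarrow> real \<Rightarrow> real"
  assumes "finite A" "\<And>i. i \<in> A \<Longrightarrow> f i differentiable (at x)"
  shows "(\<lambda>t. \<Prod>i\<in>A. f i t) differentiable (at x)"
  using assms by (induction A rule: finite_induct) (auto intro!: differentiable_mult)

text \<open>
  The Leibniz formula exhibits the determinant as a polynomial in the entries.
\<close>
lemma det_differentiable:
  fixes A :: "real \<Rightarrow> real mat"
  assumes I: "open I" "\<theta> \<in> I" and A: "\<And>t. t \<in> I \<Longrightarrow> A t \<in> carrier_mat k k"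
    and d: "\<And>i j. i < k \<Longrightarrow> j < k \<Longrightarrow> (\<lambda>t. A t $$ (i, j)) differentiable (at \<theta>)"
  shows "(\<lambda>t. det (A t)) differentiable (at \<theta>)"
proof (rule differentiable_transform_open[OF _ I])
  show "(\<lambda>t. \<Sum>q | q permutes {0..<k}. signof q * (\<Prod>i = 0..<k. A t $$ (i, q i))) differentiable (at \<theta>)"
  proof (intro differentiable_sum ballI differentiable_mult differentiable_const differentiable_prod d)
    fix q i assume "q \<in> {q. q permutes {0..<k}}" "i \<in> {0..<k}"
    then show "i < k" "q i < k" using permutes_in_image[of q "{0..<k}" i] by auto
  qed (auto intro: finite_permutations)
  show "(\<Sum>q | q permutes {0..<k}. signof q * (\<Prod>i = 0..<k. A t $$ (i, q i))) = det (A t)" if "t \<in> I" for t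
    using det_def'[OF A[OF that]] by simp
qed

context
  fixes A :: "real \<Rightarrow> real mat" and A' :: "real mat" and I :: "real set" and \<theta> :: real and k :: nat
  assumes I: "open I" "\<theta> \<in> I" and A: "\<And>t. t \<in> I \<Longrightarrow> A t \<in> carrier_mat k k" "\<And>t. t \<in> I \<Longrightarrow> det (A t) \<noteq> 0"
    and A': "A' \<in> carrier_mat k k"
    and dA: "\<And>i j. i < k \<Longrightarrow> j < k \<Longrightarrow> ((\<lambda>t. A t $$ (i, j)) has_real_derivative A' $$ (i, j)) (at \<theta>)"
begin

text \<open>
  By Cramer's rule the entries of the inverse are quotients of determinants.
\<close>
lemma minv_differentiable:
  assumes ij: "i < k" "j < k"
  shows "(\<lambda>t. minv (A t) $$ (i, j)) differentiable (at \<theta>)"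
proof (rule differentiable_transform_open[OF _ I])
  have diff: "(\<lambda>t. A t $$ (i, j)) differentiable (at \<theta>)" if "i < k" "j < k" for i j
    using dA[OF that] real_differentiable_def by blast
  have "(\<lambda>t. det (mat_delete (A t) j i)) differentiable (at \<theta>)"
  proof (rule det_differentiable[OF I])
    show "mat_delete (A t) j i \<in> carrier_mat (k - 1) (k - 1)" if "t \<in> I" for t
      using A(1)[OF that] by (simp add: mat_delete_def)
    show "(\<lambda>t. mat_delete (A t) j i $$ (i', j')) differentiable (at \<theta>)" if "i' < k - 1" "j' < k - 1" for i' j'
    proof (rule differentiable_transform_open[OF _ I])
      show "(\<lambda>t. A t $$ (if i' < j then i' else Suc i', if j' < i then j' else Suc j')) differentiable (at \<theta>)"
        using that by (intro diff) auto
      show "A t $$ (if i' < j then i' else Suc i', if j' < i then j' else Suc j') = mat_delete (A t) j i $$ (i', j')"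
        if "t \<in> I" for t
        using A(1)[OF that] \<open>i' < k - 1\<close> \<open>j' < k - 1\<close> by (simp add: mat_delete_def)
    qed
  qed
  moreover have "(\<lambda>t. det (A t)) differentiable (at \<theta>)"
    by (rule det_differentiable[OF I A(1) diff])
  ultimately show "(\<lambda>t. (- 1) ^ (j + i) * det (mat_delete (A t) j i) / det (A t)) differentiable (at \<theta>)"
    using A(2)[OF I(2)] by (intro differentiable_divide differentiable_mult differentiable_const) auto
  show "(- 1) ^ (j + i) * det (mat_delete (A t) j i) / det (A t) = minv (A t) $$ (i, j)" if t: "t \<in> I" for t
  proof -
    note adj = adj_mat[OF A(1)[OF t]]
    have "A t * ((1 / det (A t)) \<cdot>\<^sub>m adj_mat (A t)) = 1\<^sub>m k"
      using mult_smult_distrib[OF A(1)[OF t] adj(1), of "1 / det (A t)"] A(2)[OF t] adj(2) by (auto intro!: eq_matI)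
    then have "minv (A t) = (1 / det (A t)) \<cdot>\<^sub>m adj_mat (A t)"
      using adj(1) by (intro minv_unique(2)[OF A(1)[OF t]]) auto
    then show ?thesis using ij A(1)[OF t] by (simp add: adj_mat_def cofactor_def)
  qed
qed

text \<open>
  Once the inverse is known to be differentiable, differentiating \<open>A * minv A = 1\<close> entry by entry
  determines its derivative.
\<close>
lemma minv_has_derivative:
  assumes ij: "i < k" "j < k"
  shows "((\<lambda>t. minv (A t) $$ (i, j)) has_real_derivative
    ((- 1) \<cdot>\<^sub>m (minv (A \<theta>) * A' * minv (A \<theta>))) $$ (i, j)) (at \<theta>)"
proof -
  define X where "X = mat k k (\<lambda>ij. deriv (\<lambda>t. minv (A t) $$ ij) \<theta>)"
  have X: "X \<in> carrier_mat k k" by (simp add: X_def)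
  have dX: "((\<lambda>t. minv (A t) $$ (i, j)) has_real_derivative X $$ (i, j)) (at \<theta>)" if "i < k" "j < k" for i j
    using minv_differentiable[OF that] that by (simp add: X_def DERIV_deriv_iff_real_differentiable)
  define B where "B = minv (A \<theta>)"
  note inv = minv_inverse[OF A(1)[OF I(2)] A(2)[OF I(2)]]
  have B: "B \<in> carrier_mat k k" "B * A \<theta> = 1\<^sub>m k" using inv by (simp_all add: B_def)
  have A\<theta>: "A \<theta> \<in> carrier_mat k k" by (rule A(1)[OF I(2)])
  have "A \<theta> * X = (- 1) \<cdot>\<^sub>m (A' * B)"
  proof (rule eq_matI)
    fix i j assume "i < dim_row ((- 1) \<cdot>\<^sub>m (A' * B))" "j < dim_col ((- 1) \<cdot>\<^sub>m (A' * B))"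
    then have ij: "i < k" "j < k" using A' B by simp_all
    have "((\<lambda>t. \<Sum>l<k. A t $$ (i, l) * minv (A t) $$ (l, j)) has_real_derivative
        (\<Sum>l<k. A' $$ (i, l) * minv (A \<theta>) $$ (l, j) + X $$ (l, j) * A \<theta> $$ (i, l))) (at \<theta>)"
      using ij by (intro DERIV_sum DERIV_mult dA dX) auto
    moreover have "((\<lambda>t. \<Sum>l<k. A t $$ (i, l) * minv (A t) $$ (l, j)) has_real_derivative 0) (at \<theta>)"
    proof (rule has_field_derivative_transform_within_open[OF _ I])
      show "((\<lambda>t. 1\<^sub>m k $$ (i, j)) has_real_derivative 0) (at \<theta>)" by simp
      show "1\<^sub>m k $$ (i, j) = (\<Sum>l<k. A t $$ (i, l) * minv (A t) $$ (l, j))" if "t \<in> I" for t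
      proof -
        have "1\<^sub>m k $$ (i, j) = (A t * minv (A t)) $$ (i, j)"
          by (simp only: minv_right[OF A(1)[OF that] A(2)[OF that]])
        also have "\<dots> = (\<Sum>l<k. A t $$ (i, l) * minv (A t) $$ (l, j))"
          using ij A(1)[OF that] minv_carrier[OF A(1)[OF that] A(2)[OF that]] by (simp add: scalar_prod_def atLeast0LessThan)
        finally show ?thesis .
      qed
    qed
    ultimately have "(\<Sum>l<k. A' $$ (i, l) * B $$ (l, j) + X $$ (l, j) * A \<theta> $$ (i, l)) = 0"
      unfolding B_def by (rule DERIV_unique)
    then show "(A \<theta> * X) $$ (i, j) = ((- 1) \<cdot>\<^sub>m (A' * B)) $$ (i, j)"
      using ij A\<theta> A' B X by (simp add: scalar_prod_def atLeast0LessThan sum.distrib mult.commute)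
  qed (use A\<theta> X A' B in auto)
  then have "B * (A \<theta> * X) = (- 1) \<cdot>\<^sub>m (B * (A' * B))"
    using mult_smult_distrib[OF B(1) mult_carrier_mat[OF A' B(1)]] by simp
  moreover have "B * (A \<theta> * X) = X"
    using assoc_mult_mat[OF B(1) A\<theta> X] B X by simp
  moreover have "B * (A' * B) = B * A' * B"
    using assoc_mult_mat[OF B(1) A' B(1)] by simp
  ultimately have "X = (- 1) \<cdot>\<^sub>m (B * A' * B)" by simp
  then show ?thesis using dX[OF ij] by (simp only: B_def)
qed

end

section \<open>Means, contrasts and tilted precisions\<close>

text \<open>
  Two matrices side by side, as a block matrix whose lower blocks have no rows, so that the theory
  of block matrices and their determinants applies.
\<close>
definition hcat :: "real mat \<Rightarrow> real mat \<Rightarrow> real mat" where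
  "hcat A B = four_block_mat A B (0\<^sub>m 0 (dim_col A)) (0\<^sub>m 0 (dim_col B))"

lemma hcat_carrier: "A \<in> carrier_mat n p \<Longrightarrow> B \<in> carrier_mat n m \<Longrightarrow> hcat A B \<in> carrier_mat n (p + m)"
  unfolding hcat_def by (intro carrier_matI) auto

lemma mult_hcat:
  assumes "K \<in> carrier_mat k n" "A \<in> carrier_mat n p" "B \<in> carrier_mat n m"
  shows "K * hcat A B = hcat (K * A) (K * B)"
  using assms by (intro eq_matI) (auto simp: hcat_def scalar_prod_def intro!: sum.cong)

lemma transpose_hcat_mult_hcat:
  assumes "A \<in> carrier_mat n p" "B \<in> carrier_mat n m" "C \<in> carrier_mat n q" "D \<in> carrier_mat n r"
  shows "transpose_mat (hcat A B) * hcat C D = four_block_mat (transpose_mat A * C) (transpose_mat A * D)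
    (transpose_mat B * C) (transpose_mat B * D)"
  using assms by (intro eq_matI) (auto simp: hcat_def scalar_prod_def intro!: sum.cong)

lemma hcat_mult_vec:
  assumes "A \<in> carrier_mat n p" "B \<in> carrier_mat n m" "x \<in> carrier_vec (p + m)"
  shows "hcat A B *\<^sub>v x = A *\<^sub>v vec_first x p + B *\<^sub>v vec_last x m"
proof -
  have "x = vec_first x p @\<^sub>v vec_last x m" using assms(3) by simp
  then have "hcat A B *\<^sub>v x = four_block_mat A B (0\<^sub>m 0 p) (0\<^sub>m 0 m) *\<^sub>v (vec_first x p @\<^sub>v vec_last x m)"
    using assms by (simp add: hcat_def)
  also have "\<dots> = (A *\<^sub>v vec_first x p + B *\<^sub>v vec_last x m) @\<^sub>v
      (0\<^sub>m 0 p *\<^sub>v vec_first x p + 0\<^sub>m 0 m *\<^sub>v vec_last x m)"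
    using assms by (intro four_block_mat_mult_vec[of _ n p _ m _ 0]) auto
  also have "\<dots> = A *\<^sub>v vec_first x p + B *\<^sub>v vec_last x m"
    using assms by (intro eq_vecI) auto
  finally show ?thesis .
qed

text \<open>
  The assumptions extract from the rank and column space conditions what the argument needs: \<open>H\<close>
  and \<open>W\<close> are injective, their columns are orthogonal to each other, and their numbers of columns
  add up to \<open>n\<close>.
\<close>
locale kriging_design =
  fixes n p :: nat and H W :: "real mat"
  assumes p_less_n: "p < n"
    and H: "H \<in> carrier_mat n p" and W: "W \<in> carrier_mat n (n - p)"
    and H_inj: "\<And>x. x \<in> carrier_vec p \<Longrightarrow> H *\<^sub>v x = 0\<^sub>v n \<Longrightarrow> x = 0\<^sub>v p"
    and W_inj: "\<And>x. x \<in> carrier_vec (n - p) \<Longrightarrow> W *\<^sub>v x = 0\<^sub>v n \<Longrightarrow> x = 0\<^sub>v (n - p)"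
    and WH: "transpose_mat W * H = 0\<^sub>m (n - p) p"
begin

abbreviation "m \<equiv> n - p"

abbreviation contrast_cov :: "real mat \<Rightarrow> real mat" where
  "contrast_cov C \<equiv> transpose_mat W * C * W"

abbreviation mean_precision :: "real mat \<Rightarrow> real mat" where
  "mean_precision C \<equiv> transpose_mat H * minv C * H"

lemma HW: "transpose_mat H * W = 0\<^sub>m p m"
  using arg_cong[OF WH, of transpose_mat] transpose_mult[of "transpose_mat W" m n H p] H W by simp

lemma n_eq: "p + m = n" using p_less_n by simp

lemma pos_def_contrast_cov: "pos_def_mat n C \<Longrightarrow> pos_def_mat m (contrast_cov C)"
  by (rule pos_def_congruence[OF _ W W_inj])

lemma pos_def_mean_precision: "pos_def_mat n C \<Longrightarrow> pos_def_mat p (mean_precision C)"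
  by (rule pos_def_congruence[OF pos_def_minv H H_inj])

lemma pos_def_gram: "pos_def_mat p (transpose_mat H * H)" "pos_def_mat m (transpose_mat W * W)"
  using pos_def_congruence[OF pos_def_one H H_inj] pos_def_congruence[OF pos_def_one W W_inj] H W by simp_all

lemma contrast_cov_carrier: "S \<in> carrier_mat n n \<Longrightarrow> contrast_cov S \<in> carrier_mat m m"
  using W by (simp add: mult_carrier_mat[of _ m n _ n] mult_carrier_mat[of _ m n _ m])

lemma contrast_cov_entry:
  assumes S: "S \<in> carrier_mat n n" and ij: "i < m" "j < m"
  shows "contrast_cov S $$ (i, j) = (\<Sum>k<n. \<Sum>l<n. W $$ (k, i) * S $$ (k, l) * W $$ (l, j))"
proof -
  have "contrast_cov S = transpose_mat W * (S * W)" using W S by simp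
  then have "contrast_cov S $$ (i, j) = row (transpose_mat W) i \<bullet> col (S * W) j"
    using ij W S by (simp only:, intro index_mult_mat(1)) simp_all
  also have "\<dots> = col W i \<bullet> (S *\<^sub>v col W j)"
    using ij W by (simp only: row_transpose col_mult2[OF S W ij(2)] carrier_matD)
  also have "\<dots> = (\<Sum>k<n. \<Sum>l<n. col W i $ k * S $$ (k, l) * col W j $ l)"
    using W by (intro quadratic_form_sum[OF S]) auto
  finally show ?thesis using ij W by simp
qed

text \<open>
  The columns of \<open>H\<close> and of \<open>C W\<close> form a basis, whose two parts are orthogonal for the inner
  product given by the inverse of \<open>C\<close>.
\<close>
definition frame :: "real mat \<Rightarrow> real mat" where
  "frame C = hcat H (C * W)"

lemma frame_carrier: "C \<in> carrier_mat n n \<Longrightarrow> frame C \<in> carrier_mat n n"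
  using hcat_carrier[OF H, of "C * W" m] W by (simp add: frame_def n_eq)

text \<open>
  With \<open>B = [H | W]\<close>, the matrix \<open>B\<^sup>T * frame C\<close> is block triangular and \<open>B\<^sup>T B\<close> is block diagonal;
  eliminating \<open>det B\<close> from the two determinants leaves this identity, which avoids divisions.
\<close>
lemma det_frame:
  assumes C: "pos_def_mat n C"
  shows "(det (frame C))\<^sup>2 * det (transpose_mat W * W) = det (transpose_mat H * H) * (det (contrast_cov C))\<^sup>2"
proof -
  note Cc = pos_def_carrier[OF C]
  define B where "B = hcat H W"
  have B: "B \<in> carrier_mat n n" using hcat_carrier[OF H W] by (simp add: B_def n_eq)
  have CW: "C * W \<in> carrier_mat n m" using Cc W by simp
  have "transpose_mat B * frame C = four_block_mat (transpose_mat H * H) (transpose_mat H * (C * W))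
      (0\<^sub>m m p) (contrast_cov C)"
    unfolding B_def frame_def using Cc W H by (simp add: transpose_hcat_mult_hcat[OF H W H CW] WH)
  then have "det (transpose_mat B * frame C) = det (transpose_mat H * H) * det (contrast_cov C)"
    using Cc H W CW by (simp add: det_four_block_mat_lower_left_zero[of _ p _ m])
  then have 1: "det B * det (frame C) = det (transpose_mat H * H) * det (contrast_cov C)"
    using B frame_carrier[OF Cc] by (simp add: det_mult[of _ n] det_transpose[of _ n])
  have "transpose_mat B * B = four_block_mat (transpose_mat H * H) (0\<^sub>m p m) (0\<^sub>m m p) (transpose_mat W * W)"
    unfolding B_def by (simp add: transpose_hcat_mult_hcat[OF H W H W] WH HW)
  then have "det (transpose_mat B * B) = det (transpose_mat H * H) * det (transpose_mat W * W)"
    using H W by (simp add: det_four_block_mat_lower_left_zero[of _ p _ m])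
  then have 2: "(det B)\<^sup>2 = det (transpose_mat H * H) * det (transpose_mat W * W)"
    using B by (simp add: det_mult[of _ n] det_transpose[of _ n] power2_eq_square)
  have pos: "0 < det (transpose_mat H * H)" using pos_def_gram pos_def_det_pos by blast
  have "det (transpose_mat H * H) * ((det (frame C))\<^sup>2 * det (transpose_mat W * W)) = (det B * det (frame C))\<^sup>2"
    by (simp add: power_mult_distrib 2)
  also have "\<dots> = det (transpose_mat H * H) * (det (transpose_mat H * H) * (det (contrast_cov C))\<^sup>2)"
    by (simp add: 1 power2_eq_square)
  finally show ?thesis using pos by simp
qed

lemma det_frame_nonzero: "pos_def_mat n C \<Longrightarrow> det (frame C) \<noteq> 0"
  using det_frame[of C] pos_def_det_pos[OF pos_def_gram(1)] pos_def_det_pos[OF pos_def_contrast_cov, of C] by auto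

text \<open>
  In the basis \<open>frame C\<close> the inner product given by the inverse of \<open>C\<close> is block diagonal, with
  blocks \<open>mean_precision C\<close> and \<open>contrast_cov C\<close>. Comparing determinants and inserting
  \<open>det_frame\<close> gives a factor in front of \<open>det (contrast_cov C)\<close> that depends on the design only.
\<close>
lemma det_mean_precision:
  assumes C: "pos_def_mat n C"
  shows "det (mean_precision C) * det C = det (transpose_mat H * H) / det (transpose_mat W * W) * det (contrast_cov C)"
proof -
  note Cc = pos_def_carrier[OF C] and Cd = pos_def_det_pos[OF C]
  have Cd': "det C \<noteq> 0" using Cd by simp
  note mc = minv_carrier[OF Cc Cd'] and F = frame_carrier[OF Cc]
  have CW: "C * W \<in> carrier_mat n m" using Cc W by simp
  have mF: "minv C * frame C = hcat (minv C * H) W"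
    using mult_hcat[OF mc H CW] assoc_mult_mat[OF mc Cc W] minv_left[OF Cc Cd'] W by (simp add: frame_def)
  have "transpose_mat (frame C) * (minv C * frame C) = four_block_mat (transpose_mat H * (minv C * H))
      (0\<^sub>m p m) (transpose_mat (C * W) * (minv C * H)) (transpose_mat (C * W) * W)"
    unfolding mF unfolding frame_def using mc H by (subst transpose_hcat_mult_hcat[OF H CW _ W]) (auto simp: HW)
  also have "transpose_mat (C * W) = transpose_mat W * C"
    using Cc W pos_def_sym[OF C] by (simp add: transpose_mult[of _ n n])
  finally have "det (transpose_mat (frame C) * (minv C * frame C)) = det (mean_precision C) * det (contrast_cov C)"
    using Cc H W CW mc
    by (simp only:, subst det_four_block_mat_upper_right_zero[of _ p _ m]) (auto intro!: carrier_matI)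
  then have 1: "(det (frame C))\<^sup>2 * det (minv C) = det (mean_precision C) * det (contrast_cov C)"
    using F mc by (simp add: det_mult[of _ n] det_transpose[of _ n] power2_eq_square mult_carrier_mat[of _ n n] mult_ac)
  have 2: "det C * det (minv C) = 1"
    using minv_right[OF Cc Cd'] det_mult[OF Cc mc] by simp
  have G: "0 < det (contrast_cov C)" "0 < det (transpose_mat W * W)"
    using pos_def_det_pos pos_def_contrast_cov[OF C] pos_def_gram by blast+
  have "det (mean_precision C) * det C * det (transpose_mat W * W) * det (contrast_cov C) =
      ((det (frame C))\<^sup>2 * det (transpose_mat W * W)) * (det C * det (minv C))"
    using 1 by (simp add: mult_ac)
  also have "\<dots> = (det (transpose_mat H * H) * det (contrast_cov C)) * det (contrast_cov C)"
    using 2 det_frame[OF C] by (simp add: power2_eq_square)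
  finally have "det (mean_precision C) * det C * det (transpose_mat W * W) = det (transpose_mat H * H) * det (contrast_cov C)"
    using G by simp
  then show ?thesis using G by (simp add: field_simps)
qed

text \<open>
  Pythagoras in the basis \<open>frame C\<close>: if \<open>y = H a + C W c\<close>, then the residual \<open>y - H b\<close> is the sum of
  the orthogonal vectors \<open>H (a - b)\<close> and \<open>C W c\<close>, and \<open>c\<close> is determined by \<open>W\<^sup>T y = G c\<close> with
  \<open>G = contrast_cov C\<close>. The vector \<open>a\<close> is the generalised least squares estimate of the mean
  parameter.
\<close>
lemma residual_decomposition:
  assumes C: "pos_def_mat n C" and y: "y \<in> carrier_vec n"
  obtains a where "a \<in> carrier_vec p"
    "\<And>b. b \<in> carrier_vec p \<Longrightarrow> (y - H *\<^sub>v b) \<bullet> (minv C *\<^sub>v (y - H *\<^sub>v b)) =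
      (b - a) \<bullet> (mean_precision C *\<^sub>v (b - a)) +
      (transpose_mat W *\<^sub>v y) \<bullet> (minv (contrast_cov C) *\<^sub>v (transpose_mat W *\<^sub>v y))"
proof -
  note Cc = pos_def_carrier[OF C] and Cd = pos_def_det_nonzero[OF C]
  note mc = minv_carrier[OF Cc Cd] and F = frame_carrier[OF Cc] and Fd = det_frame_nonzero[OF C]
  define G where "G = contrast_cov C"
  have pG: "pos_def_mat m G" unfolding G_def by (rule pos_def_contrast_cov[OF C])
  note Gc = pos_def_carrier[OF pG] and Gd = pos_def_det_nonzero[OF pG]
  note mG = minv_carrier[OF Gc Gd]
  have CW: "C * W \<in> carrier_mat n m" using Cc W by simp
  define x where "x = minv (frame C) *\<^sub>v y"
  have x: "x \<in> carrier_vec (p + m)" using minv_carrier[OF F Fd] y by (simp add: x_def n_eq)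
  have "y = (frame C * minv (frame C)) *\<^sub>v y" using minv_right[OF F Fd] y by simp
  also have "\<dots> = frame C *\<^sub>v x"
    unfolding x_def by (rule assoc_mult_mat_vec[OF F minv_carrier[OF F Fd] y])
  finally have yx: "y = H *\<^sub>v vec_first x p + C * W *\<^sub>v vec_last x m"
    using hcat_mult_vec[OF H CW x] by (simp add: frame_def)
  define a where "a = vec_first x p"
  define c where "c = vec_last x m"
  have a: "a \<in> carrier_vec p" and c: "c \<in> carrier_vec m" by (simp_all add: a_def c_def)
  define w where "w = W *\<^sub>v c"
  have w: "w \<in> carrier_vec n" using W c by (simp add: w_def)
  have y_eq: "y = H *\<^sub>v a + C *\<^sub>v w" using yx Cc W c by (simp add: a_def c_def w_def)
  have "transpose_mat W *\<^sub>v (H *\<^sub>v a) = 0\<^sub>v m"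
    using assoc_mult_mat_vec[of "transpose_mat W" m n H p a] H W a by (simp add: WH zero_mat_mult_vec)
  moreover have Gc': "transpose_mat W *\<^sub>v (C *\<^sub>v w) = G *\<^sub>v c"
  proof -
    have "G = transpose_mat W * (C * W)" unfolding G_def using Cc W by simp
    then have "G *\<^sub>v c = transpose_mat W *\<^sub>v (C * W *\<^sub>v c)"
      using assoc_mult_mat_vec[OF _ CW c, of "transpose_mat W" m] W by simp
    also have "C * W *\<^sub>v c = C *\<^sub>v w"
      unfolding w_def by (rule assoc_mult_mat_vec[OF Cc W c])
    finally show ?thesis ..
  qed
  ultimately have z: "transpose_mat W *\<^sub>v y = G *\<^sub>v c"
    using W H Cc Gc a w c by (simp add: y_eq mult_add_distrib_mat_vec[of _ m n])
  have "minv G *\<^sub>v (G *\<^sub>v c) = c"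
    using assoc_mult_mat_vec[OF mG Gc c] minv_left[OF Gc Gd] c by simp
  then have zz: "(transpose_mat W *\<^sub>v y) \<bullet> (minv G *\<^sub>v (transpose_mat W *\<^sub>v y)) = (G *\<^sub>v c) \<bullet> c"
    by (simp add: z)
  have "(y - H *\<^sub>v b) \<bullet> (minv C *\<^sub>v (y - H *\<^sub>v b)) =
      (b - a) \<bullet> (mean_precision C *\<^sub>v (b - a)) + (G *\<^sub>v c) \<bullet> c" if b: "b \<in> carrier_vec p" for b
  proof -
    define u where "u = b - a"
    have u: "u \<in> carrier_vec p" using a b by (simp add: u_def)
    define h where "h = H *\<^sub>v u"
    have h: "h \<in> carrier_vec n" using H u by (simp add: h_def)
    have h': "minv C *\<^sub>v h \<in> carrier_vec n" "C *\<^sub>v w \<in> carrier_vec n" using mc h Cc w by simp_all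
    have "H *\<^sub>v u = H *\<^sub>v b - H *\<^sub>v a"
      unfolding u_def using H a b by (intro mult_minus_distrib_mat_vec) auto
    then have e: "y - H *\<^sub>v b = C *\<^sub>v w - h"
      using H a b w Cc by (intro eq_vecI) (auto simp: y_eq h_def)
    have "minv C *\<^sub>v (C *\<^sub>v w) = w"
      using assoc_mult_mat_vec[OF mc Cc w] minv_left[OF Cc Cd] w by simp
    then have me: "minv C *\<^sub>v (C *\<^sub>v w - h) = w - minv C *\<^sub>v h"
      using mult_minus_distrib_mat_vec[OF mc _ h, of "C *\<^sub>v w"] Cc w by simp
    have hw: "h \<bullet> w = 0"
    proof -
      have "h \<bullet> w = (transpose_mat W *\<^sub>v h) \<bullet> c"
        unfolding w_def using W h c by (intro scalar_prod_mult_mat_vec) auto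
      also have "transpose_mat W *\<^sub>v h = 0\<^sub>v m"
        unfolding h_def using assoc_mult_mat_vec[of "transpose_mat W" m n H p u] H W u by (simp add: WH zero_mat_mult_vec)
      finally show ?thesis using c by simp
    qed
    have "C *\<^sub>v (minv C *\<^sub>v h) = h"
      using assoc_mult_mat_vec[OF Cc mc h] minv_right[OF Cc Cd] h by simp
    then have wh: "(C *\<^sub>v w) \<bullet> (minv C *\<^sub>v h) = 0"
      using scalar_prod_mult_mat_vec[OF Cc w h'(1)] pos_def_sym[OF C] comm_scalar_prod[OF w h] hw by simp
    have ww: "(C *\<^sub>v w) \<bullet> w = (G *\<^sub>v c) \<bullet> c"
      using scalar_prod_mult_mat_vec[OF W h'(2) c] Gc' by (simp add: w_def)
    have hh: "h \<bullet> (minv C *\<^sub>v h) = u \<bullet> (mean_precision C *\<^sub>v u)"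
      unfolding h_def by (rule quadratic_form_congruence[OF mc H u, symmetric])
    show ?thesis
      unfolding e me u_def[symmetric] hh[symmetric] ww[symmetric]
      using w h h' hw wh
      by (simp add: scalar_prod_minus_distrib[of _ n] minus_scalar_prod_distrib[of _ n])
  qed
  then show ?thesis using that[OF a] unfolding G_def[symmetric] zz by blast
qed

text \<open>
  Up to the factor \<open>C\<close> on one side, this is the projection onto the second part of \<open>frame C\<close> along
  the first. As a form it is \<open>q = z\<^sup>T G\<^sup>-\<^sup>1 z\<close> in the contrast \<open>z = W\<^sup>T y\<close>.
\<close>
definition contrast_projection :: "real mat \<Rightarrow> real mat" where
  "contrast_projection C = W * minv (contrast_cov C) * transpose_mat W"

text \<open>
  The precision matrix of the Gaussian distribution with covariance \<open>C\<close> after its density has been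
  multiplied by \<open>exp (- t * q)\<close>.
\<close>
definition tilted_precision :: "real mat \<Rightarrow> real \<Rightarrow> real mat" where
  "tilted_precision C t = minv C + (2 * t) \<cdot>\<^sub>m contrast_projection C"

lemma quadratic_form_W:
  assumes N: "N \<in> carrier_mat m m" and y: "y \<in> carrier_vec n"
  shows "y \<bullet> ((W * N * transpose_mat W) *\<^sub>v y) = (transpose_mat W *\<^sub>v y) \<bullet> (N *\<^sub>v (transpose_mat W *\<^sub>v y))"
  using quadratic_form_congruence[of N m "transpose_mat W" n y] N W y by simp

context
  fixes C :: "real mat" and t :: real
  assumes C: "pos_def_mat n C" and t: "0 \<le> t"
begin

private lemma tilt_carriers: "C \<in> carrier_mat n n" "minv C \<in> carrier_mat n n" "contrast_cov C \<in> carrier_mat m m"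
  "minv (contrast_cov C) \<in> carrier_mat m m" "contrast_projection C \<in> carrier_mat n n"
  "tilted_precision C t \<in> carrier_mat n n"
proof -
  show 1: "C \<in> carrier_mat n n" "minv C \<in> carrier_mat n n"
    using C pos_def_carrier pos_def_det_nonzero minv_carrier by blast+
  show 2: "contrast_cov C \<in> carrier_mat m m" "minv (contrast_cov C) \<in> carrier_mat m m"
    using pos_def_contrast_cov[OF C] pos_def_carrier pos_def_det_nonzero minv_carrier by blast+
  show 3: "contrast_projection C \<in> carrier_mat n n" using W 2 by (simp add: contrast_projection_def)
  show "tilted_precision C t \<in> carrier_mat n n" using 1 3 by (simp add: tilted_precision_def)
qed

lemma quadratic_form_tilted_precision:
  assumes "y \<in> carrier_vec n"
  shows "y \<bullet> (tilted_precision C t *\<^sub>v y) = y \<bullet> (minv C *\<^sub>v y) +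
    2 * t * ((transpose_mat W *\<^sub>v y) \<bullet> (minv (contrast_cov C) *\<^sub>v (transpose_mat W *\<^sub>v y)))"
  using assms tilt_carriers quadratic_form_W[OF tilt_carriers(4) assms]
  by (simp add: tilted_precision_def add_mult_distrib_mat_vec[of _ n n] scalar_prod_add_distrib[of _ n]
      smult_mat_mult_vec contrast_projection_def)

lemma pos_def_tilted_precision: "pos_def_mat n (tilted_precision C t)"
proof -
  have "transpose_mat (contrast_projection C) = contrast_projection C"
    using W tilt_carriers pos_def_sym[OF pos_def_minv[OF pos_def_contrast_cov[OF C]]]
    by (simp add: contrast_projection_def transpose_mult[of _ n m _ n] transpose_mult[of _ m m _ n])
  then have "transpose_mat (tilted_precision C t) = tilted_precision C t"
    using tilt_carriers pos_def_sym[OF pos_def_minv[OF C]] by (simp add: tilted_precision_def transpose_add transpose_smult)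
  moreover have "0 < y \<bullet> (tilted_precision C t *\<^sub>v y)" if y: "y \<in> carrier_vec n" "y \<noteq> 0\<^sub>v n" for y
  proof -
    have "0 \<le> (transpose_mat W *\<^sub>v y) \<bullet> (minv (contrast_cov C) *\<^sub>v (transpose_mat W *\<^sub>v y))"
      using W y by (intro pos_def_nonneg[OF pos_def_minv[OF pos_def_contrast_cov[OF C]]]) simp
    then show ?thesis using pos_def_pos[OF pos_def_minv[OF C] y] t
      by (simp add: quadratic_form_tilted_precision[OF y(1)] add_pos_nonneg)
  qed
  ultimately show ?thesis using tilt_carriers by (simp add: pos_def_mat_def)
qed

text \<open>
  The inverse of \<open>C\<close> maps \<open>C W\<close> to \<open>W\<close>, so tilting multiplies the image of the second part of
  \<open>frame C\<close> by \<open>1 + 2 * t\<close>; the image of the first part does not change. The determinant of the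
  tilted precision and the tilted covariance of the contrast both follow from this.
\<close>
lemma tilted_precision_mult_CW: "tilted_precision C t * (C * W) = (1 + 2 * t) \<cdot>\<^sub>m W"
proof -
  have CW: "C * W \<in> carrier_mat n m" using tilt_carriers W by simp
  have 1: "minv C * (C * W) = W"
    using assoc_mult_mat[OF tilt_carriers(2) tilt_carriers(1) W] minv_left[OF tilt_carriers(1) pos_def_det_nonzero[OF C]] W by simp
  have "contrast_projection C * (C * W) = W * (minv (contrast_cov C) * contrast_cov C)"
    using W tilt_carriers CW by (simp add: contrast_projection_def assoc_mult_mat[of _ n m _ n _ m] assoc_mult_mat[of _ n m _ m _ m]
        assoc_mult_mat[of _ m m _ n _ m])
  also have "\<dots> = W"
    using minv_left[OF tilt_carriers(3) pos_def_det_nonzero[OF pos_def_contrast_cov[OF C]]] W by simp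
  finally have 2: "contrast_projection C * (C * W) = W" .
  show ?thesis
  proof -
    have "tilted_precision C t * (C * W) = W + (2 * t) \<cdot>\<^sub>m W"
      using tilt_carriers CW by (simp only: tilted_precision_def add_mult_distrib_mat[of _ n n _ _ m] 1 2
          mult_smult_assoc_mat[of _ n n _ m] smult_carrier_mat)
    also have "\<dots> = (1 + 2 * t) \<cdot>\<^sub>m W" by (intro eq_matI) (auto simp: algebra_simps)
    finally show ?thesis .
  qed
qed

lemma det_tilted_precision: "det (tilted_precision C t) = (1 + 2 * t) ^ m / det C"
proof -
  define F where "F = frame C"
  have F: "F \<in> carrier_mat n n" "det F \<noteq> 0" using frame_carrier tilt_carriers det_frame_nonzero[OF C] by (simp_all add: F_def)
  have CW: "C * W \<in> carrier_mat n m" using tilt_carriers W by simp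
  have 1: "minv C * (C * W) = W"
    using assoc_mult_mat[OF tilt_carriers(2) tilt_carriers(1) W] minv_left[OF tilt_carriers(1) pos_def_det_nonzero[OF C]] W by simp
  have "contrast_projection C * H = W * minv (contrast_cov C) * (transpose_mat W * H)"
    unfolding contrast_projection_def using W H tilt_carriers by (intro assoc_mult_mat[of _ n m _ n _ p]) auto
  also have "\<dots> = 0\<^sub>m n p" using W tilt_carriers by (simp add: WH)
  finally have 2: "tilted_precision C t * H = minv C * H"
    using tilt_carriers H by (simp add: tilted_precision_def add_mult_distrib_mat[of _ n n] mult_smult_assoc_mat[of _ n n _ p])
  define E where "E = four_block_mat (1\<^sub>m p) (0\<^sub>m p m) (0\<^sub>m m p) ((1 + 2 * t) \<cdot>\<^sub>m 1\<^sub>m m)"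
  have E: "E \<in> carrier_mat n n" unfolding E_def using n_eq
    by (metis four_block_carrier_mat one_carrier_mat smult_carrier_mat)
  have detE: "det E = (1 + 2 * t) ^ m"
    unfolding E_def by (subst det_four_block_mat_lower_left_zero[of _ p _ m]) simp_all
  have "hcat (minv C * H) W * E = hcat (minv C * H) ((1 + 2 * t) \<cdot>\<^sub>m W)"
    unfolding E_def hcat_def using tilt_carriers H W
    by (subst mult_four_block_mat[of _ n p _ m _ 0 _ _ p _ m]) (auto intro!: cong_four_block_mat simp: mult_smult_distrib[of _ n m])
  moreover have "tilted_precision C t * F = hcat (minv C * H) ((1 + 2 * t) \<cdot>\<^sub>m W)"
    unfolding F_def frame_def by (simp add: mult_hcat[OF tilt_carriers(6) H CW] tilted_precision_mult_CW 2)
  moreover have "minv C * F = hcat (minv C * H) W"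
    unfolding F_def frame_def by (simp add: mult_hcat[OF tilt_carriers(2) H CW] 1)
  ultimately have "tilted_precision C t * F = (minv C * F) * E" by simp
  then have "det (tilted_precision C t) * det F = det (minv C) * det F * det E"
    using tilt_carriers F E by (metis det_mult mult_carrier_mat)
  then have "det (tilted_precision C t) = det (minv C) * (1 + 2 * t) ^ m" using F detE by simp
  moreover have "det C * det (minv C) = 1"
    using minv_right[OF tilt_carriers(1) pos_def_det_nonzero[OF C]] det_mult[OF tilt_carriers(1,2)] by simp
  ultimately show ?thesis using pos_def_det_nonzero[OF C] by (simp add: field_simps)
qed

lemma contrast_cov_tilted: "contrast_cov (minv (tilted_precision C t)) = (1 / (1 + 2 * t)) \<cdot>\<^sub>m contrast_cov C"
proof -
  define K where "K = tilted_precision C t"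
  have K: "K \<in> carrier_mat n n" "minv K \<in> carrier_mat n n" "minv K * K = 1\<^sub>m n"
    unfolding K_def using tilt_carriers minv_inverse[OF tilt_carriers(6) pos_def_det_nonzero[OF pos_def_tilted_precision]] by auto
  have CW: "C * W \<in> carrier_mat n m" using tilt_carriers W by simp
  have "C * W = minv K * (K * (C * W))"
    using assoc_mult_mat[OF K(2,1) CW] left_mult_one_mat[OF CW] K(3) by simp
  also have "\<dots> = (1 + 2 * t) \<cdot>\<^sub>m (minv K * W)"
    using K W by (simp add: K_def tilted_precision_mult_CW mult_smult_distrib[of _ n n])
  finally have "(1 / (1 + 2 * t)) \<cdot>\<^sub>m (C * W) = (1 / (1 + 2 * t)) \<cdot>\<^sub>m ((1 + 2 * t) \<cdot>\<^sub>m (minv K * W))"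
    by simp
  also have "\<dots> = minv K * W" using t by (intro eq_matI) auto
  finally have "minv K * W = (1 / (1 + 2 * t)) \<cdot>\<^sub>m (C * W)" ..
  then show ?thesis
    using K W tilt_carriers mult_smult_distrib[OF _ CW, of "transpose_mat W" m "1 / (1 + 2 * t)"]
    by (simp add: K_def[symmetric] assoc_mult_mat[of _ m n _ n _ m])
qed

end

section \<open>Moments of ratios of contrast forms\<close>

text \<open>
  Quadratic forms in the contrast \<open>z = W\<^sup>T y\<close>, as functions of the observation.
\<close>
definition contrast_form :: "real mat \<Rightarrow> real vec \<Rightarrow> real" where
  "contrast_form N y = (transpose_mat W *\<^sub>v y) \<bullet> (N *\<^sub>v (transpose_mat W *\<^sub>v y))"

lemma contrast_form_eq:
  "N \<in> carrier_mat m m \<Longrightarrow> y \<in> carrier_vec n \<Longrightarrow> contrast_form N y = y \<bullet> ((W * N * transpose_mat W) *\<^sub>v y)"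
  by (simp only: contrast_form_def quadratic_form_W)

lemma contrast_form_measurable:
  assumes N: "N \<in> carrier_mat m m"
  shows "(\<lambda>y. contrast_form N (vec n y)) \<in> borel_measurable (lebesgue_Rn n)"
proof -
  have "W * N * transpose_mat W \<in> carrier_mat n n"
    using W N by (simp add: mult_carrier_mat[of _ n m _ m] mult_carrier_mat[of _ n m _ n])
  from borel_measurable_quadratic_form[OF this, of "0\<^sub>v n" "0\<^sub>v n" "\<lambda>y. y" "lebesgue_Rn n" "\<lambda>y. y"]
  show ?thesis using N by (simp add: contrast_form_eq measurable_lebesgue_Rn_component)
qed

text \<open>
  A mean vector that the contrasts annihilate, such as any \<open>H \<beta>\<close>, may be subtracted freely.
\<close>
lemma contrast_form_shift:
  assumes \<mu>: "\<mu> \<in> carrier_vec n" "transpose_mat W *\<^sub>v \<mu> = 0\<^sub>v m" and y: "y \<in> carrier_vec n"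
  shows "contrast_form N y = contrast_form N (y - \<mu>)"
proof -
  have "transpose_mat W *\<^sub>v (y - \<mu>) = transpose_mat W *\<^sub>v y - 0\<^sub>v m"
    using mult_minus_distrib_mat_vec[of "transpose_mat W" m n y \<mu>] W \<mu> y by simp
  then show ?thesis using W y by (simp add: contrast_form_def)
qed

lemma minv_contrast_cov_carrier: "pos_def_mat n C \<Longrightarrow> minv (contrast_cov C) \<in> carrier_mat m m"
  using minv_carrier pos_def_carrier pos_def_det_nonzero pos_def_contrast_cov by blast

lemma contrast_form_pos_iff:
  assumes C: "pos_def_mat n C" and "y \<in> carrier_vec n"
  shows "0 < contrast_form (minv (contrast_cov C)) y \<longleftrightarrow> transpose_mat W *\<^sub>v y \<noteq> 0\<^sub>v m"
    and "0 \<le> contrast_form (minv (contrast_cov C)) y"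
  using pos_def_pos[OF pos_def_minv[OF pos_def_contrast_cov[OF C]], of "transpose_mat W *\<^sub>v y"]
    pos_def_nonneg[OF pos_def_minv[OF pos_def_contrast_cov[OF C]], of "transpose_mat W *\<^sub>v y"] assms(2) W
    minv_contrast_cov_carrier[OF C]
  by (auto simp: contrast_form_def mult_mat_zero_vec[of _ m m])

text \<open>
  The random part of the score: for \<open>D = G'\<close> the numerator is minus the derivative of the
  denominator \<open>z\<^sup>T G\<^sup>-\<^sup>1 z\<close>. Where \<open>z = 0\<close>, the quotient has the value \<open>0\<close>.
\<close>
definition contrast_ratio :: "real mat \<Rightarrow> real mat \<Rightarrow> real vec \<Rightarrow> real" where
  "contrast_ratio C D y = contrast_form (minv (contrast_cov C) * D * minv (contrast_cov C)) y /
     contrast_form (minv (contrast_cov C)) y"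

lemma contrast_ratio_measurable:
  assumes C: "pos_def_mat n C" and D: "D \<in> carrier_mat m m"
  shows "(\<lambda>y. contrast_ratio C D (vec n y)) \<in> borel_measurable (lebesgue_Rn n)"
proof -
  note Gi = minv_contrast_cov_carrier[OF C]
  note contrast_form_measurable[OF mult_carrier_mat[OF mult_carrier_mat[OF Gi D] Gi], measurable]
    contrast_form_measurable[OF Gi, measurable]
  show ?thesis unfolding contrast_ratio_def by measurable
qed

context
  fixes C :: "real mat" and \<mu> :: "real vec"
  assumes C: "pos_def_mat n C" and \<mu>: "\<mu> \<in> carrier_vec n" "transpose_mat W *\<^sub>v \<mu> = 0\<^sub>v m"
begin

private abbreviation "G \<equiv> contrast_cov C"
private abbreviation "Gi \<equiv> minv (contrast_cov C)"

private lemma mvn_carriers: "C \<in> carrier_mat n n" "minv C \<in> carrier_mat n n" "G \<in> carrier_mat m m" "Gi \<in> carrier_mat m m"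
  "Gi * G = 1\<^sub>m m" "G * Gi = 1\<^sub>m m"
  using C pos_def_carrier pos_def_det_nonzero minv_inverse pos_def_contrast_cov[OF C] by blast+

lemma measurable_mvn_density: "(\<lambda>y. ennreal (mvn_density n \<mu> C (vec n y))) \<in> borel_measurable (lebesgue_Rn n)"
proof -
  have [measurable]: "(\<lambda>y. (vec n y - \<mu>) \<bullet> (minv C *\<^sub>v (vec n y - \<mu>))) \<in> borel_measurable (lebesgue_Rn n)"
    using \<mu> mvn_carriers by (intro borel_measurable_quadratic_form) (auto intro: measurable_lebesgue_Rn_component)
  show ?thesis unfolding mvn_density_def by measurable
qed

lemma sets_mvn [measurable_cong]: "sets (mvn n \<mu> C) = sets (lebesgue_Rn n)"
  by (simp add: mvn_def)

text \<open>
  The factor \<open>exp (- t * q)\<close> is absorbed into the Gaussian exponent. The test function takes the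
  centred observation, to which the formulas for Gaussian integrals apply.
\<close>
lemma nn_integral_mvn_tilted:
  assumes t: "0 \<le> t" and h: "(\<lambda>y. h (vec n y - \<mu>)) \<in> borel_measurable (lebesgue_Rn n)"
  shows "(\<integral>\<^sup>+y. h (vec n y - \<mu>) * ennreal (exp (- t * contrast_form Gi (vec n y))) \<partial>mvn n \<mu> C) =
    ennreal (1 / sqrt ((2 * pi) ^ n * det C)) *
    (\<integral>\<^sup>+y. h (vec n y - \<mu>) * ennreal (exp (- ((vec n y - \<mu>) \<bullet> (tilted_precision C t *\<^sub>v (vec n y - \<mu>))) / 2)) \<partial>lebesgue_Rn n)"
proof -
  have [measurable]: "(\<lambda>y. contrast_form Gi (vec n y)) \<in> borel_measurable (lebesgue_Rn n)"
    by (rule contrast_form_measurable[OF mvn_carriers(4)])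
  have [measurable]: "(\<lambda>y. (vec n y - \<mu>) \<bullet> (tilted_precision C t *\<^sub>v (vec n y - \<mu>))) \<in> borel_measurable (lebesgue_Rn n)"
    using \<mu> pos_def_carrier[OF pos_def_tilted_precision[OF C t]] by (intro borel_measurable_quadratic_form) (auto intro: measurable_lebesgue_Rn_component)
  note h[measurable]
  have q: "(vec n y - \<mu>) \<bullet> (tilted_precision C t *\<^sub>v (vec n y - \<mu>)) =
    (vec n y - \<mu>) \<bullet> (minv C *\<^sub>v (vec n y - \<mu>)) + 2 * t * contrast_form Gi (vec n y)" for y
    using quadratic_form_tilted_precision[OF C t, of "vec n y - \<mu>"] contrast_form_shift[OF \<mu>, of "vec n y" Gi] \<mu>
    by (simp add: contrast_form_def)
  have e: "mvn_density n \<mu> C (vec n y) * exp (- t * contrast_form Gi (vec n y)) =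
      1 / sqrt ((2 * pi) ^ n * det C) * exp (- ((vec n y - \<mu>) \<bullet> (tilted_precision C t *\<^sub>v (vec n y - \<mu>))) / 2)" for y
    unfolding q mvn_density_def by (simp add: diff_divide_distrib algebra_simps flip: exp_add)
  have d: "0 \<le> 1 / sqrt ((2 * pi) ^ n * det C)" using pos_def_det_pos[OF C] by simp
  have "(\<integral>\<^sup>+y. h (vec n y - \<mu>) * ennreal (exp (- t * contrast_form Gi (vec n y))) \<partial>mvn n \<mu> C) =
    (\<integral>\<^sup>+y. ennreal (mvn_density n \<mu> C (vec n y)) * (h (vec n y - \<mu>) * ennreal (exp (- t * contrast_form Gi (vec n y)))) \<partial>lebesgue_Rn n)"
    unfolding mvn_def by (intro nn_integral_density measurable_mvn_density) measurable
  also have "\<dots> = (\<integral>\<^sup>+y. ennreal (1 / sqrt ((2 * pi) ^ n * det C)) *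
      (h (vec n y - \<mu>) * ennreal (exp (- ((vec n y - \<mu>) \<bullet> (tilted_precision C t *\<^sub>v (vec n y - \<mu>))) / 2))) \<partial>lebesgue_Rn n)"
  proof (rule nn_integral_cong)
    fix y
    have "ennreal (mvn_density n \<mu> C (vec n y)) * ennreal (exp (- t * contrast_form Gi (vec n y))) =
      ennreal (1 / sqrt ((2 * pi) ^ n * det C)) * ennreal (exp (- ((vec n y - \<mu>) \<bullet> (tilted_precision C t *\<^sub>v (vec n y - \<mu>))) / 2))"
      by (simp only: ennreal_mult''[symmetric] exp_ge_zero e)
    then show "ennreal (mvn_density n \<mu> C (vec n y)) * (h (vec n y - \<mu>) * ennreal (exp (- t * contrast_form Gi (vec n y)))) =
      ennreal (1 / sqrt ((2 * pi) ^ n * det C)) *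
      (h (vec n y - \<mu>) * ennreal (exp (- ((vec n y - \<mu>) \<bullet> (tilted_precision C t *\<^sub>v (vec n y - \<mu>))) / 2)))"
      by (simp only: mult.left_commute[of _ "h (vec n y - \<mu>)"])
  qed
  also have "\<dots> = ennreal (1 / sqrt ((2 * pi) ^ n * det C)) *
    (\<integral>\<^sup>+y. h (vec n y - \<mu>) * ennreal (exp (- ((vec n y - \<mu>) \<bullet> (tilted_precision C t *\<^sub>v (vec n y - \<mu>))) / 2)) \<partial>lebesgue_Rn n)"
    by (intro nn_integral_cmult) measurable
  finally show ?thesis .
qed

lemma tilted_normalisation:
  assumes t: "0 \<le> t"
  shows "ennreal (1 / sqrt ((2 * pi) ^ n * det C)) * ennreal (sqrt ((2 * pi) ^ n / det (tilted_precision C t)) * x) =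
    ennreal (x / sqrt ((1 + 2 * t) ^ m))"
proof -
  have d: "0 < det C" by (rule pos_def_det_pos[OF C])
  have "1 / sqrt ((2 * pi) ^ n * det C) * sqrt ((2 * pi) ^ n / det (tilted_precision C t)) = 1 / sqrt ((1 + 2 * t) ^ m)"
    using d t by (simp add: det_tilted_precision[OF C t] real_sqrt_mult real_sqrt_divide)
  then have "1 / sqrt ((2 * pi) ^ n * det C) * (sqrt ((2 * pi) ^ n / det (tilted_precision C t)) * x) = x / sqrt ((1 + 2 * t) ^ m)"
    by (simp flip: mult.assoc)
  moreover have "ennreal (1 / sqrt ((2 * pi) ^ n * det C)) * ennreal (sqrt ((2 * pi) ^ n / det (tilted_precision C t)) * x) =
    ennreal (1 / sqrt ((2 * pi) ^ n * det C) * (sqrt ((2 * pi) ^ n / det (tilted_precision C t)) * x))"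
    using d by (intro ennreal_mult'[symmetric]) simp
  ultimately show ?thesis by simp
qed

text \<open>
  Says that \<open>q = z\<^sup>T G\<^sup>-\<^sup>1 z\<close> has the Laplace transform of a chi-squared variable with \<open>m\<close> degrees of
  freedom. The value at \<open>t = 0\<close> is the total mass of the distribution.
\<close>
lemma mvn_laplace_transform:
  assumes t: "0 \<le> t"
  shows "(\<integral>\<^sup>+y. ennreal (exp (- t * contrast_form Gi (vec n y))) \<partial>mvn n \<mu> C) = ennreal (1 / sqrt ((1 + 2 * t) ^ m))"
  using nn_integral_mvn_tilted[OF t, of "\<lambda>_. 1"] gaussian_mass[OF pos_def_tilted_precision[OF C t] \<mu>(1)]
    tilted_normalisation[OF t, of 1] by (simp only: mult_1 mult_1_right measurable_const) simp

lemma prob_space_mvn: "prob_space (mvn n \<mu> C)"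
  using mvn_laplace_transform[of 0] by (intro prob_spaceI) simp

text \<open>
  Under the tilted distribution the contrast has covariance \<open>G\<close> divided by \<open>1 + 2 * t\<close>, which
  contributes the factor \<open>(1 + 2 * t)\<^sup>2\<close>; the square root is the normalisation of the tilt.
\<close>
lemma mvn_tilted_second_moment:
  assumes t: "0 \<le> t" and D: "D \<in> carrier_mat m m" "transpose_mat D = D"
  shows "(\<integral>\<^sup>+y. ennreal ((contrast_form (Gi * D * Gi) (vec n y))\<^sup>2) * ennreal (exp (- t * contrast_form Gi (vec n y))) \<partial>mvn n \<mu> C) =
    ennreal (((mtrace (D * Gi))\<^sup>2 + 2 * mtrace (D * Gi * (D * Gi))) / ((1 + 2 * t)\<^sup>2 * sqrt ((1 + 2 * t) ^ m)))"
proof -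
  define N where "N = Gi * D * Gi"
  have N: "N \<in> carrier_mat m m" using mvn_carriers D by (simp add: N_def)
  define E where "E = W * N * transpose_mat W"
  have E: "E \<in> carrier_mat n n"
    unfolding E_def using W N by (simp add: mult_carrier_mat[of _ n m _ m] mult_carrier_mat[of _ n m _ n])
  have Gs: "transpose_mat Gi = Gi" by (rule pos_def_sym[OF pos_def_minv[OF pos_def_contrast_cov[OF C]]])
  have Ns: "transpose_mat N = N"
    unfolding N_def using mvn_carriers D Gs by (simp add: transpose_mult[of _ m m _ m])
  have Es: "transpose_mat E = E"
  proof -
    have "transpose_mat E = W * (transpose_mat N * transpose_mat W)"
      unfolding E_def using W N by (simp add: transpose_mult[of _ n m _ n] transpose_mult[of _ n m _ m]
        transpose_mult[of _ m m _ n] mult_carrier_mat[of _ n m _ m] mult_carrier_mat[of _ m m _ n])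
    also have "\<dots> = E" unfolding E_def Ns using W N by (intro assoc_mult_mat[symmetric]) auto
    finally show ?thesis .
  qed
  have form: "contrast_form N (vec n y) = (vec n y - \<mu>) \<bullet> (E *\<^sub>v (vec n y - \<mu>))" for y
    using contrast_form_shift[OF \<mu>, of "vec n y" N] contrast_form_eq[OF N, of "vec n y - \<mu>"] \<mu> by (simp add: E_def)
  define K where "K = tilted_precision C t"
  have K: "pos_def_mat n K" unfolding K_def by (rule pos_def_tilted_precision[OF C t])
  have Ki: "minv K \<in> carrier_mat n n" by (rule minv_carrier[OF pos_def_carrier[OF K] pos_def_det_nonzero[OF K]])
  define r where "r = 1 / (1 + 2 * t)"
  have NG: "N * (transpose_mat W * minv K * W) = r \<cdot>\<^sub>m (Gi * D)"
  proof -
    have "N * (transpose_mat W * minv K * W) = N * (r \<cdot>\<^sub>m G)"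
      by (simp only: K_def contrast_cov_tilted[OF C t] r_def)
    also have "\<dots> = r \<cdot>\<^sub>m (N * G)" by (rule mult_smult_distrib[OF N mvn_carriers(3)])
    also have "N * G = Gi * D * (Gi * G)"
      unfolding N_def using mvn_carriers D by (intro assoc_mult_mat[of _ m m _ m _ m]) auto
    also have "\<dots> = Gi * D" using mvn_carriers D by (simp add: mult_carrier_mat[of _ m m _ m])
    finally show ?thesis .
  qed
  have GiD: "Gi * D \<in> carrier_mat m m" "D * Gi \<in> carrier_mat m m" using mvn_carriers D by (simp_all add: mult_carrier_mat[of _ m m _ m])
  have tr1: "mtrace (E * minv K) = r * mtrace (D * Gi)"
    unfolding E_def mtrace_congruence(1)[OF W N Ki] NG using mtrace_smult[OF GiD(1)] mtrace_comm[OF mvn_carriers(4) D(1)] by simp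
  have tr2: "mtrace (E * minv K * (E * minv K)) = r\<^sup>2 * mtrace (D * Gi * (D * Gi))"
  proof -
    have "r \<cdot>\<^sub>m (Gi * D) * (r \<cdot>\<^sub>m (Gi * D)) = r\<^sup>2 \<cdot>\<^sub>m (Gi * D * (Gi * D))"
    proof -
      have "r \<cdot>\<^sub>m (Gi * D) * (r \<cdot>\<^sub>m (Gi * D)) = r \<cdot>\<^sub>m (r \<cdot>\<^sub>m (Gi * D * (Gi * D)))"
        using mult_smult_assoc_mat[OF GiD(1) smult_carrier_mat[OF GiD(1)]] mult_smult_distrib[OF GiD(1) GiD(1)] by simp
      also have "\<dots> = r\<^sup>2 \<cdot>\<^sub>m (Gi * D * (Gi * D))" by (intro eq_matI) (auto simp: power2_eq_square)
      finally show ?thesis .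
    qed
    moreover have "mtrace (Gi * D * (Gi * D)) = mtrace (D * Gi * (D * Gi))"
      using mtrace_comm[of Gi m m "D * Gi * D"] mvn_carriers D GiD
      by (simp add: assoc_mult_mat[of _ m m _ m _ m] mult_carrier_mat[of _ m m _ m])
    ultimately show ?thesis
      unfolding E_def mtrace_congruence(2)[OF W N Ki] NG using mtrace_smult[of "Gi * D * (Gi * D)" m] GiD
      by (simp add: mult_carrier_mat[of _ m m _ m])
  qed
  have "(\<lambda>y. ennreal (((vec n y - \<mu>) \<bullet> (E *\<^sub>v (vec n y - \<mu>)))\<^sup>2)) \<in> borel_measurable (lebesgue_Rn n)"
    using contrast_form_measurable[OF N] by (simp flip: form)
  from nn_integral_mvn_tilted[OF t, of "\<lambda>e. ennreal ((e \<bullet> (E *\<^sub>v e))\<^sup>2)", OF this]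
  have "(\<integral>\<^sup>+y. ennreal ((contrast_form N (vec n y))\<^sup>2) * ennreal (exp (- t * contrast_form Gi (vec n y))) \<partial>mvn n \<mu> C) =
    ennreal (1 / sqrt ((2 * pi) ^ n * det C)) * ennreal (sqrt ((2 * pi) ^ n / det K) *
      ((mtrace (E * minv K))\<^sup>2 + 2 * mtrace (E * minv K * (E * minv K))))"
    unfolding form gaussian_quadratic_form_square[OF K \<mu>(1) E Es, unfolded K_def] K_def by simp
  also have "\<dots> = ennreal (r\<^sup>2 * ((mtrace (D * Gi))\<^sup>2 + 2 * mtrace (D * Gi * (D * Gi))) / sqrt ((1 + 2 * t) ^ m))"
    unfolding K_def tilted_normalisation[OF t] unfolding K_def[symmetric] tr1 tr2
    by (simp add: power_mult_distrib algebra_simps)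
  also have "r\<^sup>2 * ((mtrace (D * Gi))\<^sup>2 + 2 * mtrace (D * Gi * (D * Gi))) / sqrt ((1 + 2 * t) ^ m) =
    ((mtrace (D * Gi))\<^sup>2 + 2 * mtrace (D * Gi * (D * Gi))) / ((1 + 2 * t)\<^sup>2 * sqrt ((1 + 2 * t) ^ m))"
    by (simp add: r_def power_divide)
  finally show ?thesis by (simp only: N_def)
qed

text \<open>
  The probability of \<open>q = 0\<close> is bounded by the Laplace transform of \<open>q\<close> at every \<open>t\<close>, which tends
  to \<open>0\<close> since \<open>m > 0\<close>.
\<close>
lemma AE_contrast_nonzero: "AE y in mvn n \<mu> C. transpose_mat W *\<^sub>v vec n y \<noteq> 0\<^sub>v m"
proof -
  note contrast_form_measurable[OF mvn_carriers(4), measurable]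
  let ?M = "mvn n \<mu> C"
  let ?Z = "{y \<in> space ?M. contrast_form Gi (vec n y) = 0}"
  have Z: "?Z \<in> sets ?M" by measurable
  have le: "emeasure ?M ?Z \<le> ennreal (1 / sqrt ((1 + 2 * t) ^ m))" if "0 \<le> t" for t
  proof -
    have "emeasure ?M ?Z = (\<integral>\<^sup>+y. indicator ?Z y \<partial>?M)" using Z by simp
    also have "\<dots> \<le> (\<integral>\<^sup>+y. ennreal (exp (- t * contrast_form Gi (vec n y))) \<partial>?M)"
      by (intro nn_integral_mono) (auto simp: indicator_def)
    finally show ?thesis using mvn_laplace_transform[OF that] by simp
  qed
  have "((\<lambda>t. ennreal (1 / sqrt ((1 + 2 * t) ^ m))) \<longlongrightarrow> ennreal 0) at_top"
  proof (rule tendsto_ennrealI)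
    have "((\<lambda>t. 1 / sqrt (1 + 2 * t) :: real) \<longlongrightarrow> 0) at_top" by real_asymp
    then have "((\<lambda>t. (1 / sqrt (1 + 2 * t)) ^ m :: real) \<longlongrightarrow> 0 ^ m) at_top" by (rule tendsto_power)
    then show "((\<lambda>t. 1 / sqrt ((1 + 2 * t) ^ m)) \<longlongrightarrow> 0) at_top"
      using p_less_n by (simp add: power_divide real_sqrt_power power_0_left)
  qed
  moreover have "eventually (\<lambda>t. emeasure ?M ?Z \<le> ennreal (1 / sqrt ((1 + 2 * t) ^ m))) (at_top :: real filter)"
    using eventually_ge_at_top[of 0] by eventually_elim (rule le)
  ultimately have "emeasure ?M ?Z \<le> ennreal 0" by (intro tendsto_lowerbound) auto
  then have "?Z \<in> null_sets ?M" using Z by (auto intro: null_setsI)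
  then show ?thesis
    by (rule AE_I') (auto simp: contrast_form_def mvn_carriers mult_mat_zero_vec[of _ m m])
qed

text \<open>
  Write \<open>1 / q\<^sup>2\<close> as a mixture of exponentials, exchange the integrals, and insert the tilted
  second moment.
\<close>
lemma nn_integral_contrast_ratio_square:
  assumes D: "D \<in> carrier_mat m m" "transpose_mat D = D"
  shows "(\<integral>\<^sup>+y. ennreal ((contrast_ratio C D (vec n y))\<^sup>2) \<partial>mvn n \<mu> C) =
    ennreal (((mtrace (D * Gi))\<^sup>2 + 2 * mtrace (D * Gi * (D * Gi))) / (real m * (real m + 2)))"
proof -
  let ?M = "mvn n \<mu> C"
  define N where "N = Gi * D * Gi"
  define S where "S = (mtrace (D * Gi))\<^sup>2 + 2 * mtrace (D * Gi * (D * Gi))"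
  have N: "N \<in> carrier_mat m m" unfolding N_def using mvn_carriers D by (simp add: mult_carrier_mat[of _ m m _ m])
  interpret prob_space ?M by (rule prob_space_mvn)
  interpret pair_sigma_finite ?M lborel by standard
  have [measurable]: "(\<lambda>y. contrast_form N (vec n y)) \<in> borel_measurable ?M"
    "(\<lambda>y. contrast_form Gi (vec n y)) \<in> borel_measurable ?M"
    using contrast_form_measurable[OF N] contrast_form_measurable[OF mvn_carriers(4)] by (simp_all cong: measurable_cong_sets add: mvn_def)
  define f where "f y t = ennreal ((contrast_form N (vec n y))\<^sup>2) *
    (ennreal (t * exp (- t * contrast_form Gi (vec n y))) * indicator {0..} t)" for y t
  have f_meas: "case_prod f \<in> borel_measurable (?M \<Otimes>\<^sub>M lborel)"
    unfolding f_def case_prod_unfold by measurable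
  have "ennreal ((contrast_ratio C D (vec n y))\<^sup>2) = (\<integral>\<^sup>+t. f y t \<partial>lborel)" for y
  proof (cases "transpose_mat W *\<^sub>v vec n y = 0\<^sub>v m")
    case True
    \<comment> \<open>here both forms vanish and the quotient is \<open>0\<close> by convention,
      in agreement with the integral\<close>
    then have "contrast_form N (vec n y) = 0" using N by (simp add: contrast_form_def mult_mat_zero_vec[of _ m m])
    then show ?thesis by (simp add: f_def contrast_ratio_def N_def)
  next
    case False
    then have pos: "0 < contrast_form Gi (vec n y)" using contrast_form_pos_iff(1)[OF C, of "vec n y"] by simp
    have meas: "(\<lambda>t. ennreal (t * exp (- t * q)) * indicator {0..} t) \<in> borel_measurable lborel" for q :: real
      by measurable
    have "(\<integral>\<^sup>+t. f y t \<partial>lborel) = ennreal ((contrast_form N (vec n y))\<^sup>2) * ennreal (1 / (contrast_form Gi (vec n y))\<^sup>2)"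
      unfolding f_def nn_integral_linear_exp[OF pos, symmetric] by (rule nn_integral_cmult[OF meas])
    also have "\<dots> = ennreal ((contrast_ratio C D (vec n y))\<^sup>2)"
      by (simp add: contrast_ratio_def N_def power_divide flip: ennreal_mult')
    finally show ?thesis ..
  qed
  then have "(\<integral>\<^sup>+y. ennreal ((contrast_ratio C D (vec n y))\<^sup>2) \<partial>?M) = (\<integral>\<^sup>+y. \<integral>\<^sup>+t. f y t \<partial>lborel \<partial>?M)" by simp
  also have "\<dots> = (\<integral>\<^sup>+t. \<integral>\<^sup>+y. f y t \<partial>?M \<partial>lborel)" by (rule Fubini'[OF f_meas, symmetric])
  also have "\<dots> = (\<integral>\<^sup>+t. ennreal S * (ennreal (t / ((1 + 2 * t)\<^sup>2 * sqrt ((1 + 2 * t) ^ m))) * indicator {0..} t) \<partial>lborel)"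
  proof (rule nn_integral_cong)
    fix t :: real
    show "(\<integral>\<^sup>+y. f y t \<partial>?M) = ennreal S * (ennreal (t / ((1 + 2 * t)\<^sup>2 * sqrt ((1 + 2 * t) ^ m))) * indicator {0..} t)"
    proof (cases "0 \<le> t")
      case True
      have "(\<integral>\<^sup>+y. f y t \<partial>?M) = (\<integral>\<^sup>+y. ennreal t * (ennreal ((contrast_form N (vec n y))\<^sup>2) *
          ennreal (exp (- t * contrast_form Gi (vec n y)))) \<partial>?M)"
        using True by (intro nn_integral_cong) (simp add: f_def ennreal_mult mult_ac)
      also have "\<dots> = ennreal t * (\<integral>\<^sup>+y. ennreal ((contrast_form N (vec n y))\<^sup>2) *
          ennreal (exp (- t * contrast_form Gi (vec n y))) \<partial>?M)"
        by (intro nn_integral_cmult) measurable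
      also have "\<dots> = ennreal t * ennreal (S / ((1 + 2 * t)\<^sup>2 * sqrt ((1 + 2 * t) ^ m)))"
        unfolding N_def mvn_tilted_second_moment[OF True D] S_def ..
      also have "\<dots> = ennreal (t * (S / ((1 + 2 * t)\<^sup>2 * sqrt ((1 + 2 * t) ^ m))))"
        by (rule ennreal_mult'[OF True, symmetric])
      also have "t * (S / ((1 + 2 * t)\<^sup>2 * sqrt ((1 + 2 * t) ^ m))) = S * (t / ((1 + 2 * t)\<^sup>2 * sqrt ((1 + 2 * t) ^ m)))"
        by simp
      also have "ennreal \<dots> = ennreal S * ennreal (t / ((1 + 2 * t)\<^sup>2 * sqrt ((1 + 2 * t) ^ m)))"
        using True by (intro ennreal_mult'') simp
      finally show ?thesis using True by simp
    qed (simp add: f_def)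
  qed
  also have "\<dots> = ennreal S * (\<integral>\<^sup>+t. ennreal (t / ((1 + 2 * t)\<^sup>2 * sqrt ((1 + 2 * t) ^ m))) * indicator {0..} t \<partial>lborel)"
    by (intro nn_integral_cmult) measurable
  also have "\<dots> = ennreal S * ennreal (1 / (real m * (real m + 2)))"
    using p_less_n by (subst nn_integral_tilt_tail) auto
  also have "\<dots> = ennreal (S * (1 / (real m * (real m + 2))))"
    by (intro ennreal_mult''[symmetric]) simp
  finally show ?thesis by (simp add: S_def)
qed

text \<open>
  To leave the extended reals one needs the sign of the right-hand side: the trace of \<open>(D G\<^sup>-\<^sup>1)\<^sup>2\<close>
  is the sum of the squared entries of the symmetric matrix \<open>L\<^sup>T D L\<close>, where \<open>G\<^sup>-\<^sup>1 = L L\<^sup>T\<close>.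
\<close>
lemma contrast_ratio_second_moment:
  assumes D: "D \<in> carrier_mat m m" "transpose_mat D = D"
  shows "has_bochner_integral (mvn n \<mu> C) (\<lambda>y. (contrast_ratio C D (vec n y))\<^sup>2)
    (((mtrace (D * Gi))\<^sup>2 + 2 * mtrace (D * Gi * (D * Gi))) / (real m * (real m + 2)))"
proof (rule has_bochner_integral_nn_integral)
  show "(\<lambda>y. (contrast_ratio C D (vec n y))\<^sup>2) \<in> borel_measurable (mvn n \<mu> C)"
    using contrast_ratio_measurable[OF C D(1)] by (simp cong: measurable_cong_sets add: mvn_def)
  obtain L where L: "L \<in> carrier_mat m m" "Gi = L * transpose_mat L"
    using cholesky[OF pos_def_minv[OF pos_def_contrast_cov[OF C]]] by metis
  define B where "B = transpose_mat L * D * L"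
  have B: "B \<in> carrier_mat m m" using L D by (simp add: B_def mult_carrier_mat[of _ m m _ m])
  have Bs: "transpose_mat B = B"
    unfolding B_def using L D by (simp add: transpose_mult[of _ m m _ m] mult_carrier_mat[of _ m m _ m])
  have "mtrace (D * Gi * (D * Gi)) = mtrace (B * B)"
    using L D mtrace_comm[of "transpose_mat L" m m "D * (L * (transpose_mat L * (D * L)))"]
    by (simp add: B_def assoc_mult_mat[of _ m m _ m _ m] mult_carrier_mat[of _ m m _ m])
  also have "\<dots> = (\<Sum>i<m. \<Sum>j<m. (B $$ (i, j))\<^sup>2)"
  proof -
    have "B $$ (j, i) = B $$ (i, j)" if "i < m" "j < m" for i j
      using that B Bs by (metis carrier_matD index_transpose_mat(1))
    then show ?thesis
      using B by (auto simp: mtrace_def scalar_prod_def atLeast0LessThan power2_eq_square intro!: sum.cong)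
  qed
  also have "0 \<le> \<dots>" by (intro sum_nonneg) simp
  finally show "0 \<le> ((mtrace (D * Gi))\<^sup>2 + 2 * mtrace (D * Gi * (D * Gi))) / (real m * (real m + 2))"
    by simp
qed (use nn_integral_contrast_ratio_square[OF D] in auto)

text \<open>
  Adding \<open>G\<close> to \<open>D\<close> adds \<open>1\<close> to the ratio almost surely. Comparing the second moments for \<open>D\<close>
  and \<open>D + G\<close> isolates the mean.
\<close>
lemma contrast_ratio_mean:
  assumes D: "D \<in> carrier_mat m m" "transpose_mat D = D"
  shows "has_bochner_integral (mvn n \<mu> C) (\<lambda>y. contrast_ratio C D (vec n y)) (mtrace (D * Gi) / real m)"
proof -
  let ?M = "mvn n \<mu> C"
  let ?R = "\<lambda>y. contrast_ratio C D (vec n y)"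
  interpret prob_space ?M by (rule prob_space_mvn)
  have R_meas: "?R \<in> borel_measurable ?M"
    using contrast_ratio_measurable[OF C D(1)] by (simp cong: measurable_cong_sets add: mvn_def)
  note sq = contrast_ratio_second_moment[OF D]
  have int: "integrable ?M ?R"
    using square_integrable_imp_integrable[OF R_meas] sq by (simp add: has_bochner_integral_iff)
  have Gs: "transpose_mat G = G" by (rule pos_def_sym[OF pos_def_contrast_cov[OF C]])
  have DG: "D + G \<in> carrier_mat m m" "transpose_mat (D + G) = D + G"
    using D mvn_carriers Gs by (auto simp: transpose_add)
  have DGi: "D * Gi \<in> carrier_mat m m" using mvn_carriers D by (simp add: mult_carrier_mat[of _ m m _ m])
  have e: "(D + G) * Gi = D * Gi + 1\<^sub>m m"
    using mvn_carriers D by (simp add: add_mult_distrib_mat[of _ m m _ _ m])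
  have tr1: "mtrace ((D + G) * Gi) = mtrace (D * Gi) + real m"
    unfolding e using DGi by (subst mtrace_add[of _ m]) (auto simp: mtrace_def)
  have "(D * Gi + 1\<^sub>m m) * (D * Gi + 1\<^sub>m m) = (D * Gi * (D * Gi) + D * Gi) + (D * Gi + 1\<^sub>m m)"
  proof -
    define X where "X = D * Gi"
    have X: "X \<in> carrier_mat m m" using DGi by (simp add: X_def)
    show ?thesis unfolding X_def[symmetric]
      using X by (simp add: add_mult_distrib_mat[of _ m m _ _ m] mult_add_distrib_mat[of _ m m _ m])
  qed
  then have tr2: "mtrace ((D + G) * Gi * ((D + G) * Gi)) = mtrace (D * Gi * (D * Gi)) + 2 * mtrace (D * Gi) + real m"
    unfolding e using DGi mult_carrier_mat[OF DGi DGi] by (simp add: mtrace_add[of _ m]) (simp add: mtrace_def)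
  define S where "S = ((mtrace (D * Gi))\<^sup>2 + 2 * mtrace (D * Gi * (D * Gi))) / (real m * (real m + 2))"
  have "AE y in ?M. (contrast_ratio C (D + G) (vec n y))\<^sup>2 = (?R y)\<^sup>2 + 2 * ?R y + 1"
    using AE_contrast_nonzero
  proof eventually_elim
    fix y assume "transpose_mat W *\<^sub>v vec n y \<noteq> 0\<^sub>v m"
    then have pos: "0 < contrast_form Gi (vec n y)" using contrast_form_pos_iff(1)[OF C, of "vec n y"] by simp
    have c: "Gi * D * Gi \<in> carrier_mat m m" using mvn_carriers D by (simp add: mult_carrier_mat[of _ m m _ m])
    have "Gi * (D + G) * Gi = Gi * D * Gi + Gi"
      using mvn_carriers D by (simp add: add_mult_distrib_mat[of _ m m _ _ m] mult_add_distrib_mat[of _ m m _ m] mult_carrier_mat[of _ m m _ m])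
    then have "contrast_form (Gi * (D + G) * Gi) (vec n y) = contrast_form (Gi * D * Gi) (vec n y) + contrast_form Gi (vec n y)"
      using c mvn_carriers W by (simp add: contrast_form_def add_mult_distrib_mat_vec[of _ m m] scalar_prod_add_distrib[of _ m])
    then have "contrast_ratio C (D + G) (vec n y) = ?R y + 1"
      using pos by (simp add: contrast_ratio_def field_simps)
    then show "(contrast_ratio C (D + G) (vec n y))\<^sup>2 = (?R y)\<^sup>2 + 2 * ?R y + 1"
      by (simp add: power2_eq_square algebra_simps)
  qed
  then have "(\<integral>y. (contrast_ratio C (D + G) (vec n y))\<^sup>2 \<partial>?M) = (\<integral>y. (?R y)\<^sup>2 + 2 * ?R y + 1 \<partial>?M)"
    using R_meas contrast_ratio_measurable[OF C DG(1)]
    by (intro integral_cong_AE) (auto cong: measurable_cong_sets simp: mvn_def)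
  also have "\<dots> = S + 2 * (\<integral>y. ?R y \<partial>?M) + 1"
    using sq int by (simp add: has_bochner_integral_iff S_def prob_space)
  finally have "((mtrace (D * Gi) + real m)\<^sup>2 + 2 * (mtrace (D * Gi * (D * Gi)) + 2 * mtrace (D * Gi) + real m)) / (real m * (real m + 2)) =
      S + 2 * (\<integral>y. ?R y \<partial>?M) + 1"
    using contrast_ratio_second_moment[OF DG] by (simp add: has_bochner_integral_iff tr1 tr2)
  moreover have "((a + m)\<^sup>2 + 2 * (b + 2 * a + m)) / (m * (m + 2)) = (a\<^sup>2 + 2 * b) / (m * (m + 2)) + 2 * (a / m) + 1"
    if "0 < m" for a b m :: real
    using that by (simp add: divide_simps) (simp add: power2_eq_square algebra_simps)
  from this[of "real m" "mtrace (D * Gi)" "mtrace (D * Gi * (D * Gi))"] p_less_n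
  have "((mtrace (D * Gi) + real m)\<^sup>2 + 2 * (mtrace (D * Gi * (D * Gi)) + 2 * mtrace (D * Gi) + real m)) / (real m * (real m + 2)) =
      S + 2 * (mtrace (D * Gi) / real m) + 1" by (simp add: S_def)
  ultimately show ?thesis using int by (simp add: has_bochner_integral_iff)
qed

end

text \<open>
  The variance parameter multiplies the covariance and its derivative alike and cancels, which is
  why the Fisher information does not depend on it.
\<close>
lemma contrast_ratio_smult:
  assumes C: "pos_def_mat n C" and D: "D \<in> carrier_mat m m" and s: "0 < s" and y: "y \<in> carrier_vec n"
  shows "contrast_ratio (s \<cdot>\<^sub>m C) (s \<cdot>\<^sub>m D) y = contrast_ratio C D y"
    and "s \<cdot>\<^sub>m D * minv (contrast_cov (s \<cdot>\<^sub>m C)) = D * minv (contrast_cov C)"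
proof -
  note pG = pos_def_contrast_cov[OF C]
  note G = pos_def_carrier[OF pG] and Gi = minv_carrier[OF pos_def_carrier[OF pG] pos_def_det_nonzero[OF pG]]
  define g where "g = minv (contrast_cov C)"
  have g: "g \<in> carrier_mat m m" using Gi by (simp add: g_def)
  have "contrast_cov (s \<cdot>\<^sub>m C) = s \<cdot>\<^sub>m contrast_cov C"
  proof -
    have Ws: "transpose_mat W * C \<in> carrier_mat m n" using W pos_def_carrier[OF C] by (simp add: mult_carrier_mat[of _ m n _ n])
    show ?thesis
      using mult_smult_distrib[OF _ pos_def_carrier[OF C], of "transpose_mat W" m s] mult_smult_assoc_mat[OF Ws W] W by simp
  qed
  then have gs: "minv (contrast_cov (s \<cdot>\<^sub>m C)) = (1 / s) \<cdot>\<^sub>m g"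
    using minv_smult[OF G pos_def_det_nonzero[OF pG], of s] s by (simp add: g_def)
  have Dg: "s \<cdot>\<^sub>m D * ((1 / s) \<cdot>\<^sub>m g) = D * g"
  proof -
    have "s \<cdot>\<^sub>m D * ((1 / s) \<cdot>\<^sub>m g) = s \<cdot>\<^sub>m ((1 / s) \<cdot>\<^sub>m (D * g))"
      using mult_smult_assoc_mat[OF D smult_carrier_mat[OF g]] mult_smult_distrib[OF D g] by simp
    then show ?thesis using s by (auto intro!: eq_matI)
  qed
  then show "s \<cdot>\<^sub>m D * minv (contrast_cov (s \<cdot>\<^sub>m C)) = D * minv (contrast_cov C)" by (simp add: gs g_def)
  have "(1 / s) \<cdot>\<^sub>m g * (s \<cdot>\<^sub>m D) * ((1 / s) \<cdot>\<^sub>m g) = (1 / s) \<cdot>\<^sub>m g * (D * g)"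
    using assoc_mult_mat[OF smult_carrier_mat[OF g] smult_carrier_mat[OF D] smult_carrier_mat[OF g]] Dg by simp
  also have "\<dots> = (1 / s) \<cdot>\<^sub>m (g * D * g)"
    using mult_smult_assoc_mat[OF g mult_carrier_mat[OF D g]] assoc_mult_mat[OF g D g] by simp
  finally have N: "(1 / s) \<cdot>\<^sub>m g * (s \<cdot>\<^sub>m D) * ((1 / s) \<cdot>\<^sub>m g) = (1 / s) \<cdot>\<^sub>m (g * D * g)" .
  have "contrast_form ((1 / s) \<cdot>\<^sub>m N) y = contrast_form N y / s" if "N \<in> carrier_mat m m" for N
  proof -
    have z: "transpose_mat W *\<^sub>v y \<in> carrier_vec m" using W y by simp
    show ?thesis using that z by (simp add: contrast_form_def smult_mat_mult_vec[OF that z])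
  qed
  note form = this[OF g] this[OF mult_carrier_mat[OF mult_carrier_mat[OF g D] g]]
  show "contrast_ratio (s \<cdot>\<^sub>m C) (s \<cdot>\<^sub>m D) y = contrast_ratio C D y"
    unfolding contrast_ratio_def gs N form g_def[symmetric] using s by simp
qed

section \<open>The integrated likelihood\<close>

definition likelihood_const :: real where
  "likelihood_const = 1 / sqrt ((2 * pi) ^ m * (det (transpose_mat H * H) / det (transpose_mat W * W)))"

lemma likelihood_const_pos: "0 < likelihood_const"
  using pos_def_gram pos_def_det_pos by (simp add: likelihood_const_def)

text \<open>
  For fixed \<open>s\<close> the integral over the mean parameter is Gaussian by \<open>residual_decomposition\<close>; what
  remains is the integrand of \<open>radial\<close>. By Tonelli the formula also covers divergent integrals:
  then both sides are \<open>0\<close>.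
\<close>
lemma integrated_likelihood_eq:
  assumes C: "pos_def_mat n (\<Sigma> \<theta>)"
  shows "uk_integrated_likelihood n p H \<Sigma> \<theta> y = likelihood_const / sqrt (det (contrast_cov (\<Sigma> \<theta>))) *
    enn2real (radial m (contrast_form (minv (contrast_cov (\<Sigma> \<theta>))) (vec n y)))"
proof -
  define C where "C = \<Sigma> \<theta>"
  have C': "pos_def_mat n C" using C by (simp add: C_def)
  define Q where "Q = contrast_form (minv (contrast_cov C)) (vec n y)"
  define A where "A = mean_precision C"
  have A: "pos_def_mat p A" unfolding A_def by (rule pos_def_mean_precision[OF C'])
  have Ac: "A \<in> carrier_mat p p" by (rule pos_def_carrier[OF A])
  note Cc = pos_def_carrier[OF C'] and Cd = pos_def_det_nonzero[OF C'] and Cp = pos_def_det_pos[OF C']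
  obtain a where a: "a \<in> carrier_vec p" and
    dec: "\<And>b. b \<in> carrier_vec p \<Longrightarrow> (vec n y - H *\<^sub>v b) \<bullet> (minv C *\<^sub>v (vec n y - H *\<^sub>v b)) =
      (b - a) \<bullet> (A *\<^sub>v (b - a)) + Q"
    using residual_decomposition[OF C', of "vec n y"] unfolding Q_def A_def contrast_form_def by auto
  \<comment> \<open>the part of the integrand that does not involve the mean parameter\<close>
  define k where "k s = 1 / sqrt ((2 * pi) ^ n * (s ^ n * det C)) * exp (- Q / (2 * s)) * (1 / s)" for s
  define g where "g b s = indicator {0<..} s * (exp (- (((vec p b - a) \<bullet> (A *\<^sub>v (vec p b - a))) / s) / 2) * k s)" for b and s :: real
  have integrand: "indicator {0<..} s * (uk_likelihood n H \<Sigma> (vec p b) s \<theta> y * (1 / s)) = g b s" for b s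
  proof (cases "0 < s")
    case True
    have hb: "vec n y - H *\<^sub>v vec p b \<in> carrier_vec n" using H by simp
    have "(vec n y - H *\<^sub>v vec p b) \<bullet> (minv (s \<cdot>\<^sub>m C) *\<^sub>v (vec n y - H *\<^sub>v vec p b)) =
        (1 / s) * ((vec n y - H *\<^sub>v vec p b) \<bullet> (minv C *\<^sub>v (vec n y - H *\<^sub>v vec p b)))"
      using minv_smult[OF Cc Cd, of s] True hb minv_carrier[OF Cc Cd]
      by (simp add: smult_mat_mult_vec[OF minv_carrier[OF Cc Cd] hb])
    also have "\<dots> = ((vec p b - a) \<bullet> (A *\<^sub>v (vec p b - a))) / s + Q / s"
      by (simp add: dec add_divide_distrib)
    finally have quad: "(vec n y - H *\<^sub>v vec p b) \<bullet> (minv (s \<cdot>\<^sub>m C) *\<^sub>v (vec n y - H *\<^sub>v vec p b)) =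
      ((vec p b - a) \<bullet> (A *\<^sub>v (vec p b - a))) / s + Q / s" .
    have "exp (- (x / s + Q / s) / 2) = exp (- (x / s) / 2) * exp (- Q / (2 * s))" for x
      by (simp add: diff_divide_distrib mult.commute flip: exp_add)
    then have "uk_likelihood n H \<Sigma> (vec p b) s \<theta> y =
      exp (- (((vec p b - a) \<bullet> (A *\<^sub>v (vec p b - a))) / s) / 2) * (exp (- Q / (2 * s)) / sqrt ((2 * pi) ^ n * (s ^ n * det C)))"
      using Cc unfolding uk_likelihood_def mvn_density_def C_def[symmetric] quad by simp
    then show ?thesis by (simp add: g_def k_def mult_ac)
  qed (simp add: g_def)
  interpret P: sigma_finite_measure "lebesgue_Rn p" by (rule sigma_finite_lebesgue_Rn)
  interpret PL: pair_sigma_finite "lebesgue_Rn p" lborel by standard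
  have [measurable]: "(\<lambda>x. (vec p (fst x) - a) \<bullet> (A *\<^sub>v (vec p (fst x) - a))) \<in> borel_measurable (lebesgue_Rn p \<Otimes>\<^sub>M lborel)"
    using a Ac by (intro borel_measurable_quadratic_form)
      (auto intro: measurable_compose[OF measurable_fst measurable_lebesgue_Rn_component])
  have [measurable]: "k \<in> borel_measurable borel" unfolding k_def by measurable
  have g_meas: "(\<lambda>(b, s). g b s) \<in> borel_measurable (lebesgue_Rn p \<Otimes>\<^sub>M lborel)"
    unfolding g_def case_prod_unfold by measurable
  have k_nonneg: "0 \<le> k s" if "0 < s" for s unfolding k_def using that Cp by simp
  have g_nonneg: "0 \<le> g b s" for b s
    using k_nonneg[of s] by (auto simp: g_def indicator_def)
  have inner: "(\<integral>\<^sup>+b. ennreal (g b s) \<partial>lebesgue_Rn p) =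
      ennreal (likelihood_const / sqrt (det (contrast_cov C))) *
      ennreal (indicator {0<..} s * (exp (- Q / (2 * s)) / (s * sqrt (s ^ m))))" for s
  proof (cases "0 < s")
    case True
    have sA: "pos_def_mat p ((1 / s) \<cdot>\<^sub>m A)" using True by (intro pos_def_smult A) simp
    have q: "(vec p b - a) \<bullet> (((1 / s) \<cdot>\<^sub>m A) *\<^sub>v (vec p b - a)) = ((vec p b - a) \<bullet> (A *\<^sub>v (vec p b - a))) / s" for b
    proof -
      have v: "vec p b - a \<in> carrier_vec p" using a by simp
      show ?thesis using Ac v by (simp add: smult_mat_mult_vec[OF Ac v])
    qed
    have [measurable]: "(\<lambda>b. (vec p b - a) \<bullet> (A *\<^sub>v (vec p b - a))) \<in> borel_measurable (lebesgue_Rn p)"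
      using a Ac by (intro borel_measurable_quadratic_form) (auto intro: measurable_lebesgue_Rn_component)
    have "(\<integral>\<^sup>+b. ennreal (g b s) \<partial>lebesgue_Rn p) =
        (\<integral>\<^sup>+b. ennreal (k s) * ennreal (exp (- ((vec p b - a) \<bullet> (((1 / s) \<cdot>\<^sub>m A) *\<^sub>v (vec p b - a))) / 2)) \<partial>lebesgue_Rn p)"
      unfolding q using True k_nonneg[OF True] by (simp add: g_def mult.commute flip: ennreal_mult')
    also have "\<dots> = ennreal (k s) *
        (\<integral>\<^sup>+b. ennreal (exp (- ((vec p b - a) \<bullet> (((1 / s) \<cdot>\<^sub>m A) *\<^sub>v (vec p b - a))) / 2)) \<partial>lebesgue_Rn p)"
      unfolding q by (intro nn_integral_cmult) measurable
    also have "\<dots> = ennreal (k s) * ennreal (sqrt ((2 * pi) ^ p / det ((1 / s) \<cdot>\<^sub>m A)))"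
      by (simp only: gaussian_mass[OF sA a])
    also have "\<dots> = ennreal (k s * sqrt ((2 * pi) ^ p / det ((1 / s) \<cdot>\<^sub>m A)))"
      using k_nonneg[OF True] by (intro ennreal_mult'[symmetric])
    also have "k s * sqrt ((2 * pi) ^ p / det ((1 / s) \<cdot>\<^sub>m A)) =
       likelihood_const / sqrt (det (contrast_cov C)) * (exp (- Q / (2 * s)) / (s * sqrt (s ^ m)))"
    proof -
      have Ap: "0 < det A" by (rule pos_def_det_pos[OF A])
      have "(2 * pi) ^ n = (2 * pi) ^ p * (2 * pi) ^ m" "s ^ n = s ^ p * s ^ m"
        by (simp_all only: power_add[symmetric] n_eq)
      then have "sqrt ((2 * pi) ^ p / det ((1 / s) \<cdot>\<^sub>m A)) / sqrt ((2 * pi) ^ n * (s ^ n * det C)) =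
         sqrt (1 / ((2 * pi) ^ m * (det A * det C) * s ^ m))"
        using True Ac Ap Cp by (simp add: power_one_over divide_simps flip: real_sqrt_divide)
      also have "det A * det C = det (transpose_mat H * H) / det (transpose_mat W * W) * det (contrast_cov C)"
        unfolding A_def by (rule det_mean_precision[OF C'])
      finally have "sqrt ((2 * pi) ^ p / det ((1 / s) \<cdot>\<^sub>m A)) / sqrt ((2 * pi) ^ n * (s ^ n * det C)) =
        likelihood_const / sqrt (det (contrast_cov C)) / sqrt (s ^ m)"
        unfolding likelihood_const_def by (simp only: real_sqrt_divide real_sqrt_mult real_sqrt_one mult.assoc[symmetric]) simp
      moreover have "1 / v * e * (1 / s) * u = (u / v) * (e / s)" for u v e :: real by simp
      ultimately show ?thesis unfolding k_def by (simp only:) simp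
    qed
    also have "ennreal \<dots> = ennreal (likelihood_const / sqrt (det (contrast_cov C))) *
      ennreal (exp (- Q / (2 * s)) / (s * sqrt (s ^ m)))"
      using True by (intro ennreal_mult'') simp
    finally show ?thesis using True by simp
  qed (simp add: g_def)
  have "uk_integrated_likelihood n p H \<Sigma> \<theta> y = (\<integral>(b, s). g b s \<partial>(lebesgue_Rn p \<Otimes>\<^sub>M lborel))"
    unfolding uk_integrated_likelihood_def integrand ..
  also have "\<dots> = enn2real (\<integral>\<^sup>+(b, s). ennreal (g b s) \<partial>(lebesgue_Rn p \<Otimes>\<^sub>M lborel))"
    using g_meas g_nonneg by (subst integral_eq_nn_integral) (auto simp: case_prod_unfold)
  also have "(\<integral>\<^sup>+(b, s). ennreal (g b s) \<partial>(lebesgue_Rn p \<Otimes>\<^sub>M lborel)) = (\<integral>\<^sup>+s. \<integral>\<^sup>+b. ennreal (g b s) \<partial>lebesgue_Rn p \<partial>lborel)"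
    using g_meas by (subst PL.nn_integral_snd[symmetric]) (auto simp: case_prod_unfold)
  also have "\<dots> = ennreal (likelihood_const / sqrt (det (contrast_cov C))) * radial m Q"
    unfolding inner radial_def by (intro nn_integral_cmult) measurable
  also have "enn2real \<dots> = likelihood_const / sqrt (det (contrast_cov C)) * enn2real (radial m Q)"
    using likelihood_const_pos pos_def_det_pos[OF pos_def_contrast_cov[OF C']]
    by (simp add: enn2real_mult)
  finally show ?thesis by (simp add: Q_def C_def)
qed

end

section \<open>The score\<close>

text \<open>
  The score is affine in the contrast ratio only almost everywhere, so its own measurability has to
  be assumed: it cannot be inferred from that of \<open>R\<close>.
\<close>
lemma (in prob_space) variance_of_affine:
  fixes X R :: "'a \<Rightarrow> real"
  assumes X: "X \<in> borel_measurable M" and AE: "AE y in M. X y = a + b * R y"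
    and R1: "has_bochner_integral M R r1" and R2: "has_bochner_integral M (\<lambda>y. (R y)\<^sup>2) r2"
  shows "integrable M X" "integrable M (\<lambda>y. (X y)\<^sup>2)" "variance_of M X = b\<^sup>2 * (r2 - r1\<^sup>2)"
proof -
  note int = R1[unfolded has_bochner_integral_iff] R2[unfolded has_bochner_integral_iff]
  have [measurable]: "R \<in> borel_measurable M" using int by auto
  note X[measurable]
  have "integrable M (\<lambda>y. a + b * R y)" using int by (simp add: integrable_const)
  then show "integrable M X" by (rule integrable_cong_AE_imp) (use AE in auto)
  have sq: "(a + b * R y)\<^sup>2 = a\<^sup>2 + 2 * a * b * R y + b\<^sup>2 * (R y)\<^sup>2" for y
    by (simp add: power2_eq_square algebra_simps)
  have "integrable M (\<lambda>y. (a + b * R y)\<^sup>2)" unfolding sq using int by (simp add: integrable_const)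
  then show "integrable M (\<lambda>y. (X y)\<^sup>2)"
    by (rule integrable_cong_AE_imp) (use AE in \<open>auto elim: eventually_mono\<close>)
  have mean: "(LINT y|M. X y) = a + b * r1"
  proof -
    have "(LINT y|M. X y) = (LINT y|M. a + b * R y)" using AE by (intro integral_cong_AE) auto
    then show ?thesis using int by (simp add: prob_space)
  qed
  have "variance_of M X = (LINT y|M. b\<^sup>2 * ((R y)\<^sup>2 - 2 * r1 * R y + r1\<^sup>2))"
    unfolding variance_of_def mean
  proof (rule integral_cong_AE)
    show "AE y in M. (X y - (a + b * r1))\<^sup>2 = b\<^sup>2 * ((R y)\<^sup>2 - 2 * r1 * R y + r1\<^sup>2)"
      using AE by eventually_elim (simp add: power2_eq_square algebra_simps)
  qed measurable
  also have "\<dots> = b\<^sup>2 * (r2 - r1\<^sup>2)"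
    using int by (simp add: prob_space power2_eq_square)
  finally show "variance_of M X = b\<^sup>2 * (r2 - r1\<^sup>2)" .
qed

locale kriging_model = kriging_design +
  fixes \<Sigma> :: "real \<Rightarrow> real mat" and I :: "real set"
  assumes open_I: "open I" and pd: "\<And>\<theta>. \<theta> \<in> I \<Longrightarrow> pos_def_mat n (\<Sigma> \<theta>)"
    and diff: "\<And>\<theta>. \<theta> \<in> I \<Longrightarrow> mat_differentiable n \<Sigma> \<theta>"
begin

abbreviation "\<Gamma> \<theta> \<equiv> contrast_cov (\<Sigma> \<theta>)"
abbreviation "\<Gamma>' \<theta> \<equiv> contrast_cov (mat_deriv \<Sigma> \<theta>)"
abbreviation "L \<equiv> uk_integrated_likelihood n p H \<Sigma>"

lemma contrast_cov_props:
  assumes "\<theta> \<in> I"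
  shows "pos_def_mat m (\<Gamma> \<theta>)" "\<Gamma> \<theta> \<in> carrier_mat m m" "det (\<Gamma> \<theta>) \<noteq> 0" "0 < det (\<Gamma> \<theta>)" "minv (\<Gamma> \<theta>) \<in> carrier_mat m m"
    "mat_deriv \<Sigma> \<theta> \<in> carrier_mat n n" "\<Gamma>' \<theta> \<in> carrier_mat m m"
proof -
  show 1: "pos_def_mat m (\<Gamma> \<theta>)" by (rule pos_def_contrast_cov[OF pd[OF assms]])
  show 2: "\<Gamma> \<theta> \<in> carrier_mat m m" "det (\<Gamma> \<theta>) \<noteq> 0" by (rule pos_def_carrier[OF 1], rule pos_def_det_nonzero[OF 1])
  show "0 < det (\<Gamma> \<theta>)" by (rule pos_def_det_pos[OF 1])
  show "minv (\<Gamma> \<theta>) \<in> carrier_mat m m" by (rule minv_carrier[OF 2])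
  show 3: "mat_deriv \<Sigma> \<theta> \<in> carrier_mat n n" using pos_def_carrier[OF pd[OF assms]] by (simp add: mat_deriv_def)
  show "\<Gamma>' \<theta> \<in> carrier_mat m m" by (rule contrast_cov_carrier[OF 3])
qed

lemma \<Sigma>_has_derivative:
  assumes "\<theta> \<in> I" "k < n" "l < n"
  shows "((\<lambda>t. \<Sigma> t $$ (k, l)) has_real_derivative mat_deriv \<Sigma> \<theta> $$ (k, l)) (at \<theta>)"
  using diff[OF assms(1)] assms pos_def_carrier[OF pd[OF assms(1)]]
  by (simp add: mat_deriv_def mat_differentiable_def DERIV_deriv_iff_real_differentiable)

lemma cov_has_derivative:
  assumes \<theta>: "\<theta> \<in> I" and ij: "i < m" "j < m"
  shows "((\<lambda>t. \<Gamma> t $$ (i, j)) has_real_derivative \<Gamma>' \<theta> $$ (i, j)) (at \<theta>)"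
proof (rule has_field_derivative_transform_within_open[OF _ open_I \<theta>])
  show "((\<lambda>t. \<Sum>k<n. \<Sum>l<n. W $$ (k, i) * \<Sigma> t $$ (k, l) * W $$ (l, j)) has_real_derivative \<Gamma>' \<theta> $$ (i, j)) (at \<theta>)"
    unfolding contrast_cov_entry[OF contrast_cov_props(6)[OF \<theta>] ij]
    by (intro DERIV_sum DERIV_cmult_right DERIV_cmult \<Sigma>_has_derivative \<theta>) auto
  show "(\<Sum>k<n. \<Sum>l<n. W $$ (k, i) * \<Sigma> t $$ (k, l) * W $$ (l, j)) = \<Gamma> t $$ (i, j)" if "t \<in> I" for t
    by (rule contrast_cov_entry[OF pos_def_carrier[OF pd[OF that]] ij, symmetric])
qed

lemma cov_deriv_symmetric:
  assumes \<theta>: "\<theta> \<in> I" shows "transpose_mat (\<Gamma>' \<theta>) = \<Gamma>' \<theta>"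
proof -
  note D = contrast_cov_props(6)[OF \<theta>]
  have "mat_deriv \<Sigma> \<theta> $$ (l, k) = mat_deriv \<Sigma> \<theta> $$ (k, l)" if kl: "k < n" "l < n" for k l
  proof (rule DERIV_unique[OF \<Sigma>_has_derivative[OF \<theta> kl(2,1)]])
    show "((\<lambda>t. \<Sigma> t $$ (l, k)) has_real_derivative mat_deriv \<Sigma> \<theta> $$ (k, l)) (at \<theta>)"
    proof (rule has_field_derivative_transform_within_open[OF \<Sigma>_has_derivative[OF \<theta> kl] open_I \<theta>])
      show "\<Sigma> t $$ (k, l) = \<Sigma> t $$ (l, k)" if "t \<in> I" for t
        using pos_def_sym[OF pd[OF that]] pos_def_carrier[OF pd[OF that]] kl
        by (metis carrier_matD index_transpose_mat(1))
    qed
  qed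
  then have "transpose_mat (mat_deriv \<Sigma> \<theta>) = mat_deriv \<Sigma> \<theta>" using D by (intro eq_matI) auto
  moreover have "transpose_mat (\<Gamma>' \<theta>) = transpose_mat W * (transpose_mat (mat_deriv \<Sigma> \<theta>) * W)"
    using W D by (simp add: transpose_mult[of _ m n _ m] transpose_mult[of _ m n _ n] transpose_mult[of _ n n _ m]
        mult_carrier_mat[of _ n n _ m])
  ultimately show ?thesis using W D by simp
qed

lemma contrast_form_has_derivative:
  assumes \<theta>: "\<theta> \<in> I" and y: "y \<in> carrier_vec n"
  shows "((\<lambda>t. contrast_form (minv (\<Gamma> t)) y) has_real_derivative
    - contrast_form (minv (\<Gamma> \<theta>) * \<Gamma>' \<theta> * minv (\<Gamma> \<theta>)) y) (at \<theta>)"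
proof -
  define z where "z = transpose_mat W *\<^sub>v y"
  have z: "z \<in> carrier_vec m" using W y by (simp add: z_def)
  define X where "X = minv (\<Gamma> \<theta>) * \<Gamma>' \<theta> * minv (\<Gamma> \<theta>)"
  have X: "X \<in> carrier_mat m m"
    unfolding X_def by (intro mult_carrier_mat[of _ m m _ m] contrast_cov_props \<theta>)
  have sum: "contrast_form N y = (\<Sum>i<m. \<Sum>j<m. z $ i * N $$ (i, j) * z $ j)" if "N \<in> carrier_mat m m" for N
    unfolding contrast_form_def z_def[symmetric] using that z z by (rule quadratic_form_sum)
  have "((\<lambda>t. contrast_form (minv (\<Gamma> t)) y) has_real_derivative contrast_form ((- 1) \<cdot>\<^sub>m X) y) (at \<theta>)"
  proof (rule has_field_derivative_transform_within_open[OF _ open_I \<theta>])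
    show "((\<lambda>t. \<Sum>i<m. \<Sum>j<m. z $ i * minv (\<Gamma> t) $$ (i, j) * z $ j) has_real_derivative contrast_form ((- 1) \<cdot>\<^sub>m X) y) (at \<theta>)"
      unfolding sum[OF smult_carrier_mat[OF X]] unfolding X_def
      by (intro DERIV_sum DERIV_cmult_right DERIV_cmult
          minv_has_derivative[OF open_I \<theta> contrast_cov_props(2) contrast_cov_props(3) contrast_cov_props(7)[OF \<theta>] cov_has_derivative[OF \<theta>]]) auto
    show "(\<Sum>i<m. \<Sum>j<m. z $ i * minv (\<Gamma> t) $$ (i, j) * z $ j) = contrast_form (minv (\<Gamma> t)) y" if "t \<in> I" for t
      by (rule sum[OF contrast_cov_props(5)[OF that], symmetric])
  qed
  also have "contrast_form ((- 1) \<cdot>\<^sub>m X) y = - contrast_form X y"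
    using X z by (simp add: contrast_form_def smult_mat_mult_vec[OF X z] flip: z_def)
  finally show ?thesis by (simp add: X_def)
qed

lemma likelihood_eq:
  assumes "t \<in> I"
  shows "L t y = likelihood_const / sqrt (det (\<Gamma> t)) * enn2real (radial m (contrast_form (minv (\<Gamma> t)) (vec n y)))"
  by (rule integrated_likelihood_eq[of \<Sigma> t, OF pd[OF assms]])

definition score_offset :: "real \<Rightarrow> real" where
  "score_offset \<theta> = - deriv (\<lambda>t. det (\<Gamma> t)) \<theta> / (2 * det (\<Gamma> \<theta>))"

context
  fixes y :: "nat \<Rightarrow> real"
  assumes z: "transpose_mat W *\<^sub>v vec n y \<noteq> 0\<^sub>v m"
begin

private lemma form_pos: "t \<in> I \<Longrightarrow> 0 < contrast_form (minv (\<Gamma> t)) (vec n y)"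
  using contrast_form_pos_iff(1)[OF pd, of t "vec n y"] z by simp

private lemma likelihood_eq_powers:
  assumes "t \<in> I"
  shows "L t y = likelihood_const / sqrt (det (\<Gamma> t)) * (radial_const m / sqrt (contrast_form (minv (\<Gamma> t)) (vec n y) ^ m))"
  by (simp only: likelihood_eq[OF assms] enn2real_radial[OF form_pos[OF assms]])

lemma likelihood_pos: "t \<in> I \<Longrightarrow> 0 < L t y"
  using likelihood_eq_powers[of t] likelihood_const_pos radial_const_pos[of m] p_less_n contrast_cov_props(4)[of t] form_pos[of t]
  by simp

lemma log_likelihood_has_derivative:
  assumes \<theta>: "\<theta> \<in> I"
  shows "((\<lambda>t. ln (L t y)) has_real_derivative
    score_offset \<theta> + real m / 2 * contrast_ratio (\<Sigma> \<theta>) (\<Gamma>' \<theta>) (vec n y)) (at \<theta>)"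
proof (rule has_field_derivative_transform_within_open[OF _ open_I \<theta>])
  define Q where "Q t = contrast_form (minv (\<Gamma> t)) (vec n y)" for t
  define Q' where "Q' = contrast_form (minv (\<Gamma> \<theta>) * \<Gamma>' \<theta> * minv (\<Gamma> \<theta>)) (vec n y)"
  have dQ: "(Q has_real_derivative - Q') (at \<theta>)"
    unfolding Q_def Q'_def by (rule contrast_form_has_derivative[OF \<theta>]) simp
  have Q: "0 < Q \<theta>" using form_pos[OF \<theta>] by (simp add: Q_def)
  have "(\<lambda>t. det (\<Gamma> t)) differentiable (at \<theta>)"
    using cov_has_derivative[OF \<theta>] real_differentiable_def
    by (intro det_differentiable[OF open_I \<theta> contrast_cov_props(2)]) auto
  then have dG: "((\<lambda>t. det (\<Gamma> t)) has_real_derivative deriv (\<lambda>t. det (\<Gamma> t)) \<theta>) (at \<theta>)"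
    by (simp add: DERIV_deriv_iff_real_differentiable)
  note d = contrast_cov_props(4)[OF \<theta>]
  have "((\<lambda>t. ln likelihood_const + ln (radial_const m) - ln (det (\<Gamma> t)) / 2 - real m / 2 * ln (Q t)) has_real_derivative
      0 - inverse (det (\<Gamma> \<theta>)) * deriv (\<lambda>t. det (\<Gamma> t)) \<theta> / 2 - real m / 2 * (inverse (Q \<theta>) * (- Q'))) (at \<theta>)"
    by (intro DERIV_diff DERIV_const DERIV_cdivide DERIV_cmult DERIV_chain2[OF DERIV_ln] dQ dG d Q)
  moreover have "0 - inverse (det (\<Gamma> \<theta>)) * deriv (\<lambda>t. det (\<Gamma> t)) \<theta> / 2 - real m / 2 * (inverse (Q \<theta>) * (- Q')) =
      score_offset \<theta> + real m / 2 * contrast_ratio (\<Sigma> \<theta>) (\<Gamma>' \<theta>) (vec n y)"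
  proof -
    have "0 - inverse a * a' / 2 - k / 2 * (inverse q * (- q')) = - a' / (2 * a) + k / 2 * (q' / q)"
      for a a' k q q' :: real by (simp add: inverse_eq_divide)
    then show ?thesis by (simp only: score_offset_def contrast_ratio_def Q_def Q'_def)
  qed
  ultimately show "((\<lambda>t. ln likelihood_const + ln (radial_const m) - ln (det (\<Gamma> t)) / 2 - real m / 2 * ln (Q t)) has_real_derivative
      score_offset \<theta> + real m / 2 * contrast_ratio (\<Sigma> \<theta>) (\<Gamma>' \<theta>) (vec n y)) (at \<theta>)" by simp
  show "ln likelihood_const + ln (radial_const m) - ln (det (\<Gamma> t)) / 2 - real m / 2 * ln (Q t) = ln (L t y)" if t: "t \<in> I" for t
    using likelihood_const_pos radial_const_pos[of m] p_less_n contrast_cov_props(4)[OF t] form_pos[OF t]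
    by (simp add: likelihood_eq_powers[OF t] Q_def ln_mult ln_div ln_sqrt ln_realpow)
qed

end

text \<open>
  The integrated likelihood depends on \<open>y\<close> only through a form in the contrast, so the score takes one
  and the same value at all points with zero contrast; elsewhere the explicit formula applies. This makes
  the score measurable everywhere and not just up to a null set.
\<close>
lemma score_eq:
  assumes \<theta>: "\<theta> \<in> I"
  shows "score L \<theta> y = (if transpose_mat W *\<^sub>v vec n y = 0\<^sub>v m then score L \<theta> (\<lambda>_. 0)
    else score_offset \<theta> + real m / 2 * contrast_ratio (\<Sigma> \<theta>) (\<Gamma>' \<theta>) (vec n y))"
proof (cases "transpose_mat W *\<^sub>v vec n y = 0\<^sub>v m")
  case True
  have "vec n (\<lambda>_. 0) = (0\<^sub>v n :: real vec)" by (intro eq_vecI) auto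
  then have "transpose_mat W *\<^sub>v vec n (\<lambda>_. 0) = 0\<^sub>v m" using W by (simp add: mult_mat_zero_vec[of _ m n])
  then have "L t y = L t (\<lambda>_. 0)" if "t \<in> I" for t
    using True by (simp add: likelihood_eq[OF that] contrast_form_def)
  then have "\<forall>\<^sub>F t in nhds \<theta>. ln (L t y) = ln (L t (\<lambda>_. 0))"
    using eventually_nhds_in_open[OF open_I \<theta>] by (auto elim: eventually_mono)
  then show ?thesis using True by (simp add: score_def deriv_cong_ev)
next
  case False
  then show ?thesis using DERIV_imp_deriv[OF log_likelihood_has_derivative[OF False \<theta>]] by (simp add: score_def)
qed

text \<open>
  Under the sampling distribution with parameters \<open>(\<beta>, s)\<close>, the moments of the contrast ratio are
  those for the covariance \<open>s \<cdot>\<^sub>m \<Sigma> \<theta>\<close> and the derivative \<open>s \<cdot>\<^sub>m \<Gamma>' \<theta>\<close>.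
\<close>
lemma score_variance:
  fixes \<beta> :: "real vec" and s :: real
  defines "P \<equiv> \<lambda>\<theta>. uk_distr n H \<Sigma> (\<beta>, s) \<theta>" and "M \<equiv> \<lambda>\<theta>. \<Gamma>' \<theta> * minv (\<Gamma> \<theta>)"
  assumes \<theta>: "\<theta> \<in> I" and \<beta>: "\<beta> \<in> carrier_vec p" and s: "0 < s"
  shows "prob_space (P \<theta>)"
    and "AE y in P \<theta>. (\<forall>t\<in>I. 0 < L t y) \<and> (\<lambda>t. ln (L t y)) differentiable (at \<theta>)"
    and "integrable (P \<theta>) (score L \<theta>)" and "integrable (P \<theta>) (\<lambda>y. (score L \<theta> y)\<^sup>2)"
    and "variance_of (P \<theta>) (score L \<theta>) = real m / (2 * (real m + 2)) * (mtrace (M \<theta> * M \<theta>) - (mtrace (M \<theta>))\<^sup>2 / real m)"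
proof -
  define C where "C = s \<cdot>\<^sub>m \<Sigma> \<theta>"
  define \<mu> where "\<mu> = H *\<^sub>v \<beta>"
  have C: "pos_def_mat n C" unfolding C_def by (rule pos_def_smult[OF s pd[OF \<theta>]])
  have \<mu>: "\<mu> \<in> carrier_vec n" "transpose_mat W *\<^sub>v \<mu> = 0\<^sub>v m"
    using H W \<beta> assoc_mult_mat_vec[of "transpose_mat W" m n H p \<beta>] by (simp_all add: \<mu>_def WH zero_mat_mult_vec)
  have P: "P \<theta> = mvn n \<mu> C" by (simp add: P_def uk_distr_def C_def \<mu>_def)
  show ps: "prob_space (P \<theta>)" unfolding P by (rule prob_space_mvn[OF C \<mu>])
  interpret prob_space "P \<theta>" by (rule ps)
  have AE: "AE y in P \<theta>. transpose_mat W *\<^sub>v vec n y \<noteq> 0\<^sub>v m" unfolding P by (rule AE_contrast_nonzero[OF C \<mu>])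
  then show "AE y in P \<theta>. (\<forall>t\<in>I. 0 < L t y) \<and> (\<lambda>t. ln (L t y)) differentiable (at \<theta>)"
  proof eventually_elim
    case (elim y)
    then show ?case using likelihood_pos log_likelihood_has_derivative[OF _ \<theta>] real_differentiable_def by blast
  qed
  define R where "R y = contrast_ratio (\<Sigma> \<theta>) (\<Gamma>' \<theta>) (vec n y)" for y
  have sD: "s \<cdot>\<^sub>m \<Gamma>' \<theta> \<in> carrier_mat m m" "transpose_mat (s \<cdot>\<^sub>m \<Gamma>' \<theta>) = s \<cdot>\<^sub>m \<Gamma>' \<theta>"
    using contrast_cov_props(7)[OF \<theta>] cov_deriv_symmetric[OF \<theta>] by (simp_all add: transpose_smult)
  have Rs: "contrast_ratio C (s \<cdot>\<^sub>m \<Gamma>' \<theta>) (vec n y) = R y" for y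
    unfolding C_def R_def by (rule contrast_ratio_smult(1)[OF pd[OF \<theta>] contrast_cov_props(7)[OF \<theta>] s]) simp
  have Ms: "s \<cdot>\<^sub>m \<Gamma>' \<theta> * minv (contrast_cov C) = M \<theta>"
    unfolding C_def M_def by (rule contrast_ratio_smult(2)[OF pd[OF \<theta>] contrast_cov_props(7)[OF \<theta>] s, of "0\<^sub>v n"]) simp
  have R1: "has_bochner_integral (P \<theta>) R (mtrace (M \<theta>) / real m)"
    using contrast_ratio_mean[OF C \<mu> sD] unfolding P Rs Ms .
  have R2: "has_bochner_integral (P \<theta>) (\<lambda>y. (R y)\<^sup>2) (((mtrace (M \<theta>))\<^sup>2 + 2 * mtrace (M \<theta> * M \<theta>)) / (real m * (real m + 2)))"
    using contrast_ratio_second_moment[OF C \<mu> sD] unfolding P Rs Ms .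
  have X: "score L \<theta> \<in> borel_measurable (P \<theta>)"
  proof -
    have sets: "sets (P \<theta>) = sets (lebesgue_Rn n)" unfolding P by (rule sets_mvn[OF C \<mu>])
    have [measurable]: "R \<in> borel_measurable (P \<theta>)" using R1 by (auto simp: has_bochner_integral_iff)
    have [measurable]: "(\<lambda>y. contrast_form (minv (\<Gamma> \<theta>)) (vec n y)) \<in> borel_measurable (P \<theta>)"
      using contrast_form_measurable[OF contrast_cov_props(5)[OF \<theta>]] sets by (simp cong: measurable_cong_sets)
    have iff: "transpose_mat W *\<^sub>v vec n y = 0\<^sub>v m \<longleftrightarrow> contrast_form (minv (\<Gamma> \<theta>)) (vec n y) = 0" for y
      using contrast_form_pos_iff[OF pd[OF \<theta>], of "vec n y"] by simp linarith
    have "score L \<theta> = (\<lambda>y. if contrast_form (minv (\<Gamma> \<theta>)) (vec n y) = 0 then score L \<theta> (\<lambda>_. 0) else score_offset \<theta> + real m / 2 * R y)"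
      by (rule ext) (simp add: score_eq[OF \<theta>, of _] iff R_def)
    also have "\<dots> \<in> borel_measurable (P \<theta>)" by measurable
    finally show ?thesis .
  qed
  have "AE y in P \<theta>. score L \<theta> y = score_offset \<theta> + real m / 2 * R y"
    using AE by eventually_elim (simp add: score_eq[OF \<theta>] R_def)
  note V = variance_of_affine[OF X this R1 R2]
  show "integrable (P \<theta>) (score L \<theta>)" "integrable (P \<theta>) (\<lambda>y. (score L \<theta> y)\<^sup>2)" by (rule V)+
  have "(k / 2)\<^sup>2 * ((a\<^sup>2 + 2 * b) / (k * (k + 2)) - (a / k)\<^sup>2) = k / (2 * (k + 2)) * (b - a\<^sup>2 / k)"
    if "0 < k" for a b k :: real
    using that by (simp add: divide_simps) (simp add: power2_eq_square algebra_simps)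
  then show "variance_of (P \<theta>) (score L \<theta>) = real m / (2 * (real m + 2)) * (mtrace (M \<theta> * M \<theta>) - (mtrace (M \<theta>))\<^sup>2 / real m)"
    using p_less_n by (simp only: V(3) of_nat_0_less_iff zero_less_diff)
qed

end

section \<open>The reference prior\<close>

text \<open>
  The standard deviation of the score is \<open>\<kappa>\<close> times the square root in the formula, with
  \<open>\<kappa>\<^sup>2 = m / (2 * (m + 2))\<close> a function of \<open>m\<close> alone. Since the prior is determined only up to
  a positive factor, \<open>\<kappa>\<close> is absorbed into that factor, in both directions of the equivalence.
\<close>
theorem proposition4:
  fixes n p :: nat and H W :: "real mat" and \<Sigma> :: "real \<Rightarrow> real mat"
    and I :: "real set" and \<pi> :: "real \<Rightarrow> real"
  assumes "p < n"
    and "H \<in> carrier_mat n p" and "vec_space.rank n H = p"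
    and "W \<in> carrier_mat n (n - p)" and "vec_space.rank n W = n - p"
    and "vec_space.col_space n W = orth_complement n (vec_space.col_space n H)"
    and "open I" and "is_interval I"
    and "\<And>\<theta>. \<theta> \<in> I \<Longrightarrow> correlation_mat n (\<Sigma> \<theta>)"
    and "\<And>\<theta>. \<theta> \<in> I \<Longrightarrow> invertible_mat (\<Sigma> \<theta>)"
    and "\<And>\<theta>. \<theta> \<in> I \<Longrightarrow> mat_differentiable n \<Sigma> \<theta>"
  shows "uk_reference_prior n p H \<Sigma> I \<pi> \<longleftrightarrow>
    (\<exists>c>0. \<forall>\<theta>\<in>I. let M = transpose_mat W * mat_deriv \<Sigma> \<theta> * W * minv (transpose_mat W * \<Sigma> \<theta> * W) in
       \<pi> \<theta> = c * sqrt (mtrace (M ^\<^sub>m 2) - 1 / real (n - p) * (mtrace M)\<^sup>2))"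
proof -
  note H = assms(2) and W = assms(4)
  have WH: "transpose_mat W * H = 0\<^sub>m (n - p) p"
  proof (rule eq_matI)
    fix i j assume "i < dim_row (0\<^sub>m (n - p) p :: real mat)" "j < dim_col (0\<^sub>m (n - p) p :: real mat)"
    then have ij: "i < n - p" "j < p" by simp_all
    have "col H j \<bullet> col W i = 0"
      using col_in_col_space[OF W ij(1)] col_in_col_space[OF H ij(2)] unfolding assms(6) orth_complement_def by blast
    then show "(transpose_mat W * H) $$ (i, j) = 0\<^sub>m (n - p) p $$ (i, j)"
      using ij H W comm_scalar_prod[of "col H j" n "col W i"] by simp
  qed (use H W in auto)
  interpret kriging_model n p H W \<Sigma> I
  proof
    show "x = 0\<^sub>v p" if "x \<in> carrier_vec p" "H *\<^sub>v x = 0\<^sub>v n" for x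
      by (rule full_column_rank_inj[OF H assms(3) that])
    show "x = 0\<^sub>v (n - p)" if "x \<in> carrier_vec (n - p)" "W *\<^sub>v x = 0\<^sub>v n" for x
      by (rule full_column_rank_inj[OF W assms(5) that])
    show "pos_def_mat n (\<Sigma> \<theta>)" if "\<theta> \<in> I" for \<theta>
      using assms(9)[OF that] invertible_mat_det[OF _ assms(10)[OF that]]
      by (intro pos_semidef_invertible_imp_pos_def) (auto simp: correlation_mat_def)
  qed (use assms WH in auto)
  define M where "M \<theta> = transpose_mat W * mat_deriv \<Sigma> \<theta> * W * minv (transpose_mat W * \<Sigma> \<theta> * W)" for \<theta>
  define V where "V \<theta> = mtrace (M \<theta> ^\<^sub>m 2) - 1 / real (n - p) * (mtrace (M \<theta>))\<^sup>2" for \<theta>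
  define \<kappa> where "\<kappa> = sqrt (real m / (2 * (real m + 2)))"
  have \<kappa>: "0 < \<kappa>" using assms(1) by (simp add: \<kappa>_def)
  have sq: "M \<theta> ^\<^sub>m 2 = M \<theta> * M \<theta>" if "\<theta> \<in> I" for \<theta>
  proof -
    have "M \<theta> \<in> carrier_mat m m"
      unfolding M_def by (intro mult_carrier_mat[of _ m m _ m] contrast_cov_props that)
    then show ?thesis by (simp add: numeral_2_eq_2)
  qed
  have dev: "sqrt (variance_of (uk_distr n H \<Sigma> \<nu> \<theta>) (score L \<theta>)) = \<kappa> * sqrt (V \<theta>)"
    and reg: "prob_space (uk_distr n H \<Sigma> \<nu> \<theta>) \<and>
      (AE y in uk_distr n H \<Sigma> \<nu> \<theta>. (\<forall>t\<in>I. 0 < L t y) \<and> (\<lambda>t. ln (L t y)) differentiable (at \<theta>)) \<and>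
      integrable (uk_distr n H \<Sigma> \<nu> \<theta>) (score L \<theta>) \<and> integrable (uk_distr n H \<Sigma> \<nu> \<theta>) (\<lambda>y. (score L \<theta> y)\<^sup>2)"
    if \<theta>: "\<theta> \<in> I" and \<nu>: "\<nu> \<in> carrier_vec p \<times> {0<..}" for \<theta> \<nu>
  proof -
    obtain \<beta> s where \<nu>_eq: "\<nu> = (\<beta>, s)" and \<beta>: "\<beta> \<in> carrier_vec p" and s: "0 < s" using \<nu> by auto
    note score_variance[OF \<theta> \<beta> s]
    then show "prob_space (uk_distr n H \<Sigma> \<nu> \<theta>) \<and>
      (AE y in uk_distr n H \<Sigma> \<nu> \<theta>. (\<forall>t\<in>I. 0 < L t y) \<and> (\<lambda>t. ln (L t y)) differentiable (at \<theta>)) \<and>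
      integrable (uk_distr n H \<Sigma> \<nu> \<theta>) (score L \<theta>) \<and> integrable (uk_distr n H \<Sigma> \<nu> \<theta>) (\<lambda>y. (score L \<theta> y)\<^sup>2)"
      unfolding \<nu>_eq by blast
    have "variance_of (uk_distr n H \<Sigma> \<nu> \<theta>) (score L \<theta>) = real m / (2 * (real m + 2)) * V \<theta>"
      unfolding \<nu>_eq V_def sq[OF \<theta>] using score_variance(5)[OF \<theta> \<beta> s] by (simp add: M_def)
    then show "sqrt (variance_of (uk_distr n H \<Sigma> \<nu> \<theta>) (score L \<theta>)) = \<kappa> * sqrt (V \<theta>)"
      by (simp only: real_sqrt_mult \<kappa>_def)
  qed
  have *: "(prob_space (uk_distr n H \<Sigma> \<nu> \<theta>) \<and>
      (AE y in uk_distr n H \<Sigma> \<nu> \<theta>. (\<forall>t\<in>I. 0 < L t y) \<and> (\<lambda>t. ln (L t y)) differentiable (at \<theta>)) \<and>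
      integrable (uk_distr n H \<Sigma> \<nu> \<theta>) (score L \<theta>) \<and> integrable (uk_distr n H \<Sigma> \<nu> \<theta>) (\<lambda>y. (score L \<theta> y)\<^sup>2) \<and>
      \<pi> \<theta> = k * sqrt (variance_of (uk_distr n H \<Sigma> \<nu> \<theta>) (score L \<theta>))) \<longleftrightarrow> \<pi> \<theta> = k * (\<kappa> * sqrt (V \<theta>))"
    if "\<theta> \<in> I" "\<nu> \<in> carrier_vec p \<times> {0<..}" for k \<theta> \<nu>
    unfolding dev[OF that] using reg[OF that] by blast
  have "uk_reference_prior n p H \<Sigma> I \<pi> \<longleftrightarrow> (\<exists>k>0. \<forall>\<theta>\<in>I. \<forall>\<nu>\<in>(carrier_vec p :: real vec set) \<times> {0::real<..}. \<pi> \<theta> = k * (\<kappa> * sqrt (V \<theta>)))"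
    unfolding uk_reference_prior_def is_jeffreys_prior_def by (simp only: * cong: ball_cong)
  also have "\<dots> \<longleftrightarrow> (\<exists>k>0. \<forall>\<theta>\<in>I. \<pi> \<theta> = k * (\<kappa> * sqrt (V \<theta>)))"
  proof -
    have "(0\<^sub>v p, 1) \<in> (carrier_vec p :: real vec set) \<times> {0::real<..}" by simp
    then show ?thesis by blast
  qed
  also have "\<dots> \<longleftrightarrow> (\<exists>c>0. \<forall>\<theta>\<in>I. \<pi> \<theta> = c * sqrt (V \<theta>))"
  proof
    assume "\<exists>k>0. \<forall>\<theta>\<in>I. \<pi> \<theta> = k * (\<kappa> * sqrt (V \<theta>))"
    then obtain k where "0 < k" "\<forall>\<theta>\<in>I. \<pi> \<theta> = k * (\<kappa> * sqrt (V \<theta>))" by blast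
    then show "\<exists>c>0. \<forall>\<theta>\<in>I. \<pi> \<theta> = c * sqrt (V \<theta>)" using \<kappa> by (intro exI[of _ "k * \<kappa>"]) simp
  next
    assume "\<exists>c>0. \<forall>\<theta>\<in>I. \<pi> \<theta> = c * sqrt (V \<theta>)"
    then obtain c where "0 < c" "\<forall>\<theta>\<in>I. \<pi> \<theta> = c * sqrt (V \<theta>)" by blast
    then show "\<exists>k>0. \<forall>\<theta>\<in>I. \<pi> \<theta> = k * (\<kappa> * sqrt (V \<theta>))" using \<kappa> by (intro exI[of _ "c / \<kappa>"]) simp
  qed
  finally show ?thesis unfolding V_def M_def Let_def .
qed

end
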